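(* In the setting of the context, assume in addition that $f$ is $C^1$-smooth with exactly two critical points on each half-open interval of length $T$, that $a>0$, $b<0$, $h\in(\beta,T)$, and that the set of all $q\in[0,\beta)$ satisfying $\int_0^h e^{as}(f(q+h-s)-f(q))\,ds\ge0$ is a non-empty interval $(\beta_1,\beta)$. Suppose that the equation $$f(\tau)+b\int_0^{\frac1a\ln\frac b{a+b}}e^{-au}f(u+\tau)\,du=0$$ has a unique root $\tau\in(\beta_1,\beta)$, and that there is $\alpha\in(0,\beta)$ such that the solutions $u(t,p(q))$, $p(q)=\tilde f(q)$, are $U$-shaped for all $q\in(\alpha,\beta]$. If $\Delta(q)<0$ for $q\in(\alpha,\beta_1]$, then there is an increasing sequence (either finite or infinite) of real numbers $p_i$, with $$0<\tilde f(\tau)<p_1<\dots<p_j<\dots<\tilde f(\alpha),$$ such that $\mathcal R$ is differentiable on the intervals $D_1=[0,p_1),\dots,D_j=[p_{j-1},p_j),\dots$, strictly increasing on the interval $(0,\tilde f(\tau))$, and strictly decreasing on the interval $(\tilde f(\tau),p_1)$ and on every $D_j$, $j>1$. Moreover, $\mathcal R$ is right continuous at each $p_j$, and $\mathcal R(p_j-)=0$, $\mathcal R(0)=\mathcal R(p_j)$. Finally, $\mathcal R'$ is continuous on every $D_j$, $\mathcal R'(p)=\Delta(q(p))$, and $\mathcal R'(p_j-)<\mathcal R'(p_j+)$.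
   Context: Setting. $a,b\in\mathbb R$, $0<h<T$, and either ($a+b<0$ and $ah\le1$) or ($bh<-e^{ah-1}$ and $ah\ge1$); each case implies $a+b<0$. $f:\mathbb R\to\mathbb R$ is continuous and $T$-periodic, and there is $\beta\in(0,T)$ such that $f$ is strictly decreasing on $[0,\beta]$, strictly increasing on $[\beta,T]$, and $\min f=0$. Put $\tilde f=f/|a+b|$ and $K=\tilde f([0,\beta])=[0,\max\tilde f]$. The equation is $u'(t)=a\,u(t)+b\max_{s\in[t-h,t]}u(s)+f(t)$. Return map. For $p\in K$ let $q=q(p)\in[0,\beta]$ be the unique point with $\tilde f(q)=p$, and let $u(\cdot,p)$ be the solution of the equation for $t\ge q$ with $u(s,p)=p$ for $s\in[q-h,q]$. Let $\nu^*=\nu^*(q)$ be the smallest $\nu>q$ for which there is $\varepsilon>0$ with $u(\nu,p)=\max_{r\in[\nu-h,\nu+\varepsilon]}u(r,p)$ (such $\nu$ exists). Set $\mathcal R(p)=u(\nu^*,p)$; $\mathcal R$ maps $K$ into $K$. $U$-shaped solutions. The solution $u(t,p)$ is called $U$-shaped if on the interval $(q,\nu^*(q))$ it has only one critical point, in which it reaches its minimal value, and if in some left-side neighbourhood of $\nu^*(q)$ it satisfies the ordinary differential equation $u'(t)=(a+b)u(t)+f(t)$. Writing $U(t,p)=\max_{s\in[t-h,t]}u(s,p)$, for a $U$-shaped solution the interval $(q,\nu^*(q))$ is the disjoint union of $(q,\lambda(q)]$, $(\lambda(q),\mu(q)]$ and $(\mu(q),\nu^*(q))$, where either $\lambda(q)=q+h$,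 or $\lambda(q)=\mu(q)$ and the second interval is empty, such that $U(t,p)=p$ on the first, $U(t,p)=u(t-h,p)$ on the second, and $U(t,p)=u(t,p)$ on the third interval. For $q=\beta$ (that is, $p=0$) one has $\mu(\beta)=\beta$. $\Delta$. $v$ is the fundamental solution of $u'(t)=au(t)+bu(t-h)$ (that is, $v(t)=0$ for $t<0$, $v(0)=1$, and $v$ satisfies the equation for $t>0$), and $$\Delta(q)=\left(v(\mu(q)-q)+b\int_{\mu(q)-q-h}^{\mu(q)-q}v(s)\,ds\right)e^{(a+b)(\nu^*(q)-\mu(q))}.$$ $g(x-)$ and $g(x+)$ denote the left and right limits of $g$ at $x$.
   Formalization: α<β₁ is assumed (else f̃(τ)<f̃(α) can fail); the set of q may contain its left endpoint β₁ (by continuity it cannot be open); "one critical point" means one local extremum and is not required at q=β, where u increases throughout; the sequence may be empty. *)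

theory Defs
  imports "HOL-Analysis.Analysis" "HOL-Library.Extended_Nat"
begin

definition ftilde :: "real \<Rightarrow> real \<Rightarrow> (real \<Rightarrow> real) \<Rightarrow> real \<Rightarrow> real" where
  "ftilde a b f t = f t / \<bar>a + b\<bar>"

definition q_of :: "real \<Rightarrow> real \<Rightarrow> real \<Rightarrow> (real \<Rightarrow> real) \<Rightarrow> real \<Rightarrow> real" where
  "q_of a b \<beta> f p = (THE q. q \<in> {0..\<beta>} \<and> ftilde a b f q = p)"

(* For continuous u the supremum over the compact interval is the maximum. *)
definition running_max :: "real \<Rightarrow> (real \<Rightarrow> real) \<Rightarrow> real \<Rightarrow> real" where
  "running_max h u t = Sup (u ` {t - h..t})"

(* At the initial time t = q the derivative is one-sided; for t > q it is two-sided. *)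
definition is_solution ::
  "real \<Rightarrow> real \<Rightarrow> real \<Rightarrow> (real \<Rightarrow> real) \<Rightarrow> real \<Rightarrow> real \<Rightarrow> (real \<Rightarrow> real) \<Rightarrow> bool" where
  "is_solution a b h f q p u \<longleftrightarrow>
     continuous_on {q - h..} u \<and>
     (\<forall>s\<in>{q - h..q}. u s = p) \<and>
     (\<forall>t\<ge>q. (u has_real_derivative a * u t + b * running_max h u t + f t) (at t within {q..}))"

(* The solution u(., p) with p = ftilde q, indexed by q instead of p.  Its domain is [q - h, oo);
   outside of it the function has the fixed dummy value of the set extensional, so that it is unique. *)
definition sol :: "real \<Rightarrow> real \<Rightarrow> real \<Rightarrow> (real \<Rightarrow> real) \<Rightarrow> real \<Rightarrow> real \<Rightarrow> real" where
  "sol a b h f q =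
     (THE u. u \<in> extensional {q - h..} \<and> is_solution a b h f q (ftilde a b f q) u)"

definition nu_star :: "real \<Rightarrow> real \<Rightarrow> real \<Rightarrow> (real \<Rightarrow> real) \<Rightarrow> real \<Rightarrow> real" where
  "nu_star a b h f q =
     (LEAST \<nu>. q < \<nu> \<and>
        (\<exists>\<epsilon>>0. sol a b h f q \<nu> = Sup (sol a b h f q ` {\<nu> - h..\<nu> + \<epsilon>})))"

definition return_map :: "real \<Rightarrow> real \<Rightarrow> real \<Rightarrow> real \<Rightarrow> (real \<Rightarrow> real) \<Rightarrow> real \<Rightarrow> real" where
  "return_map a b h \<beta> f p =
     (let q = q_of a b \<beta> f p in sol a b h f q (nu_star a b h f q))"

(* A critical point at which u turns, i.e. not an inflection point. *)
definition turning_point :: "(real \<Rightarrow> real) \<Rightarrow> real \<Rightarrow> bool" where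
  "turning_point u t \<longleftrightarrow>
     (u has_real_derivative 0) (at t) \<and>
     ((\<forall>\<^sub>F s in at t. u t \<le> u s) \<or> (\<forall>\<^sub>F s in at t. u s \<le> u t))"

(* "Only one critical point" is read as "only one turning point".  Points where the solution
   increases through a zero of its derivative must be admitted: a discontinuity of the return map
   occurs exactly when u = f = 0 at some \<beta> + k T in (q, nu_star q), and there u' = (a + b) u + f = 0.

   For q = \<beta> the descending branch of the U is absent: the initial value 0 is already the minimum
   and u increases on all of (\<beta>, nu_star \<beta>).  Only the second clause is then imposed. *)
definition U_shaped :: "real \<Rightarrow> real \<Rightarrow> real \<Rightarrow> real \<Rightarrow> (real \<Rightarrow> real) \<Rightarrow> real \<Rightarrow> bool" where
  "U_shaped a b h \<beta> f q \<longleftrightarrow>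
     (let u = sol a b h f q; \<nu> = nu_star a b h f q in
        (q < \<beta> \<longrightarrow> (\<exists>m. {t \<in> {q<..<\<nu>}. turning_point u t} = {m} \<and> (\<forall>t\<in>{q<..<\<nu>}. u m \<le> u t))) \<and>
        (\<exists>\<delta>>0. \<forall>t\<in>{\<nu> - \<delta><..<\<nu>}. (u has_real_derivative (a + b) * u t + f t) (at t)))"

definition switching ::
  "real \<Rightarrow> real \<Rightarrow> real \<Rightarrow> (real \<Rightarrow> real) \<Rightarrow> real \<Rightarrow> real \<Rightarrow> real \<Rightarrow> bool" where
  "switching a b h f q l m \<longleftrightarrow>
     (let u = sol a b h f q; U = running_max h u; \<nu> = nu_star a b h f q in
        q \<le> l \<and> l \<le> m \<and> m < \<nu> \<and> (l = q + h \<or> l = m) \<and>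
        (\<forall>t\<in>{q<..l}. U t = ftilde a b f q) \<and>
        (\<forall>t\<in>{l<..m}. U t = u (t - h)) \<and>
        (\<forall>t\<in>{m<..<\<nu>}. U t = u t))"

(* For q = \<beta> the first two intervals are empty, and the value is \<beta>. *)
definition mu :: "real \<Rightarrow> real \<Rightarrow> real \<Rightarrow> (real \<Rightarrow> real) \<Rightarrow> real \<Rightarrow> real" where
  "mu a b h f q = (THE m. \<exists>l. switching a b h f q l m)"

(* v is continuous on [0, oo), but v(t - h) jumps at t = h, where v has only one-sided derivatives;
   hence the equation is required at all t > 0 other than h. *)
definition fundamental_solution :: "real \<Rightarrow> real \<Rightarrow> real \<Rightarrow> real \<Rightarrow> real" where
  "fundamental_solution a b h =
     (THE v. (\<forall>t<0. v t = 0) \<and> v 0 = 1 \<and> continuous_on {0..} v \<and>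
        (\<forall>t>0. t \<noteq> h \<longrightarrow> (v has_real_derivative a * v t + b * v (t - h)) (at t)))"

definition Delta :: "real \<Rightarrow> real \<Rightarrow> real \<Rightarrow> (real \<Rightarrow> real) \<Rightarrow> real \<Rightarrow> real" where
  "Delta a b h f q =
     (let v = fundamental_solution a b h; m = mu a b h f q in
        (v (m - q) + b * integral {m - q - h..m - q} v) * exp ((a + b) * (nu_star a b h f q - m)))"

end

theory Submission
  imports Defs
begin

text \<open>Write c = -(a + b) > 0 and let G(t) be the integral of e^(cs) f(s) over [0, t].  Wherever a solution
u equals its own running maximum U it obeys the scalar equation u' = -c u + f, which says that
e^(ct) u(t) - G(t) is constant; in general this quantity has derivative b e^(ct) (U - u) \<le> 0.  So
from the switching time \<mu> on, a U-shaped solution is described by one number C.  It increases as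
long as u \<le> f/c, that is, as long as C \<le> E(t) with E(t) = e^(ct) f(t)/c - G(t), and it returns at
the time \<nu> where E falls below C, with the value f(\<nu>)/c.

The function E is strictly monotone wherever f is, with the same sense, and its minima
level k = E(kT + \<beta>) = -G(kT + \<beta>) decrease to -\<infinity>.  Hence \<nu> lies in the descending phase
[kT, kT + \<beta>) with the first k \<ge> 1 such that level k < C, and there \<nu> is the inverse of E at C
(\<open>N_in_phase\<close>).  When C sinks to level j, the time \<nu> runs into jT + \<beta>, where f = 0, and then jumps
to the next phase; the orbit that just touches zero at jT + \<beta> continues as a translate of the one
that starts from zero at \<beta>.  This is why R(p_j-) = 0 and R(p_j) = R(0).  Inside one phase the return
value is the maximum over the phase of the solution of u' = -c u + f with constant C, so it is a
differentiable function of C with derivative e^(-c \<nu>) (\<open>maximum_difference_lower\<close>, \<open>R_deriv\<close>), even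
where f' vanishes.

It remains to see how C depends on p.  Until both of two neighbouring solutions have switched, their
difference obeys the linear delay equation y' = a y + b y(t - h) with history 1; its solution Y is
the factor v(s) + b \<integral> v in the definition of \<Delta> (\<open>fundamental_solution_integral\<close>).  The switching
time is continuous, and the error made between the two switching times is of second order, so C is
differentiable with derivative e^(c \<mu>) Y(\<mu> - q) (\<open>orbit_level_slope\<close>); multiplied by e^(-c \<nu>) this is
\<Delta>.  For q between \<beta>1 and \<beta> the switch happens within one delay of q, where Y is elementary with a
single zero s0 = ln(b/(a+b))/a, and \<mu> - q = s0 is the equation that determines \<tau>.  By continuity of
\<mu> the slope changes sign only at \<tau> (\<open>peaked_if_unique_root\<close>): C rises from level 0 and then falls, and
the p_j are the points where the falling branch meets the levels.

The definite descriptions in the definitions have to be justified as well: solutions and the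
fundamental solution exist by a contraction argument (\<open>delay_equation_exists\<close>), and a first return
time exists (\<open>admissible_exists\<close>, \<open>least_admissible\<close>).  The
alternative between a h \<le> 1 and b h < -e^(ah-1) enters in the existence of a return time: it keeps a
solution from descending for ever.\<close>

lemma integral_has_derivative_right_ray:
  fixes g :: "real \<Rightarrow> real"
  assumes "continuous_on {q..} g" and "q \<le> t"
  shows "((\<lambda>x. integral {q..x} g) has_real_derivative g t) (at t within {q..})"
proof -
  have "((\<lambda>x. integral {q..x} g) has_real_derivative g t) (at t within {q..t+1})"
    by (rule integral_has_real_derivative) (use assms in \<open>auto intro: continuous_on_subset\<close>)
  moreover have "at t within {q..t+1} = at t within {q..}"
    by (rule at_within_nhd[of t "{..<t+1}"]) auto
  ultimately show ?thesis by simp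
qed

lemma has_derivative_interior:
  fixes u :: "real \<Rightarrow> real"
  assumes "(u has_real_derivative D) (at t within {q..})" and "q < t"
  shows "(u has_real_derivative D) (at t)"
proof -
  have "at t within {q..} = at t"
    by (rule at_within_interior) (use assms(2) in auto)
  then show ?thesis using assms(1) by simp
qed

lemma abs_integral_le_exp:
  fixes g :: "real \<Rightarrow> real"
  assumes "K > 0" "A \<ge> 0" "q \<le> t" and "continuous_on {q..} g"
    and bd: "\<And>s. q \<le> s \<Longrightarrow> \<bar>g s\<bar> \<le> A * exp (K * (s - q))"
  shows "\<bar>integral {q..t} g\<bar> \<le> A * exp (K * (t - q)) / K"
proof -
  have cg: "continuous_on {q..t} g" using assms(4) by (auto intro: continuous_on_subset)
  have hi: "((\<lambda>s. A * exp (K * (s - q))) has_integral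
      (A * exp (K * (t - q)) / K - A * exp (K * (q - q)) / K)) {q..t}"
  proof (rule fundamental_theorem_of_calculus)
    show "q \<le> t" by fact
    fix x assume "x \<in> {q..t}"
    have "((\<lambda>x. A * exp (K * (x - q)) / K) has_real_derivative A * exp (K * (x - q))) (at x within {q..t})"
      using \<open>K > 0\<close> by (auto intro!: derivative_eq_intros)
    then show "((\<lambda>x. A * exp (K * (x - q)) / K) has_vector_derivative A * exp (K * (x - q))) (at x within {q..t})"
      by (simp add: has_real_derivative_iff_has_vector_derivative)
  qed
  have "norm (integral {q..t} g) \<le> integral {q..t} (\<lambda>s. A * exp (K * (s - q)))"
    by (rule integral_norm_bound_integral)
      (use cg hi bd in \<open>auto intro: integrable_continuous_real\<close>)
  also have "\<dots> = A * exp (K * (t - q)) / K - A / K"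
    by (subst integral_unique[OF hi]) simp
  also have "\<dots> \<le> A * exp (K * (t - q)) / K" using assms(1,2) by simp
  finally show ?thesis by simp
qed

lemma first_nonneg_point:
  fixes \<phi> :: "real \<Rightarrow> real"
  assumes cont: "continuous_on {x..y} \<phi>" and z: "z \<in> {x..y}" "0 \<le> \<phi> z"
  obtains r where "r \<in> {x..y}" "0 \<le> \<phi> r" "\<And>t. x \<le> t \<Longrightarrow> t < r \<Longrightarrow> \<phi> t < 0"
proof -
  let ?A = "{x..y} \<inter> \<phi> -` {0..}"
  have "closed ?A" by (rule continuous_closed_preimage[OF cont]) auto
  moreover have "bounded ?A" by (rule bounded_subset[of "{x..y}"]) auto
  ultimately have "compact ?A" by (simp add: compact_eq_bounded_closed)
  then obtain r where "r \<in> ?A" "\<forall>t\<in>?A. r \<le> t"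
    using compact_attains_inf[of ?A] z by fast
  then show thesis by (intro that[of r]) (auto simp: not_less[symmetric])
qed

section \<open>A Gronwall inequality with delay\<close>

text \<open>The bound for D' may involve all of the last delay interval.  The majorant (M + \<delta>) e^(L(t-s))
is increasing, so up to the first time at which |D| meets it, it also majorizes the past values of
|D|, and the usual comparison applies.\<close>
lemma delay_gronwall:
  fixes D D' :: "real \<Rightarrow> real"
  assumes L: "0 \<le> L" and h: "0 \<le> h" and M: "0 \<le> M"
    and cont: "continuous_on {s - h..S} D"
    and init: "\<And>t. t \<in> {s - h..s} \<Longrightarrow> \<bar>D t\<bar> \<le> M"
    and deriv: "\<And>t. s < t \<Longrightarrow> t < S \<Longrightarrow> (D has_real_derivative D' t) (at t)"
    and bound: "\<And>t N. s < t \<Longrightarrow> t < S \<Longrightarrow> (\<And>r. r \<in> {t - h..t} \<Longrightarrow> \<bar>D r\<bar> \<le> N) \<Longrightarrow> \<bar>D' t\<bar> \<le> L * N"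
    and t: "t \<in> {s..S}"
  shows "\<bar>D t\<bar> \<le> M * exp (L * (t - s))"
proof -
  have strict: "\<bar>D t\<bar> < (M + \<delta>) * exp (L * (t - s))" if \<delta>: "\<delta> > 0" and t: "t \<in> {s..S}" for \<delta> t
  proof (rule ccontr)
    define \<phi> where "\<phi> = (\<lambda>t. (M + \<delta>) * exp (L * (t - s)))"
    have \<phi>mono: "\<phi> x \<le> \<phi> y" if "x \<le> y" for x y
      unfolding \<phi>_def using that L M \<delta> by (intro mult_left_mono) (auto intro!: mult_left_mono)
    assume nlt: "\<not> \<bar>D t\<bar> < (M + \<delta>) * exp (L * (t - s))"
    have cs: "continuous_on {s..S} D" using cont h by (auto intro: continuous_on_subset)
    have "continuous_on {s..S} (\<lambda>t. \<bar>D t\<bar> - \<phi> t)"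
      unfolding \<phi>_def by (intro continuous_intros cs)
    then obtain r where rS: "s \<le> r" "r \<le> S" "\<phi> r \<le> \<bar>D r\<bar>"
      and lt: "\<And>x. s \<le> x \<Longrightarrow> x < r \<Longrightarrow> \<bar>D x\<bar> < \<phi> x"
      by (rule first_nonneg_point[of s S _ t])
        (use t nlt in \<open>auto simp: \<phi>_def\<close>)
    have "\<bar>D s\<bar> \<le> M" using init[of s] h by simp
    moreover have "\<phi> s = M + \<delta>" by (simp add: \<phi>_def)
    ultimately have "s < r" using rS \<delta> by (cases "s = r") auto
    have below: "\<bar>D x\<bar> \<le> \<phi> x" if "s \<le> x" "x < r" for x
      using lt[OF that] by simp
    have dest: "\<bar>D' x\<bar> \<le> L * \<phi> x" if "s < x" "x < r" for x
    proof (rule bound)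
      fix y assume y: "y \<in> {x - h..x}"
      show "\<bar>D y\<bar> \<le> \<phi> x"
      proof (cases "y \<ge> s")
        case True then show ?thesis using below[of y] \<phi>mono[of y x] y that by auto
      next
        case False
        then have "\<bar>D y\<bar> \<le> M" using init y that by auto
        also have "\<dots> \<le> \<phi> s" by (simp add: \<phi>_def \<delta> less_imp_le)
        also have "\<dots> \<le> \<phi> x" using \<phi>mono that by simp
        finally show ?thesis .
      qed
    qed (use that rS in auto)
    have d\<phi>: "(\<phi> has_real_derivative L * \<phi> x) (at x)" for x
      unfolding \<phi>_def by (auto intro!: derivative_eq_intros)
    have cr: "continuous_on {s..r} D" using cs rS by (auto intro: continuous_on_subset)
    have c\<phi>: "continuous_on {s..r} \<phi>" unfolding \<phi>_def by (intro continuous_intros)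
    have "D r - \<phi> r \<le> D s - \<phi> s"
    proof (rule DERIV_nonpos_imp_decreasing_open[of s r "\<lambda>x. D x - \<phi> x"])
      fix x assume x: "s < x" "x < r"
      show "\<exists>y. ((\<lambda>x. D x - \<phi> x) has_real_derivative y) (at x) \<and> y \<le> 0"
        using deriv[of x] d\<phi>[of x] dest[OF x] x rS
        by (intro exI[of _ "D' x - L * \<phi> x"]) (auto intro!: derivative_intros)
    qed (use \<open>s < r\<close> cr c\<phi> in \<open>auto intro!: continuous_intros\<close>)
    moreover have "- D r - \<phi> r \<le> - D s - \<phi> s"
    proof (rule DERIV_nonpos_imp_decreasing_open[of s r "\<lambda>x. - D x - \<phi> x"])
      fix x assume x: "s < x" "x < r"
      show "\<exists>y. ((\<lambda>x. - D x - \<phi> x) has_real_derivative y) (at x) \<and> y \<le> 0"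
        using deriv[of x] d\<phi>[of x] dest[OF x] x rS
        by (intro exI[of _ "- D' x - L * \<phi> x"]) (auto intro!: derivative_intros)
    qed (use \<open>s < r\<close> cr c\<phi> in \<open>auto intro!: continuous_intros\<close>)
    ultimately show False using rS \<open>\<bar>D s\<bar> \<le> M\<close> \<open>\<phi> s = M + \<delta>\<close> \<delta> by auto
  qed
  show ?thesis
  proof (rule field_le_epsilon)
    fix e :: real assume "e > 0"
    define \<delta> where "\<delta> = e / exp (L * (t - s))"
    have "\<delta> > 0" using \<open>e > 0\<close> by (simp add: \<delta>_def)
    moreover have "\<delta> * exp (L * (t - s)) = e" by (simp add: \<delta>_def)
    ultimately show "\<bar>D t\<bar> \<le> M * exp (L * (t - s)) + e"
      using strict[OF _ t, of \<delta>] by (simp add: distrib_right)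
  qed
qed

section \<open>The running maximum\<close>

lemma running_max_upper:
  assumes "continuous_on {t - h..t} u" and "r \<in> {t - h..t}"
  shows "u r \<le> running_max h u t"
  unfolding running_max_def
  using assms compact_continuous_image[OF assms(1)]
  by (intro cSup_upper) (auto intro: compact_imp_bounded bounded_imp_bdd_above)

lemma running_max_attained:
  assumes "continuous_on {t - h..t} u" and "0 \<le> h"
  obtains s where "s \<in> {t - h..t}" "running_max h u t = u s"
proof -
  obtain s where s: "s \<in> {t - h..t}" "\<And>r. r \<in> {t - h..t} \<Longrightarrow> u r \<le> u s"
    using continuous_attains_sup[OF _ _ assms(1)] assms(2) by auto
  have "running_max h u t = u s"
    unfolding running_max_def using s by (intro cSup_eq_maximum) auto
  then show thesis using s that by blast
qed

lemma running_max_eqI: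
  assumes "\<And>r. r \<in> {t - h..t} \<Longrightarrow> u r \<le> y" and "s \<in> {t - h..t}" "u s = y"
  shows "running_max h u t = y"
  unfolding running_max_def using assms by (intro cSup_eq_maximum) auto

lemma running_max_cong:
  assumes "\<And>r. r \<in> {t - h..t} \<Longrightarrow> u r = w r"
  shows "running_max h u t = running_max h w t"
  unfolding running_max_def using assms by (metis image_cong)

lemma running_max_lipschitz:
  assumes u: "continuous_on {t - h..t} u" and w: "continuous_on {t - h..t} w" and h: "0 \<le> h"
    and le: "\<And>s. s \<in> {t - h..t} \<Longrightarrow> \<bar>u s - w s\<bar> \<le> M"
  shows "\<bar>running_max h u t - running_max h w t\<bar> \<le> M"
proof -
  obtain s where s: "s \<in> {t - h..t}" "running_max h u t = u s" using running_max_attained[OF u h] .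
  obtain r where r: "r \<in> {t - h..t}" "running_max h w t = w r" using running_max_attained[OF w h] .
  show ?thesis
    using s r le[OF s(1)] le[OF r(1)] running_max_upper[OF u r(1)] running_max_upper[OF w s(1)] by linarith
qed

lemma running_max_continuous:
  assumes u: "continuous_on {q - h..} u" and h: "0 \<le> h"
  shows "continuous_on {q..} (running_max h u)"
  unfolding continuous_on_iff
proof (intro ballI allI impI)
  fix t0 e :: real assume t0: "t0 \<in> {q..}" and "e > 0"
  have "uniformly_continuous_on {q - h..t0 + 1} u"
    by (rule compact_uniformly_continuous) (use u in \<open>auto intro: continuous_on_subset\<close>)
  then obtain d where d: "d > 0"
    "\<And>x y. x \<in> {q - h..t0 + 1} \<Longrightarrow> y \<in> {q - h..t0 + 1} \<Longrightarrow> dist y x < d \<Longrightarrow> dist (u y) (u x) < e / 2"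
    unfolding uniformly_continuous_on_def using \<open>e > 0\<close> by (metis half_gt_zero)
  have cw: "continuous_on {t - h..t} u" if "t \<ge> q" for t
    using u that by (auto intro: continuous_on_subset)
  have le: "running_max h u x \<le> running_max h u y + e / 2"
    if x: "x \<ge> q" "x \<le> t0 + 1" and y: "y \<ge> q" "y \<le> t0 + 1" "dist y x < d" for x y
  proof -
    obtain s where s: "s \<in> {x - h..x}" "running_max h u x = u s" using running_max_attained[OF cw[OF x(1)] h] .
    have "s + (y - x) \<in> {y - h..y}" using s by auto
    then have "u (s + (y - x)) \<le> running_max h u y" using running_max_upper[OF cw[OF y(1)]] by blast
    moreover have "dist (u (s + (y - x))) (u s) < e / 2"
      using s x y by (intro d(2)) (auto simp: dist_real_def)
    ultimately show ?thesis unfolding s(2) dist_real_def by linarith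
  qed
  show "\<exists>d>0. \<forall>x'\<in>{q..}. dist x' t0 < d \<longrightarrow> dist (running_max h u x') (running_max h u t0) < e"
  proof (intro exI[of _ "min d 1"] conjI ballI impI)
    fix x assume x: "x \<in> {q..}" "dist x t0 < min d 1"
    have "x \<le> t0 + 1" using x by (auto simp: dist_real_def)
    then show "dist (running_max h u x) (running_max h u t0) < e"
      using le[of x t0] le[of t0 x] x t0 \<open>e > 0\<close> by (auto simp: dist_real_def abs_minus_commute)
  qed (use d in auto)
qed

section \<open>Existence for delay equations\<close>

text \<open>Picard iteration converges on the whole half-line at once in the sup norm with weight
e^(-K(t-q)), K = 2(|a| + |b|) + 1: a Lipschitz, nonanticipating functional N becomes a contraction with
constant 1/2.  Both the running maximum and the shift u(t - h) are such functionals.\<close>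
lemma delay_equation_exists:
  fixes N :: "(real \<Rightarrow> real) \<Rightarrow> real \<Rightarrow> real"
  assumes N0: "\<And>t. q \<le> t \<Longrightarrow> N (\<lambda>_. 0) t = 0"
    and NL: "\<And>u w M t. continuous_on UNIV u \<Longrightarrow> continuous_on UNIV w \<Longrightarrow> q \<le> t \<Longrightarrow>
               (\<And>s. s \<le> t \<Longrightarrow> \<bar>u s - w s\<bar> \<le> M) \<Longrightarrow> \<bar>N u t - N w t\<bar> \<le> M"
    and NC: "\<And>u. continuous_on UNIV u \<Longrightarrow> continuous_on {q..} (N u)"
    and fc: "continuous_on {q..} f" and fB: "\<And>t. q \<le> t \<Longrightarrow> \<bar>f t\<bar> \<le> B"
  shows "\<exists>u. continuous_on UNIV u \<and> (\<forall>t\<le>q. u t = p) \<and>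
    (\<forall>t\<ge>q. (u has_real_derivative a * u t + b * N u t + f t) (at t within {q..}))"
proof -
  define \<Lambda> where "\<Lambda> = \<bar>a\<bar> + \<bar>b\<bar>"
  define K where "K = 2 * \<Lambda> + 1"
  have \<Lambda>: "\<Lambda> \<ge> 0" and K: "K > 0" by (auto simp: \<Lambda>_def K_def)
  have B: "B \<ge> 0" using fB[of q] by simp
  define \<omega> where "\<omega> = (\<lambda>t. exp (K * max 0 (t - q)))"
  have \<omega>1: "\<omega> t \<ge> 1" for t using K by (simp add: \<omega>_def)
  have \<omega>0: "\<omega> t > 0" for t by (simp add: \<omega>_def)
  have \<omega>mono: "\<omega> x \<le> \<omega> y" if "x \<le> y" for x y using that K by (simp add: \<omega>_def)
  have \<omega>q: "\<omega> t = exp (K * (t - q))" if "q \<le> t" for t using that by (simp add: \<omega>_def)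
  have c\<omega>: "continuous_on UNIV \<omega>" unfolding \<omega>_def by (intro continuous_intros)
  define W where "W = (\<lambda>w :: real \<Rightarrow>\<^sub>C real. \<lambda>t. \<omega> t * apply_bcontfun w t)"
  have cW: "continuous_on UNIV (W w)" for w unfolding W_def
    by (intro continuous_intros c\<omega> continuous_on_apply_bcontfun)
  define F where "F = (\<lambda>w t. a * W w t + b * N (W w) t + f t)"
  have cF: "continuous_on {q..} (F w)" for w
    unfolding F_def using cW[of w] NC[OF cW] fc
    by (intro continuous_intros) (auto intro: continuous_on_subset)
  define \<Phi> where "\<Phi> = (\<lambda>w t. (p + integral {q..max q t} (F w)) / \<omega> t)"
  have WL: "\<bar>W w s - W z s\<bar> \<le> \<omega> t * dist w z" if "s \<le> t" for w z s t
  proof -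
    have "\<bar>W w s - W z s\<bar> = \<omega> s * dist (apply_bcontfun w s) (apply_bcontfun z s)"
      using \<omega>0[of s] by (simp add: W_def dist_real_def abs_mult flip: right_diff_distrib)
    also have "\<dots> \<le> \<omega> t * dist w z"
      using \<omega>mono[OF that] \<omega>0[of s] dist_bounded[of w s z] by (intro mult_mono) auto
    finally show ?thesis .
  qed
  have FL: "\<bar>F w t - F z t\<bar> \<le> (\<Lambda> * dist w z) * exp (K * (t - q))" if "q \<le> t" for w z t
  proof -
    have 1: "\<bar>W w t - W z t\<bar> \<le> \<omega> t * dist w z" using WL by simp
    have 2: "\<bar>N (W w) t - N (W z) t\<bar> \<le> \<omega> t * dist w z"
      using NL[OF cW cW that] WL by blast
    have "F w t - F z t = a * (W w t - W z t) + b * (N (W w) t - N (W z) t)"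
      by (simp add: F_def algebra_simps)
    then have "\<bar>F w t - F z t\<bar> \<le> \<bar>a\<bar> * \<bar>W w t - W z t\<bar> + \<bar>b\<bar> * \<bar>N (W w) t - N (W z) t\<bar>"
      by (metis abs_mult abs_triangle_ineq)
    also have "\<dots> \<le> \<bar>a\<bar> * (\<omega> t * dist w z) + \<bar>b\<bar> * (\<omega> t * dist w z)"
      using 1 2 by (intro add_mono mult_left_mono) auto
    also have "\<dots> = (\<Lambda> * dist w z) * exp (K * (t - q))"
      unfolding \<omega>q[OF that] \<Lambda>_def by (simp add: algebra_simps)
    finally show ?thesis .
  qed
  have F0: "\<bar>F 0 t\<bar> \<le> B" if "q \<le> t" for t
  proof -
    have "W 0 = (\<lambda>_. 0)" by (simp add: W_def fun_eq_iff)
    then show ?thesis using N0[OF that] fB[OF that] by (simp add: F_def)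
  qed
  have FB: "\<bar>F w t\<bar> \<le> (\<Lambda> * norm w + B) * exp (K * (t - q))" if "q \<le> t" for w t
  proof -
    have "\<bar>F w t\<bar> \<le> \<bar>F w t - F 0 t\<bar> + \<bar>F 0 t\<bar>" by simp
    also have "\<dots> \<le> (\<Lambda> * norm w) * exp (K * (t - q)) + B * 1"
      using FL[OF that, of w 0] F0[OF that] by simp
    also have "\<dots> \<le> (\<Lambda> * norm w) * exp (K * (t - q)) + B * exp (K * (t - q))"
      using K B that by (intro add_left_mono mult_left_mono) auto
    finally show ?thesis by (simp add: algebra_simps)
  qed
  have der: "((\<lambda>x. p + integral {q..x} (F w)) has_real_derivative F w t) (at t within {q..})"
    if "q \<le> t" for w t
    using integral_has_derivative_right_ray[OF cF that, of w] by (auto intro!: derivative_eq_intros)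
  have ci: "continuous_on {q..} (\<lambda>x. p + integral {q..x} (F w))" for w
    using der by (intro DERIV_continuous_on) auto
  have c\<Phi>: "continuous_on UNIV (\<Phi> w)" for w
  proof -
    have "continuous_on UNIV (\<lambda>t. p + integral {q..max q t} (F w))"
      by (rule continuous_on_compose2[OF ci, of UNIV "\<lambda>t. max q t"]) (auto intro!: continuous_intros)
    moreover have "\<forall>t\<in>UNIV. \<omega> t \<noteq> 0" using \<omega>0 by (metis less_irrefl)
    ultimately show ?thesis unfolding \<Phi>_def using c\<omega> by (intro continuous_on_divide)
  qed
  have b\<Phi>: "\<Phi> w \<in> bcontfun" for w
  proof (rule bcontfun_normI[OF c\<Phi>])
    fix t
    define A where "A = \<Lambda> * norm w + B"
    have A: "A \<ge> 0" using \<Lambda> B by (simp add: A_def)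
    have "\<bar>integral {q..max q t} (F w)\<bar> \<le> A * exp (K * (max q t - q)) / K"
      by (rule abs_integral_le_exp[OF K A _ cF]) (use FB in \<open>auto simp: A_def\<close>)
    also have "\<dots> = (A / K) * \<omega> t" by (simp add: \<omega>_def max_def)
    finally have "\<bar>p + integral {q..max q t} (F w)\<bar> \<le> \<bar>p\<bar> * \<omega> t + (A / K) * \<omega> t"
      using mult_left_mono[OF \<omega>1[of t], of "\<bar>p\<bar>"] by simp
    then show "norm (\<Phi> w t) \<le> \<bar>p\<bar> + A / K"
      using \<omega>0[of t] by (simp add: \<Phi>_def divide_le_eq algebra_simps)
  qed
  define \<Psi> where "\<Psi> = (\<lambda>w. Bcontfun (\<Phi> w))"
  have \<Psi>: "apply_bcontfun (\<Psi> w) = \<Phi> w" for w using b\<Phi> by (simp add: \<Psi>_def Bcontfun_inverse)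
  have contr: "dist (\<Psi> w) (\<Psi> z) \<le> 1 / 2 * dist w z" for w z
  proof (rule dist_bound)
    fix t
    define A where "A = \<Lambda> * dist w z"
    have A: "A \<ge> 0" using \<Lambda> by (simp add: A_def)
    have int: "F w integrable_on {q..max q t}" for w
      by (rule integrable_continuous_real, rule continuous_on_subset[OF cF]) auto
    have "\<Phi> w t - \<Phi> z t = (integral {q..max q t} (F w) - integral {q..max q t} (F z)) / \<omega> t"
      by (simp add: \<Phi>_def flip: diff_divide_distrib)
    also have "integral {q..max q t} (F w) - integral {q..max q t} (F z)
        = integral {q..max q t} (\<lambda>t. F w t - F z t)"
      using int by (simp add: integral_diff)
    finally have eq: "\<Phi> w t - \<Phi> z t = integral {q..max q t} (\<lambda>t. F w t - F z t) / \<omega> t" .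
    have "\<bar>integral {q..max q t} (\<lambda>t. F w t - F z t)\<bar> \<le> A * exp (K * (max q t - q)) / K"
      by (rule abs_integral_le_exp[OF K A]) (use FL cF in \<open>auto simp: A_def intro!: continuous_intros\<close>)
    also have "\<dots> = (A / K) * \<omega> t" by (simp add: \<omega>_def max_def)
    finally have "\<bar>\<Phi> w t - \<Phi> z t\<bar> \<le> A / K"
      using \<omega>0[of t] by (simp add: eq divide_le_eq abs_div)
    also have "\<dots> \<le> 1 / 2 * dist w z"
      using K \<Lambda> mult_right_mono[of "2 * \<Lambda>" K "dist w z"] by (simp add: A_def K_def field_simps)
    finally show "dist (apply_bcontfun (\<Psi> w) t) (apply_bcontfun (\<Psi> z) t) \<le> 1 / 2 * dist w z"
      by (simp add: \<Psi> dist_real_def)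
  qed
  obtain w where w: "\<Psi> w = w"
    using banach_fix_type[of "1 / 2" \<Psi>] contr by auto
  have weq: "W w t = p + integral {q..max q t} (F w)" for t
  proof -
    have "W w t = \<omega> t * \<Phi> w t" using w \<Psi>[of w] by (simp add: W_def)
    then show ?thesis using \<omega>0[of t] by (simp add: \<Phi>_def)
  qed
  show ?thesis
  proof (intro exI[of _ "W w"] conjI allI impI)
    show "continuous_on UNIV (W w)" by (rule cW)
    fix t assume "t \<le> q" then show "W w t = p" by (simp add: weq max_def)
  next
    fix t assume t: "t \<ge> q"
    have "(W w has_real_derivative F w t) (at t within {q..})"
      by (rule has_field_derivative_transform_within[OF der[OF t, of w], of 1])
        (use t in \<open>auto simp: weq max_def\<close>)
    then show "(W w has_real_derivative a * W w t + b * N (W w) t + f t) (at t within {q..})"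
      by (simp add: F_def)
  qed
qed

section \<open>Solutions of the max equation and the fundamental solution\<close>

text \<open>Uniqueness is stated up to a finite time S because an explicit candidate is later only known to
solve the equation until it returns.\<close>
lemma max_equation_unique:
  fixes u w :: "real \<Rightarrow> real"
  assumes h: "0 \<le> h"
    and cu: "continuous_on {q - h..S} u" and cw: "continuous_on {q - h..S} w"
    and init: "\<And>s. s \<in> {q - h..q} \<Longrightarrow> u s = w s"
    and du: "\<And>t. q < t \<Longrightarrow> t < S \<Longrightarrow> (u has_real_derivative a * u t + b * running_max h u t + f t) (at t)"
    and dw: "\<And>t. q < t \<Longrightarrow> t < S \<Longrightarrow> (w has_real_derivative a * w t + b * running_max h w t + f t) (at t)"
    and t: "t \<in> {q - h..S}"
  shows "u t = w t"
proof (cases "t \<le> q")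
  case True then show ?thesis using init t by auto
next
  case False
  have "\<bar>u t - w t\<bar> \<le> 0 * exp ((\<bar>a\<bar> + \<bar>b\<bar>) * (t - q))"
  proof (rule delay_gronwall[where h = h and S = S and D = "\<lambda>t. u t - w t" and
        D' = "\<lambda>t. a * (u t - w t) + b * (running_max h u t - running_max h w t)"])
    show "continuous_on {q - h..S} (\<lambda>t. u t - w t)" using cu cw by (intro continuous_intros)
    show "((\<lambda>t. u t - w t) has_real_derivative
        a * (u t - w t) + b * (running_max h u t - running_max h w t)) (at t)" if "q < t" "t < S" for t
      using DERIV_diff[OF du[OF that] dw[OF that]] by (simp add: algebra_simps)
    fix t N assume t: "q < t" "t < S" and N: "\<And>r. r \<in> {t - h..t} \<Longrightarrow> \<bar>u r - w r\<bar> \<le> N"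
    have 1: "\<bar>u t - w t\<bar> \<le> N" using N[of t] h by simp
    have 2: "\<bar>running_max h u t - running_max h w t\<bar> \<le> N"
      by (rule running_max_lipschitz[OF _ _ h N])
        (use t cu cw in \<open>auto intro: continuous_on_subset\<close>)
    have "\<bar>a * (u t - w t) + b * (running_max h u t - running_max h w t)\<bar>
        \<le> \<bar>a\<bar> * \<bar>u t - w t\<bar> + \<bar>b\<bar> * \<bar>running_max h u t - running_max h w t\<bar>"
      by (metis abs_mult abs_triangle_ineq)
    also have "\<dots> \<le> \<bar>a\<bar> * N + \<bar>b\<bar> * N" using 1 2 by (intro add_mono mult_left_mono) auto
    finally show "\<bar>a * (u t - w t) + b * (running_max h u t - running_max h w t)\<bar> \<le> (\<bar>a\<bar> + \<bar>b\<bar>) * N"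
      by (simp add: distrib_right)
  qed (use h init False t in auto)
  then show ?thesis by simp
qed

lemma max_equation_exists:
  assumes h: "0 \<le> h" and fc: "continuous_on UNIV f" and fB: "\<And>t. \<bar>f t\<bar> \<le> B"
  shows "\<exists>u. is_solution a b h f q p u"
proof -
  have "\<exists>u. continuous_on UNIV u \<and> (\<forall>t\<le>q. u t = p) \<and>
    (\<forall>t\<ge>q. (u has_real_derivative a * u t + b * running_max h u t + f t) (at t within {q..}))"
  proof (rule delay_equation_exists)
    fix t show "running_max h (\<lambda>_. 0) t = 0" by (rule running_max_eqI[of _ _ _ _ t]) (use h in auto)
  next
    fix u w :: "real \<Rightarrow> real" and M t
    assume "continuous_on UNIV u" "continuous_on UNIV w" "\<And>s. s \<le> t \<Longrightarrow> \<bar>u s - w s\<bar> \<le> M"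
    then show "\<bar>running_max h u t - running_max h w t\<bar> \<le> M"
      by (intro running_max_lipschitz h) (auto intro: continuous_on_subset)
  next
    fix u :: "real \<Rightarrow> real" assume "continuous_on UNIV u"
    then show "continuous_on {q..} (running_max h u)"
      by (intro running_max_continuous h) (auto intro: continuous_on_subset)
  qed (use fc fB in \<open>auto intro: continuous_on_subset\<close>)
  then obtain u where "continuous_on UNIV u" "\<forall>t\<le>q. u t = p"
    "\<forall>t\<ge>q. (u has_real_derivative a * u t + b * running_max h u t + f t) (at t within {q..})"
    by blast
  then have "is_solution a b h f q p u"
    unfolding is_solution_def by (auto intro: continuous_on_subset)
  then show ?thesis by blast
qed

lemma is_solution_unique:
  assumes "0 \<le> h" "is_solution a b h f q p u" "is_solution a b h f q p w" "t \<in> {q - h..}"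
  shows "u t = w t"
proof (rule max_equation_unique[where u = u and w = w and t = t and h = h and q = q and S = "max t q" and a = a and b = b and f = f])
  show "(u has_real_derivative a * u r + b * running_max h u r + f r) (at r)" if "q < r" "r < max t q" for r
    using assms(2) that unfolding is_solution_def by (intro has_derivative_interior[of _ _ _ q]) auto
  show "(w has_real_derivative a * w r + b * running_max h w r + f r) (at r)" if "q < r" "r < max t q" for r
    using assms(3) that unfolding is_solution_def by (intro has_derivative_interior[of _ _ _ q]) auto
qed (use assms in \<open>auto simp: is_solution_def intro: continuous_on_subset\<close>)

lemma is_solution_cong:
  assumes h: "0 \<le> h" and u: "is_solution a b h f q p u" and eq: "\<And>t. t \<in> {q - h..} \<Longrightarrow> w t = u t"
  shows "is_solution a b h f q p w"
  unfolding is_solution_def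
proof (intro conjI ballI allI impI)
  show "continuous_on {q - h..} w"
    using u eq unfolding is_solution_def by (metis continuous_on_cong)
  show "w s = p" if "s \<in> {q - h..q}" for s using u eq that unfolding is_solution_def by auto
  fix t assume t: "t \<ge> q"
  have "(u has_real_derivative a * u t + b * running_max h u t + f t) (at t within {q..})"
    using u t unfolding is_solution_def by auto
  moreover have "running_max h w t = running_max h u t"
    by (rule running_max_cong) (use eq t in auto)
  ultimately have "(u has_real_derivative a * w t + b * running_max h w t + f t) (at t within {q..})"
    using eq[of t] t h by simp
  then show "(w has_real_derivative a * w t + b * running_max h w t + f t) (at t within {q..})"
    by (rule has_field_derivative_transform_within[of _ _ _ _ 1]) (use t eq h in auto)
qed

lemma sol_is_solution:
  assumes h: "0 \<le> h" and fc: "continuous_on UNIV f" and fB: "\<And>t. \<bar>f t\<bar> \<le> B"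
  shows "is_solution a b h f q (ftilde a b f q) (sol a b h f q)"
proof -
  let ?P = "\<lambda>u. u \<in> extensional {q - h..} \<and> is_solution a b h f q (ftilde a b f q) u"
  obtain u where u: "is_solution a b h f q (ftilde a b f q) u"
    using max_equation_exists[OF h fc fB] by blast
  have "?P (restrict u {q - h..})"
    using is_solution_cong[OF h u] by auto
  moreover have "w = restrict u {q - h..}" if "?P w" for w
    using that is_solution_unique[OF h, of a b f q "ftilde a b f q" w u] u
    by (intro extensionalityI[of _ "{q - h..}"]) auto
  ultimately have "?P (THE u. ?P u)" by (rule theI)
  then show ?thesis by (simp add: sol_def)
qed

lemma linear_delay_equation_exists:
  assumes h: "0 \<le> h"
  shows "\<exists>Y::real \<Rightarrow> real. continuous_on UNIV Y \<and> (\<forall>s\<le>0. Y s = 1) \<and>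
    (\<forall>s\<ge>0. (Y has_real_derivative a * Y s + b * Y (s - h)) (at s within {0..}))"
proof -
  have "\<exists>u. continuous_on UNIV u \<and> (\<forall>t\<le>0. u t = 1) \<and>
    (\<forall>t\<ge>0. (u has_real_derivative a * u t + b * u (t - h) + (\<lambda>_. 0) t) (at t within {0..}))"
    by (rule delay_equation_exists[where N = "\<lambda>u t. u (t - h)" and B = 0])
      (use h in \<open>auto intro!: continuous_intros intro: continuous_on_compose2\<close>)
  then show ?thesis by simp
qed

text \<open>On each interval (nh, (n+1)h) the delayed term of a difference of two solutions is known to
vanish, so the difference solves z' = a z with zero initial value.\<close>
lemma fundamental_solution_unique:
  fixes v w :: "real \<Rightarrow> real"
  assumes h: "0 < h"
    and v: "\<forall>t<0. v t = 0" "v 0 = 1" "continuous_on {0..} v"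
      "\<forall>t>0. t \<noteq> h \<longrightarrow> (v has_real_derivative a * v t + b * v (t - h)) (at t)"
    and w: "\<forall>t<0. w t = 0" "w 0 = 1" "continuous_on {0..} w"
      "\<forall>t>0. t \<noteq> h \<longrightarrow> (w has_real_derivative a * w t + b * w (t - h)) (at t)"
  shows "v = w"
proof -
  define z where "z = (\<lambda>t. v t - w t)"
  have zero: "\<forall>t \<le> real n * h. z t = 0" for n
  proof (induction n)
    case 0
    have "z t = 0" if "t \<le> 0" for t using that v(1,2) w(1,2) by (cases "t = 0") (auto simp: z_def)
    then show ?case by simp
  next
    case (Suc n)
    show ?case
    proof (intro allI impI)
      fix t assume t: "t \<le> real (Suc n) * h"
      show "z t = 0"
      proof (cases "t \<le> real n * h")
        case True then show ?thesis using Suc by blast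
      next
        case False
        have n0: "0 \<le> real n * h" using h by simp
        have "exp (- a * t) * z t = exp (- a * (real n * h)) * z (real n * h)"
        proof (rule DERIV_isconst2[of "real n * h" "real (Suc n) * h"])
          have "continuous_on {real n * h..real (Suc n) * h} z"
            unfolding z_def using n0 v(3) w(3)
            by (intro continuous_intros) (auto intro: continuous_on_subset)
          then show "continuous_on {real n * h..real (Suc n) * h} (\<lambda>t. exp (- a * t) * z t)"
            by (intro continuous_intros)
        next
          fix x assume x: "real n * h < x" "x < real (Suc n) * h"
          have xh: "x \<noteq> h"
          proof (cases n)
            case 0 then show ?thesis using x by simp
          next
            case (Suc m)
            have "1 * h \<le> real n * h" using h Suc by (intro mult_right_mono) auto
            then show ?thesis using x by simp
          qed
          have "z (x - h) = 0" using Suc x by (simp add: algebra_simps)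
          have "(z has_real_derivative a * z x + b * z (x - h)) (at x)"
          proof -
            have "x > 0" using x n0 by linarith
            then show ?thesis
              using DERIV_diff[OF v(4)[rule_format, of x] w(4)[rule_format, of x]] xh
              by (simp add: z_def algebra_simps)
          qed
          then have "(z has_real_derivative a * z x) (at x)" using \<open>z (x - h) = 0\<close> by simp
          then show "((\<lambda>t. exp (- a * t) * z t) has_real_derivative 0) (at x)"
            by (auto intro!: derivative_eq_intros)
        qed (use False t h in \<open>auto simp: distrib_right\<close>)
        also have "z (real n * h) = 0" using Suc by simp
        finally show ?thesis by simp
      qed
    qed
  qed
  have "z t = 0" for t
  proof -
    obtain n where "t / h < real n" using reals_Archimedean2 by blast
    then have "t \<le> real n * h" using h by (simp add: divide_less_eq)
    then show ?thesis using zero by blast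
  qed
  then show ?thesis by (auto simp: z_def fun_eq_iff)
qed

text \<open>The solution Y with history 1 satisfies Y' = (a + b) v for s > 0.  So v can be read off from Y, and
the integral of v over a delay interval is a difference of two values of Y.\<close>
lemma fundamental_solution_integral:
  fixes Y :: "real \<Rightarrow> real"
  assumes h: "0 < h" and ab: "a + b \<noteq> 0"
    and cY: "continuous_on UNIV Y" and Y1: "\<forall>s\<le>0. Y s = 1"
    and dY: "\<forall>s\<ge>0. (Y has_real_derivative a * Y s + b * Y (s - h)) (at s within {0..})"
    and s: "0 \<le> s"
  shows "fundamental_solution a b h s + b * integral {s - h..s} (fundamental_solution a b h) = Y s"
proof -
  define v where "v = (\<lambda>s. if s < 0 then 0 else (a * Y s + b * Y (s - h)) / (a + b))"
  have dpos: "(Y has_real_derivative a * Y s + b * Y (s - h)) (at s)" if "s > 0" for s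
    using dY that by (intro has_derivative_interior[of _ _ _ 0]) auto
  have dneg: "(Y has_real_derivative 0) (at s)" if "s < 0" for s
  proof (rule has_field_derivative_transform_within_open[of "\<lambda>_. 1" _ _ "{..<0}"])
    show "1 = Y x" if "x \<in> {..<0}" for x using that Y1 by simp
  qed (use that in auto)
  have dYv: "(Y has_real_derivative (a + b) * v s) (at s)" if "s \<noteq> 0" for s
    using dpos[of s] dneg[of s] that ab by (cases "s < 0") (auto simp: v_def)
  let ?P = "\<lambda>v. (\<forall>t<0. v t = 0) \<and> v 0 = 1 \<and> continuous_on {0..} v \<and>
        (\<forall>t>0. t \<noteq> h \<longrightarrow> (v has_real_derivative a * v t + b * v (t - h)) (at t))"
  have "?P v"
  proof (intro conjI allI impI)
    show "v 0 = 1" using Y1 h ab by (simp add: v_def)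
    have "continuous_on {0..} (\<lambda>s. (a * Y s + b * Y (s - h)) / (a + b))"
      using ab by (intro continuous_intros continuous_on_compose2[OF cY]) auto
    then show "continuous_on {0..} v" by (rule continuous_on_eq) (simp add: v_def)
  next
    fix t :: real assume t: "t > 0" "t \<noteq> h"
    have "((\<lambda>t. Y (t - h)) has_real_derivative (a + b) * v (t - h) * 1) (at t)"
      by (rule DERIV_chain2[of Y]) (use dYv[of "t - h"] t in \<open>auto intro!: derivative_eq_intros\<close>)
    moreover have "(Y has_real_derivative (a + b) * v t) (at t)" using dYv t by simp
    ultimately have "((\<lambda>s. (a * Y s + b * Y (s - h)) / (a + b)) has_real_derivative
        (a * ((a + b) * v t) + b * ((a + b) * v (t - h) * 1)) / (a + b)) (at t)"
      by (intro DERIV_cdivide DERIV_add DERIV_cmult)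
    also have "(a * ((a + b) * v t) + b * ((a + b) * v (t - h) * 1)) / (a + b) = a * v t + b * v (t - h)"
      using ab by (simp add: field_simps)
    finally show "(v has_real_derivative a * v t + b * v (t - h)) (at t)"
      by (rule has_field_derivative_transform_within_open[of _ _ _ "{0<..}"]) (use t in \<open>auto simp: v_def\<close>)
  qed (simp add: v_def)
  then have fs: "fundamental_solution a b h = v"
    unfolding fundamental_solution_def
    by (intro the_equality) (auto intro: fundamental_solution_unique[OF h])
  have "((\<lambda>s. (a + b) * v s) has_integral (Y s - Y (s - h))) {s - h..s}"
    by (rule fundamental_theorem_of_calculus_interior_strong[of "{0}"])
      (use h dYv cY in \<open>auto simp: has_real_derivative_iff_has_vector_derivative[symmetric]
        intro: continuous_on_subset\<close>)
  then have "(v has_integral (Y s - Y (s - h)) / (a + b)) {s - h..s}"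
    using has_integral_mult_right[of "\<lambda>s. (a + b) * v s" "Y s - Y (s - h)" "{s - h..s}" "1 / (a + b)"] ab
    by simp
  then have "integral {s - h..s} v = (Y s - Y (s - h)) / (a + b)" by (rule integral_unique)
  moreover have "v s = (a * Y s + b * Y (s - h)) / (a + b)" using s by (simp add: v_def)
  ultimately have "v s + b * integral {s - h..s} v
      = ((a * Y s + b * Y (s - h)) + b * (Y s - Y (s - h))) / (a + b)"
    by (simp add: add_divide_distrib)
  also have "\<dots> = (a + b) * Y s / (a + b)" by (simp add: algebra_simps)
  finally show ?thesis using ab by (simp add: fs)
qed

section \<open>The forcing term and its level function\<close>

text \<open>The derivative of e^(-ar) (u - k) has the sign of u' - a (u - k); this turns every comparison with
the unstable equation u' = a u below into a monotonicity statement.\<close>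
lemma has_derivative_exp_weight:
  fixes u :: "real \<Rightarrow> real"
  assumes "(u has_real_derivative D) (at t)"
  shows "((\<lambda>r. exp (- a * r) * (u r - k)) has_real_derivative exp (- a * t) * (D - a * (u t - k))) (at t)"
  using assms by (auto intro!: derivative_eq_intros simp: algebra_simps)

text \<open>The integral up to t + T and its value at t satisfy the same differential equation up to the
factor e^(kT), by periodicity of g.\<close>
lemma exp_weighted_integral_shift:
  fixes g :: "real \<Rightarrow> real"
  assumes gc: "continuous_on UNIV g" and per: "\<And>t. g (t + T) = g t" and T: "0 < T" and t: "0 \<le> t"
  shows "integral {0..t + T} (\<lambda>s. exp (k * s) * g s) =
    integral {0..T} (\<lambda>s. exp (k * s) * g s) + exp (k * T) * integral {0..t} (\<lambda>s. exp (k * s) * g s)"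
proof (cases "t = 0")
  case False
  define J where "J = (\<lambda>t. integral {0..t} (\<lambda>s. exp (k * s) * g s))"
  have dJ0: "(J has_real_derivative exp (k * r) * g r) (at r within {0..})" if "0 \<le> r" for r
    unfolding J_def by (rule integral_has_derivative_right_ray)
      (use that gc in \<open>auto intro!: continuous_intros intro: continuous_on_subset\<close>)
  have dJ: "(J has_real_derivative exp (k * r) * g r) (at r)" if "0 < r" for r
    by (rule has_derivative_interior[OF dJ0]) (use that in auto)
  have cJ: "continuous_on {0..} J" using dJ0 by (intro DERIV_continuous_on) auto
  have cT: "continuous_on {0..t} (\<lambda>r. J (r + T) - exp (k * T) * J r)"
    by (intro continuous_intros continuous_on_compose2[OF cJ] continuous_on_subset[OF cJ]) (use T in auto)
  have "J (t + T) - exp (k * T) * J t = J (0 + T) - exp (k * T) * J 0"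
  proof (rule DERIV_isconst_end[OF _ cT])
    fix r assume r: "0 < r" "r < t"
    have "((\<lambda>r. J (r + T)) has_real_derivative (exp (k * (r + T)) * g (r + T)) * 1) (at r)"
      by (rule DERIV_chain2[OF dJ]) (use r T in \<open>auto intro!: derivative_eq_intros\<close>)
    then have "((\<lambda>r. J (r + T) - exp (k * T) * J r) has_real_derivative
        (exp (k * (r + T)) * g (r + T)) * 1 - exp (k * T) * (exp (k * r) * g r)) (at r)"
      using r by (intro DERIV_diff DERIV_cmult dJ) auto
    moreover have "(exp (k * (r + T)) * g (r + T)) * 1 - exp (k * T) * (exp (k * r) * g r) = 0"
      unfolding per distrib_left exp_add by simp
    ultimately show "((\<lambda>r. J (r + T) - exp (k * T) * J r) has_real_derivative 0) (at r)" by simp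
  qed (use t False in auto)
  then show ?thesis by (simp add: J_def)
qed simp

text \<open>The periodic forcing with its monotonicity phases.  The alternative on a h and b h is stated where the
existence of a return time is proved.\<close>
locale unimodal_forcing =
  fixes a b h T \<beta> :: real and f :: "real \<Rightarrow> real"
  assumes h: "0 < h" and hT: "h < T" and a: "0 < a" and b: "b < 0" and ab: "a + b < 0"
    and fc: "continuous_on UNIV f" and per: "\<And>t. f (t + T) = f t"
    and \<beta>: "0 < \<beta>" and \<beta>T: "\<beta> < T" and \<beta>h: "\<beta> < h"
    and dec: "strict_antimono_on {0..\<beta>} f" and inc: "strict_mono_on {\<beta>..T} f"
    and fnn: "\<And>t. 0 \<le> f t" and f\<beta>: "f \<beta> = 0"
begin

definition c :: real where "c = - (a + b)"

lemma c: "c > 0" using ab by (simp add: c_def)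

lemma equilibrium_iff: "(a + b) * y + z = 0 \<longleftrightarrow> y = z / c"
proof -
  have "a + b = - c" by (simp add: c_def)
  then show ?thesis using c by (auto simp: field_simps)
qed

lemma T: "T > 0" using h hT by simp

lemma f_shift: "f (t + real k * T) = f t"
proof (induction k)
  case (Suc k)
  have "f (t + real (Suc k) * T) = f ((t + real k * T) + T)" by (simp add: algebra_simps)
  then show ?case using Suc per by simp
qed simp

text \<open>On [kT, kT + \<beta>] the forcing decreases, on [kT + \<beta>, (k+1)T] it increases.  Only natural k occur,
because all solutions start at times q \<ge> 0.\<close>
lemma f_dec:
  assumes "real k * T \<le> s" "s < t" "t \<le> real k * T + \<beta>"
  shows "f t < f s"
proof -
  have "f (t - real k * T) < f (s - real k * T)"
    using dec assms by (intro monotone_onD[OF dec]) auto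
  then show ?thesis using f_shift[of "t - real k * T" k] f_shift[of "s - real k * T" k] by simp
qed

lemma f_inc:
  assumes "real k * T + \<beta> \<le> s" "s < t" "t \<le> real (Suc k) * T"
  shows "f s < f t"
proof -
  have "f (s - real k * T) < f (t - real k * T)"
    using assms by (intro monotone_onD[OF inc]) (auto simp: algebra_simps)
  then show ?thesis using f_shift[of "t - real k * T" k] f_shift[of "s - real k * T" k] by simp
qed

lemma f_zero: "f (real k * T + \<beta>) = 0"
  using f_shift[of \<beta> k] f\<beta> by (simp add: add.commute)

lemma phase_exists:
  assumes "0 \<le> t"
  obtains k where "real k * T \<le> t" "t < real (Suc k) * T"
proof -
  define k where "k = nat \<lfloor>t / T\<rfloor>"
  have "0 \<le> t / T" using assms T by simp
  then have k: "real k = of_int \<lfloor>t / T\<rfloor>" unfolding k_def by simp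
  have "real k \<le> t / T" "t / T < real k + 1" unfolding k by linarith+
  then show thesis using T that[of k] by (simp add: field_simps)
qed

lemma f_bounded: obtains B where "\<And>t. \<bar>f t\<bar> \<le> B" "0 < B"
proof -
  have le: "f s \<le> f 0" if "0 \<le> s" "s \<le> T" for s
  proof (cases "s \<le> \<beta>")
    case True then show ?thesis using f_dec[of 0 0 s] that by (cases "s = 0") auto
  next
    case False then show ?thesis using f_inc[of 0 s T] that per[of 0] by (cases "s = T") auto
  qed
  have "f t \<le> f 0" for t
  proof -
    obtain n where n: "- t / T < real n" using reals_Archimedean2 by blast
    then have "0 \<le> t + real n * T" using T by (simp add: field_simps)
    then obtain k where k: "real k * T \<le> t + real n * T" "t + real n * T < real (Suc k) * T"
      by (rule phase_exists)
    define s where "s = t + real n * T - real k * T"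
    have "f t = f s" using f_shift[of t n] f_shift[of s k] by (simp add: s_def)
    moreover have "0 \<le> s" "s \<le> T" using k by (auto simp: s_def algebra_simps)
    ultimately show ?thesis using le by simp
  qed
  moreover have "f 0 > 0" using f_dec[of 0 0 \<beta>] \<beta> f\<beta> by simp
  ultimately show thesis using fnn that[of "f 0"] by auto
qed

definition G :: "real \<Rightarrow> real" where
  "G t = integral {0..t} (\<lambda>s. exp (c * s) * f s)"

text \<open>A solution of u' = -c u + f with e^(ct) u(t) - G(t) = C satisfies u(t) \<le> f(t)/c exactly when C \<le> E(t).\<close>
definition E :: "real \<Rightarrow> real" where
  "E t = exp (c * t) * (f t / c) - G t"

lemma G_deriv_within:
  assumes "0 \<le> t"
  shows "(G has_real_derivative exp (c * t) * f t) (at t within {0..})"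
  unfolding G_def
  by (rule integral_has_derivative_right_ray)
    (use assms fc in \<open>auto intro!: continuous_intros intro: continuous_on_subset\<close>)

lemma G_deriv: "0 < t \<Longrightarrow> (G has_real_derivative exp (c * t) * f t) (at t)"
  by (rule has_derivative_interior[OF G_deriv_within]) auto

lemma G_cont: "continuous_on {0..} G"
  using G_deriv_within by (intro DERIV_continuous_on) auto

lemma G_cont': "0 \<le> x \<Longrightarrow> continuous_on {x..y} G"
  by (rule continuous_on_subset[OF G_cont]) auto

lemma G_zero: "G 0 = 0" by (simp add: G_def)

text \<open>Replacing f by a constant bound x makes the integral explicit.  With x the value of f at the right
end point this yields the strict monotonicity of E from that of f without differentiating f.\<close>
lemma G_compare:
  assumes "0 \<le> s" "s \<le> t"
  shows "(\<And>r. s < r \<Longrightarrow> r < t \<Longrightarrow> x \<le> f r) \<Longrightarrow> x * (exp (c * t) - exp (c * s)) / c \<le> G t - G s"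
    and "(\<And>r. s < r \<Longrightarrow> r < t \<Longrightarrow> f r \<le> x) \<Longrightarrow> G t - G s \<le> x * (exp (c * t) - exp (c * s)) / c"
proof -
  have ct: "continuous_on {s..t} (\<lambda>r. G r - x * exp (c * r) / c)"
    using c by (intro continuous_intros G_cont' assms) auto
  have d: "((\<lambda>r. G r - x * exp (c * r) / c) has_real_derivative exp (c * r) * (f r - x)) (at r)"
    if "s < r" for r
  proof -
    have "((\<lambda>r. x * exp (c * r) / c) has_real_derivative x * exp (c * r)) (at r)"
      using c by (auto intro!: derivative_eq_intros)
    then have "((\<lambda>r. G r - x * exp (c * r) / c) has_real_derivative exp (c * r) * f r - x * exp (c * r)) (at r)"
      using that assms by (intro DERIV_diff G_deriv) auto
    then show ?thesis by (simp add: algebra_simps)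
  qed
  show "x * (exp (c * t) - exp (c * s)) / c \<le> G t - G s"
    if "\<And>r. s < r \<Longrightarrow> r < t \<Longrightarrow> x \<le> f r"
  proof -
    have "G s - x * exp (c * s) / c \<le> G t - x * exp (c * t) / c"
      by (rule DERIV_nonneg_imp_increasing_open[OF assms(2) _ ct])
        (use d that in \<open>fastforce intro: mult_nonneg_nonneg\<close>)
    then show ?thesis by (simp add: right_diff_distrib diff_divide_distrib)
  qed
  show "G t - G s \<le> x * (exp (c * t) - exp (c * s)) / c"
    if "\<And>r. s < r \<Longrightarrow> r < t \<Longrightarrow> f r \<le> x"
  proof -
    have "G t - x * exp (c * t) / c \<le> G s - x * exp (c * s) / c"
      by (rule DERIV_nonpos_imp_decreasing_open[OF assms(2) _ ct])
        (use d that in \<open>fastforce intro: mult_nonneg_nonpos\<close>)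
    then show ?thesis by (simp add: right_diff_distrib diff_divide_distrib)
  qed
qed

lemma G_mono: "0 \<le> s \<Longrightarrow> s \<le> t \<Longrightarrow> G s \<le> G t"
  using G_compare(1)[of s t 0] fnn by simp

lemma G_T_pos: "G T > 0"
proof -
  have f2: "f (\<beta> / 2) > 0" using f_dec[of 0 "\<beta> / 2" \<beta>] \<beta> f\<beta> by simp
  have "f (\<beta> / 2) * (exp (c * (\<beta> / 2)) - exp (c * 0)) / c \<le> G (\<beta> / 2) - G 0"
    by (rule G_compare(1)) (use \<beta> f_dec[of 0 _ "\<beta> / 2"] in \<open>auto intro: less_imp_le\<close>)
  moreover have "f (\<beta> / 2) * (exp (c * (\<beta> / 2)) - exp (c * 0)) / c > 0"
    using f2 c \<beta> by (intro divide_pos_pos mult_pos_pos) (auto simp: zero_less_mult_iff)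
  moreover have "G (\<beta> / 2) \<le> G T" using \<beta> \<beta>T by (intro G_mono) auto
  ultimately show ?thesis by (simp add: G_zero)
qed

lemma G_shift:
  assumes "0 \<le> t"
  shows "G (t + T) = G T + exp (c * T) * G t"
  unfolding G_def by (rule exp_weighted_integral_shift) (use T assms fc per in auto)

lemma E_shift:
  assumes "0 \<le> t"
  shows "E (t + T) = exp (c * T) * E t - G T"
proof -
  have "exp (c * (t + T)) = exp (c * T) * exp (c * t)"
    unfolding distrib_left exp_add by simp
  then show ?thesis unfolding E_def G_shift[OF assms] per by (simp add: algebra_simps)
qed

lemma E_cont: "continuous_on {0..} E"
  unfolding E_def using c by (intro continuous_intros G_cont continuous_on_subset[OF fc]) auto

lemma E_dec:
  assumes "real k * T \<le> s" "s < t" "t \<le> real k * T + \<beta>"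
  shows "E t < E s"
proof -
  have s0: "0 \<le> s" using assms(1) T by (meson mult_nonneg_nonneg of_nat_0_le_iff less_imp_le order_trans)
  have "f t * (exp (c * t) - exp (c * s)) / c \<le> G t - G s"
    by (rule G_compare(1)) (use s0 assms f_dec[of k _ t] in \<open>auto intro!: less_imp_le\<close>)
  then have "E t - E s \<le> exp (c * t) * (f t / c) - exp (c * s) * (f s / c) - f t * (exp (c * t) - exp (c * s)) / c"
    by (simp add: E_def)
  also have "\<dots> = exp (c * s) * (f t - f s) / c"
    by (simp add: algebra_simps diff_divide_distrib)
  also have "\<dots> < 0"
    using f_dec[OF assms] c by (intro divide_neg_pos mult_pos_neg) auto
  finally show ?thesis by simp
qed

lemma E_inc:
  assumes "real k * T + \<beta> \<le> s" "s < t" "t \<le> real (Suc k) * T"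
  shows "E s < E t"
proof -
  have "0 \<le> real k * T" using T by simp
  then have s0: "0 \<le> s" using assms(1) \<beta> by linarith
  have "G t - G s \<le> f t * (exp (c * t) - exp (c * s)) / c"
    by (rule G_compare(2)) (use s0 assms f_inc[of k _ t] in \<open>auto intro!: less_imp_le\<close>)
  then have "E t - E s \<ge> exp (c * t) * (f t / c) - exp (c * s) * (f s / c) - f t * (exp (c * t) - exp (c * s)) / c"
    by (simp add: E_def)
  also have "exp (c * t) * (f t / c) - exp (c * s) * (f s / c) - f t * (exp (c * t) - exp (c * s)) / c
      = exp (c * s) * (f t - f s) / c"
    by (simp add: algebra_simps diff_divide_distrib)
  finally have "exp (c * s) * (f t - f s) / c \<le> E t - E s" .
  moreover have "exp (c * s) * (f t - f s) / c > 0"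
    using f_inc[OF assms] c by (intro divide_pos_pos mult_pos_pos) auto
  ultimately show ?thesis by simp
qed

definition level :: "nat \<Rightarrow> real" where "level k = E (real k * T + \<beta>)"

lemma level_eq: "level k = - G (real k * T + \<beta>)"
  by (simp add: level_def E_def f_zero)

lemma G_Suc: "G (real k * T + \<beta>) + G T \<le> G (real (Suc k) * T + \<beta>)"
proof -
  have nn: "0 \<le> real k * T + \<beta>" using T \<beta> by simp
  have "G (real (Suc k) * T + \<beta>) = G ((real k * T + \<beta>) + T)" by (simp add: algebra_simps)
  also have "\<dots> = G T + exp (c * T) * G (real k * T + \<beta>)" by (rule G_shift[OF nn])
  also have "\<dots> \<ge> G T + 1 * G (real k * T + \<beta>)"
    using c T G_mono[OF _ nn] by (intro add_left_mono mult_right_mono) (auto simp: G_zero)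
  finally show ?thesis by simp
qed

lemma level_Suc: "level (Suc k) < level k"
  using G_Suc[of k] G_T_pos unfolding level_eq by linarith

lemma level_strict_antimono: "j < k \<Longrightarrow> level k < level j"
proof (induction k)
  case (Suc k)
  then show ?case using level_Suc[of k] by (cases "j = k") auto
qed simp

lemma level_antimono: "j \<le> k \<Longrightarrow> level k \<le> level j"
  using level_strict_antimono[of j k] by (cases "j = k") auto

text \<open>Each period adds at least G(T) > 0 to G.\<close>
lemma level_unbounded: "\<exists>k. level k < x"
proof -
  have "real k * G T \<le> G (real k * T + \<beta>)" for k
  proof (induction k)
    case 0 then show ?case using G_mono[of 0 \<beta>] \<beta> by (simp add: G_zero)
  next
    case (Suc k) then show ?case using G_Suc[of k] by (simp add: algebra_simps)
  qed
  moreover obtain k where k: "- x / G T < real k" using reals_Archimedean2 by blast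
  moreover have "- x < real k * G T" using k pos_divide_less_eq[OF G_T_pos, of "- x"] by blast
  ultimately have "level k < x" unfolding level_eq by (smt (verit))
  then show ?thesis ..
qed

end

section \<open>Admissible return times\<close>

text \<open>A solution whose constant initial value is the equilibrium f(q)/c of u' = -c u + f at the initial
time.\<close>
locale max_solution = unimodal_forcing +
  fixes q :: real and u :: "real \<Rightarrow> real"
  assumes q0: "0 \<le> q" and q\<beta>: "q \<le> \<beta>" and sol: "is_solution a b h f q (f q / c) u"
begin

abbreviation "U \<equiv> running_max h u"

lemma cu: "continuous_on {q - h..} u" using sol by (simp add: is_solution_def)
lemma cu': "q - h \<le> x \<Longrightarrow> continuous_on {x..y} u" by (rule continuous_on_subset[OF cu]) auto
lemma hist: "q - h \<le> s \<Longrightarrow> s \<le> q \<Longrightarrow> u s = f q / c" using sol by (simp add: is_solution_def)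
lemma uq: "u q = f q / c" using hist[of q] h by simp

lemma du: "q < t \<Longrightarrow> (u has_real_derivative a * u t + b * U t + f t) (at t)"
  by (rule has_derivative_interior[of _ _ _ q]) (use sol in \<open>auto simp: is_solution_def\<close>)

lemma cU: "continuous_on {q..} U" using running_max_continuous[OF cu] h by simp
lemma cU': "q \<le> x \<Longrightarrow> continuous_on {x..y} U" by (rule continuous_on_subset[OF cU]) auto

lemma U_ge: "q \<le> t \<Longrightarrow> t - h \<le> r \<Longrightarrow> r \<le> t \<Longrightarrow> u r \<le> U t"
  by (rule running_max_upper) (auto intro: cu')

lemma U_ge_u: "q \<le> t \<Longrightarrow> u t \<le> U t" using U_ge[of t t] h by simp

lemma U_attained:
  assumes "q \<le> t" obtains s where "t - h \<le> s" "s \<le> t" "U t = u s"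
proof -
  have "continuous_on {t - h..t} u" using assms by (intro cu') simp
  then obtain s where s: "s \<in> {t - h..t}" "U t = u s" using running_max_attained h by (metis less_imp_le)
  then show thesis by (intro that[of s]) auto
qed

lemma U_eqI: "(\<And>r. t - h \<le> r \<Longrightarrow> r \<le> t \<Longrightarrow> u r \<le> y) \<Longrightarrow> t - h \<le> s \<Longrightarrow> s \<le> t \<Longrightarrow> u s = y \<Longrightarrow> U t = y"
  by (rule running_max_eqI[of _ _ _ _ s]) auto

lemma Uq: "U q = f q / c" by (rule U_eqI[of _ _ q]) (use hist h in auto)

text \<open>For an equilibrium value y at the time \<nu> the constant parts of the equation cancel, so that the
growth of u - y is governed by U - y and by the change of f since \<nu>.\<close>
lemma weighted_deriv:
  assumes "q < r" "(a + b) * y + f \<nu> = 0"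
  shows "((\<lambda>r. exp (- a * r) * (u r - y)) has_real_derivative
     exp (- a * r) * (b * (U r - y) + (f r - f \<nu>))) (at r)"
proof -
  have "b * (U r - y) + (f r - f \<nu>) = (a * u r + b * U r + f r) - a * (u r - y)"
    using assms(2) by (simp add: algebra_simps)
  then show ?thesis using has_derivative_exp_weight[OF du[OF assms(1)], of a y] by metis
qed

text \<open>Here U \<ge> u(\<nu>) as long as \<nu> lies in the delay window, and b < 0, so the delayed term can only push u
further down, while f has already decreased.\<close>
lemma drop_after_maximum:
  assumes \<nu>: "q \<le> \<nu>" "u \<nu> = f \<nu> / c" and k: "real k * T \<le> \<nu>"
    and t: "\<nu> < t" "t \<le> real k * T + \<beta>" "t \<le> \<nu> + h"
  shows "u t < u \<nu>"
proof -
  have z: "(a + b) * u \<nu> + f \<nu> = 0" using \<nu>(2) equilibrium_iff by blast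
  have "exp (- a * t) * (u t - u \<nu>) < exp (- a * \<nu>) * (u \<nu> - u \<nu>)"
  proof (rule DERIV_neg_imp_decreasing_open[OF t(1)])
    fix r assume r: "\<nu> < r" "r < t"
    have "U r \<ge> u \<nu>" using U_ge[of r \<nu>] r t \<nu> by simp
    then have "b * (U r - u \<nu>) \<le> 0" using b by (intro mult_nonpos_nonneg) auto
    moreover have "f r < f \<nu>" using f_dec[OF k r(1)] r t by simp
    ultimately have "exp (- a * r) * (b * (U r - u \<nu>) + (f r - f \<nu>)) < 0"
      by (intro mult_pos_neg) auto
    then show "\<exists>y. ((\<lambda>r. exp (- a * r) * (u r - u \<nu>)) has_real_derivative y) (at r) \<and> y < 0"
      using weighted_deriv[OF _ z, of r] r \<nu> by auto
  next
    show "continuous_on {\<nu>..t} (\<lambda>r. exp (- a * r) * (u r - u \<nu>))"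
      using \<nu> h by (intro continuous_intros cu') auto
  qed
  then show ?thesis by (simp add: mult_less_0_iff)
qed

lemma below_start: "q < t \<Longrightarrow> t \<le> \<beta> \<Longrightarrow> u t < u q"
  by (rule drop_after_maximum[of q 0]) (use q0 q\<beta> uq \<beta>h in auto)

text \<open>The set whose least element is the return time.\<close>
definition admissible :: "real \<Rightarrow> bool" where
  "admissible \<nu> \<longleftrightarrow> q < \<nu> \<and> (\<exists>\<epsilon>>0. u \<nu> = Sup (u ` {\<nu> - h..\<nu> + \<epsilon>}))"

lemma admissible_iff:
  "admissible \<nu> \<longleftrightarrow> q < \<nu> \<and> (\<exists>\<epsilon>>0. \<forall>r\<in>{\<nu> - h..\<nu> + \<epsilon>}. u r \<le> u \<nu>)"
proof -
  have "u \<nu> = Sup (u ` {\<nu> - h..\<nu> + \<epsilon>}) \<longleftrightarrow> (\<forall>r\<in>{\<nu> - h..\<nu> + \<epsilon>}. u r \<le> u \<nu>)"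
    if "q < \<nu>" "\<epsilon> > 0" for \<epsilon>
  proof
    assume *: "u \<nu> = Sup (u ` {\<nu> - h..\<nu> + \<epsilon>})"
    have "compact (u ` {\<nu> - h..\<nu> + \<epsilon>})"
      using that by (intro compact_continuous_image cu') auto
    then have "bdd_above (u ` {\<nu> - h..\<nu> + \<epsilon>})"
      by (intro bounded_imp_bdd_above compact_imp_bounded)
    then show "\<forall>r\<in>{\<nu> - h..\<nu> + \<epsilon>}. u r \<le> u \<nu>" unfolding * by (auto intro: cSup_upper)
  next
    assume "\<forall>r\<in>{\<nu> - h..\<nu> + \<epsilon>}. u r \<le> u \<nu>"
    then show "u \<nu> = Sup (u ` {\<nu> - h..\<nu> + \<epsilon>})"
      using h that by (intro cSup_eq_maximum[symmetric]) auto
  qed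
  then show ?thesis unfolding admissible_def by blast
qed

lemma admissibleD_max:
  assumes "admissible \<nu>" shows "U \<nu> = u \<nu>"
  using assms h unfolding admissible_iff by (intro U_eqI[of _ _ \<nu>]) auto

lemma admissible_critical:
  assumes "admissible \<nu>" shows "u \<nu> = f \<nu> / c"
proof -
  obtain \<epsilon> where \<nu>: "q < \<nu>" "\<epsilon> > 0" "\<forall>r\<in>{\<nu> - h..\<nu> + \<epsilon>}. u r \<le> u \<nu>"
    using assms unfolding admissible_iff by blast
  have "a * u \<nu> + b * U \<nu> + f \<nu> = 0"
  proof (rule DERIV_local_max[OF du[OF \<nu>(1)], of "min \<epsilon> h"])
    show "\<forall>y. \<bar>\<nu> - y\<bar> < min \<epsilon> h \<longrightarrow> u y \<le> u \<nu>"
    proof (intro allI impI)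
      fix y assume "\<bar>\<nu> - y\<bar> < min \<epsilon> h"
      then have "y \<in> {\<nu> - h..\<nu> + \<epsilon>}" by (auto simp: abs_if split: if_splits)
      then show "u y \<le> u \<nu>" using \<nu>(3) by blast
    qed
  qed (use \<nu> h in auto)
  then have "(a + b) * u \<nu> + f \<nu> = 0" using admissibleD_max[OF assms] by (simp add: algebra_simps)
  then show ?thesis using equilibrium_iff by blast
qed

text \<open>If f increased after \<nu>, then u would rise above u(\<nu>): as long as it does not, the running maximum stays
equal to u(\<nu>) and (e^(-ar)(u - u(\<nu>)))' = e^(-ar)(f(r) - f(\<nu>)) > 0.\<close>
lemma admissible_phase:
  assumes "admissible \<nu>" obtains k where "real k * T \<le> \<nu>" "\<nu> < real k * T + \<beta>"
proof -
  obtain \<epsilon> where \<nu>: "q < \<nu>" "\<epsilon> > 0" and \<epsilon>: "\<forall>r\<in>{\<nu> - h..\<nu> + \<epsilon>}. u r \<le> u \<nu>"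
    using assms unfolding admissible_iff by blast
  obtain k where k: "real k * T \<le> \<nu>" "\<nu> < real (Suc k) * T"
    using phase_exists[of \<nu>] \<nu> q0 by auto
  have "\<nu> < real k * T + \<beta>"
  proof (rule ccontr)
    assume "\<not> \<nu> < real k * T + \<beta>"
    then have k\<beta>: "real k * T + \<beta> \<le> \<nu>" by simp
    define t where "t = min (min (\<nu> + \<epsilon>) (\<nu> + h)) (real (Suc k) * T)"
    have t: "\<nu> < t" "t \<le> \<nu> + \<epsilon>" "t \<le> \<nu> + h" "t \<le> real (Suc k) * T" using \<nu> h k by (auto simp: t_def)
    have z: "(a + b) * u \<nu> + f \<nu> = 0" using admissible_critical[OF assms] equilibrium_iff by blast
    have "exp (- a * \<nu>) * (u \<nu> - u \<nu>) < exp (- a * t) * (u t - u \<nu>)"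
    proof (rule DERIV_pos_imp_increasing_open[OF t(1)])
      fix r assume r: "\<nu> < r" "r < t"
      have "U r = u \<nu>" by (rule U_eqI[of _ _ \<nu>]) (use r t \<epsilon> in auto)
      moreover have "f \<nu> < f r" using f_inc[OF k\<beta> r(1)] r t by simp
      ultimately have "exp (- a * r) * (b * (U r - u \<nu>) + (f r - f \<nu>)) > 0" by simp
      then show "\<exists>y. ((\<lambda>r. exp (- a * r) * (u r - u \<nu>)) has_real_derivative y) (at r) \<and> y > 0"
        using weighted_deriv[OF _ z, of r] r \<nu> by auto
    next
      show "continuous_on {\<nu>..t} (\<lambda>r. exp (- a * r) * (u r - u \<nu>))"
        using \<nu> h by (intro continuous_intros cu') auto
    qed
    then have "u t > u \<nu>" by (simp add: zero_less_mult_iff)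
    then show False using \<epsilon> t h by (smt (verit) atLeastAtMost_iff)
  qed
  then show thesis using that k by blast
qed

lemma admissibleI:
  assumes "q < \<nu>" "U \<nu> = u \<nu>" "u \<nu> = f \<nu> / c" "real k * T \<le> \<nu>" "\<nu> < real k * T + \<beta>"
  shows "admissible \<nu>"
  unfolding admissible_iff
proof (intro conjI exI[of _ "real k * T + \<beta> - \<nu>"] ballI)
  fix r assume r: "r \<in> {\<nu> - h..\<nu> + (real k * T + \<beta> - \<nu>)}"
  show "u r \<le> u \<nu>"
  proof (cases "r \<le> \<nu>")
    case True then show ?thesis using U_ge[of \<nu> r] assms r by simp
  next
    case False
    then have "u r < u \<nu>"
      by (intro drop_after_maximum[of \<nu> k]) (use assms r \<beta>h in auto)
    then show ?thesis by simp
  qed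
qed (use assms in auto)

text \<open>Two admissible times in one descending phase are less than \<beta> < h apart, so the later one would have
to dominate the earlier one, after which u has dropped.\<close>
lemma admissible_phase_unique:
  assumes "admissible x" "admissible y" "real k * T \<le> x" "x < real k * T + \<beta>"
    "real k * T \<le> y" "y < real k * T + \<beta>"
  shows "x = y"
proof -
  have no: "\<not> x < y" if "admissible x" "admissible y" "real k * T \<le> x" "y < real k * T + \<beta>" for x y
  proof
    assume "x < y"
    have "q < x" "q < y" using that unfolding admissible_def by auto
    have "u y < u x"
      by (rule drop_after_maximum[of x k]) (use that \<open>x < y\<close> \<open>q < x\<close> admissible_critical \<beta>h in auto)
    moreover have "u x \<le> u y"
      using U_ge[of y x] admissibleD_max[OF that(2)] \<open>x < y\<close> \<open>q < y\<close> that \<beta>h by simp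
    ultimately show False by simp
  qed
  show ?thesis using no[OF assms(1,2)] no[OF assms(2,1)] assms by force
qed

lemma admissible_phase_ge1:
  assumes "admissible \<nu>" "real k * T \<le> \<nu>" "\<nu> < real k * T + \<beta>"
  shows "k \<ge> 1"
proof (rule ccontr)
  assume "\<not> k \<ge> 1"
  then have "k = 0" by simp
  then have "\<nu> < \<beta>" using assms by simp
  have "q < \<nu>" using assms by (simp add: admissible_def)
  have "u q \<le> u \<nu>" using U_ge[of \<nu> q] admissibleD_max[OF assms(1)] \<open>\<nu> < \<beta>\<close> \<open>q < \<nu>\<close> \<beta>h q0 by simp
  then show False using below_start[of \<nu>] \<open>q < \<nu>\<close> \<open>\<nu> < \<beta>\<close> by simp
qed

text \<open>Each descending phase contains at most one admissible time, so the admissible times are discrete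
and a least one exists as soon as there is any.\<close>
lemma least_admissible:
  assumes "\<exists>\<nu>. admissible \<nu>"
  shows "admissible (LEAST \<nu>. admissible \<nu>)" "\<And>x. admissible x \<Longrightarrow> (LEAST \<nu>. admissible \<nu>) \<le> x"
proof -
  let ?P = "\<lambda>k. \<exists>\<nu>. admissible \<nu> \<and> real k * T \<le> \<nu> \<and> \<nu> < real k * T + \<beta>"
  have "\<exists>k. ?P k" using assms admissible_phase by metis
  define k where "k = (LEAST k. ?P k)"
  have "?P k" unfolding k_def using \<open>\<exists>k. ?P k\<close> by (rule LeastI_ex)
  then obtain \<nu> where \<nu>: "admissible \<nu>" "real k * T \<le> \<nu>" "\<nu> < real k * T + \<beta>" by blast
  have le: "\<nu> \<le> x" if adm: "admissible x" for x
  proof -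
    obtain j where j: "real j * T \<le> x" "x < real j * T + \<beta>" using admissible_phase[OF adm] by blast
    have "k \<le> j" unfolding k_def using adm j by (intro Least_le) blast
    show ?thesis
    proof (cases "k = j")
      case True then show ?thesis using admissible_phase_unique[OF adm \<nu>(1), of k] j \<nu> by simp
    next
      case False
      then have "real (Suc k) * T \<le> real j * T" using \<open>k \<le> j\<close> T by (intro mult_right_mono) auto
      then show ?thesis using j \<nu> \<beta>T by (simp add: algebra_simps)
    qed
  qed
  have "(LEAST \<nu>. admissible \<nu>) = \<nu>" by (rule Least_equality) (use \<nu>(1) le in auto)
  then show "admissible (LEAST \<nu>. admissible \<nu>)" "\<And>x. admissible x \<Longrightarrow> (LEAST \<nu>. admissible \<nu>) \<le> x"
    using \<nu> le by auto
qed

text \<open>Constant along u exactly where u is its own running maximum.\<close>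
definition orbit_const :: "real \<Rightarrow> real" where
  "orbit_const t = exp (c * t) * u t - G t"

lemma orbit_const_deriv:
  assumes "q < t"
  shows "(orbit_const has_real_derivative exp (c * t) * (b * (U t - u t))) (at t)"
proof -
  have "((\<lambda>t. exp (c * t) * u t - G t) has_real_derivative
      (exp (c * t) * c * u t + (a * u t + b * U t + f t) * exp (c * t)) - exp (c * t) * f t) (at t)"
    by (intro DERIV_diff DERIV_mult G_deriv du assms) (use assms q0 in \<open>auto intro!: derivative_eq_intros\<close>)
  moreover have "(exp (c * t) * c * u t + (a * u t + b * U t + f t) * exp (c * t)) - exp (c * t) * f t
      = exp (c * t) * (b * (U t - u t))"
    by (simp add: c_def algebra_simps)
  ultimately show ?thesis unfolding orbit_const_def by simp
qed

lemma orbit_const_cont: "q \<le> x \<Longrightarrow> continuous_on {x..y} orbit_const"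
  unfolding orbit_const_def using q0 h by (intro continuous_intros cu' G_cont') auto

lemma orbit_const_le_E: "orbit_const t \<le> E t \<longleftrightarrow> u t \<le> f t / c"
proof -
  have "E t - orbit_const t = exp (c * t) * (f t / c - u t)"
    by (simp add: orbit_const_def E_def algebra_simps)
  then show ?thesis by (smt (verit) exp_gt_zero zero_le_mult_iff)
qed

end

lemma derivative_nonneg_if_right_minimum:
  fixes u :: "real \<Rightarrow> real"
  assumes "(u has_real_derivative D) (at t)" "\<epsilon> > 0" "\<And>y. t < y \<Longrightarrow> y < t + \<epsilon> \<Longrightarrow> u t \<le> u y"
  shows "0 \<le> D"
proof (rule ccontr)
  assume "\<not> 0 \<le> D"
  then obtain d where d: "d > 0" "\<And>k. k > 0 \<Longrightarrow> k < d \<Longrightarrow> u (t + k) < u t"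
    using DERIV_neg_dec_right[OF assms(1)] by auto
  define k where "k = min d \<epsilon> / 2"
  have "0 < k" "k < d" "k < \<epsilon>" using d(1) assms(2) by (auto simp: k_def)
  then show False using d(2)[of k] assms(3)[of "t + k"] by force
qed

lemma exp_weight_cancel:
  fixes x y :: real
  shows "exp (- k * t) * x \<le> exp (- k * s) * y \<longleftrightarrow> x \<le> exp (k * (t - s)) * y"
proof -
  have "exp (- k * s) = exp (- k * t) * exp (k * (t - s))"
    unfolding exp_add[symmetric] by (simp add: algebra_simps)
  then have "exp (- k * t) * x \<le> exp (- k * s) * y \<longleftrightarrow>
      exp (- k * t) * x \<le> exp (- k * t) * (exp (k * (t - s)) * y)"
    by (simp only: mult.assoc)
  then show ?thesis by simp
qed

section \<open>Every solution has an admissible return time\<close>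

context unimodal_forcing
begin

lemma periodic_reduce:
  assumes per\<psi>: "\<And>t. 0 \<le> t \<Longrightarrow> \<psi> (t + T) = (\<psi> t :: real)" and "0 \<le> t"
  shows "\<psi> (t + real n * T) = \<psi> t"
proof (induction n)
  case (Suc n)
  have "\<psi> (t + real (Suc n) * T) = \<psi> ((t + real n * T) + T)" by (simp add: algebra_simps)
  also have "\<dots> = \<psi> (t + real n * T)" using assms(2) T by (intro per\<psi>) simp
  finally show ?case using Suc by simp
qed simp

text \<open>The period map of \<psi>' = a \<psi> + y + f is an expansion by e^(aT) > 1, so it has a fixed point; K is the
initial value there.\<close>
lemma periodic_solution_exists:
  obtains \<psi> :: "real \<Rightarrow> real" where "\<And>t. 0 \<le> t \<Longrightarrow> \<psi> (t + T) = \<psi> t" "continuous_on {0..} \<psi>"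
    "\<And>t. 0 < t \<Longrightarrow> (\<psi> has_real_derivative a * \<psi> t + y + f t) (at t)"
proof -
  define J where "J = (\<lambda>t. integral {0..t} (\<lambda>s. exp ((- a) * s) * (y + f s)))"
  have shift: "J (t + T) = J T + exp ((- a) * T) * J t" if "0 \<le> t" for t
    unfolding J_def by (rule exp_weighted_integral_shift)
      (use that T fc per in \<open>auto intro!: continuous_intros\<close>)
  have dJ0: "(J has_real_derivative exp ((- a) * t) * (y + f t)) (at t within {0..})" if "0 \<le> t" for t
    unfolding J_def by (rule integral_has_derivative_right_ray)
      (use that fc in \<open>auto intro!: continuous_intros intro: continuous_on_subset\<close>)
  have dJ: "(J has_real_derivative exp ((- a) * t) * (y + f t)) (at t)" if "0 < t" for t
    by (rule has_derivative_interior[OF dJ0]) (use that in auto)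
  have cJ: "continuous_on {0..} J" using dJ0 by (intro DERIV_continuous_on) auto
  define K where "K = exp (a * T) * J T / (1 - exp (a * T))"
  have "K * (1 - exp (a * T)) = exp (a * T) * J T" using a T by (simp add: K_def)
  then have K: "exp (a * T) * (K + J T) = K" by (simp add: algebra_simps)
  define \<psi> where "\<psi> = (\<lambda>t. exp (a * t) * (K + J t))"
  show thesis
  proof (rule that[of \<psi>])
    fix t :: real assume t: "0 \<le> t"
    have "\<psi> (t + T) = exp (a * t) * (exp (a * T) * (K + J T) + (exp (a * T) * exp ((- a) * T)) * J t)"
      unfolding \<psi>_def shift[OF t] by (simp add: algebra_simps exp_add)
    also have "exp (a * T) * exp ((- a) * T) = 1" by (simp flip: exp_add)
    finally show "\<psi> (t + T) = \<psi> t" using K by (simp add: \<psi>_def)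
  next
    show "continuous_on {0..} \<psi>" unfolding \<psi>_def by (intro continuous_intros cJ)
  next
    fix t :: real assume t: "0 < t"
    have "exp (a * t) * exp ((- a) * t) = 1" by (simp flip: exp_add)
    then have e: "exp (a * t) * (exp ((- a) * t) * (y + f t)) = y + f t"
      by (metis mult.assoc mult_1)
    have "(\<psi> has_real_derivative exp (a * t) * a * (K + J t) + exp ((- a) * t) * (y + f t) * exp (a * t)) (at t)"
      unfolding \<psi>_def using dJ[OF t] by (auto intro!: derivative_eq_intros)
    moreover have "exp (a * t) * a * (K + J t) + exp ((- a) * t) * (y + f t) * exp (a * t)
        = a * \<psi> t + y + f t"
      using e by (simp add: \<psi>_def mult.commute mult.left_commute)
    ultimately show "(\<psi> has_real_derivative a * \<psi> t + y + f t) (at t)" by simp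
  qed
qed

end

context max_solution
begin

abbreviation "rhs \<equiv> \<lambda>t. a * u t + b * U t + f t"

lemma rhs_cont: "q \<le> x \<Longrightarrow> continuous_on {x..y} rhs"
  using h by (intro continuous_intros cu' cU' continuous_on_subset[OF fc]) auto

text \<open>If u(t) = U(t) at some t and no later maximum is admissible, then u increases and equals U for ever
after.  Its orbit constant then stays fixed below E, but E takes arbitrarily small values.\<close>
lemma strictly_below_maximum:
  assumes none: "\<And>\<nu>. \<not> admissible \<nu>" and t: "q < t"
  shows "u t < U t"
proof (rule ccontr)
  assume "\<not> u t < U t"
  then have Ut: "U t = u t" using U_ge_u[of t] t by simp
  have none': "\<exists>r\<in>{t..y}. u \<nu> < u r" if "t \<le> \<nu>" "\<nu> < y" for \<nu> y
  proof (rule ccontr)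
    assume "\<not> ?thesis"
    then have le: "u r \<le> u \<nu>" if "r \<in> {t..y}" for r using that by force
    have "u r \<le> u \<nu>" if "r \<in> {\<nu> - h..y}" for r
    proof (cases "t \<le> r")
      case False
      then have "u r \<le> u t" using U_ge[of t r] Ut t \<open>t \<le> \<nu>\<close> that by auto
      also have "\<dots> \<le> u \<nu>" using le \<open>t \<le> \<nu>\<close> \<open>\<nu> < y\<close> by simp
      finally show ?thesis .
    qed (use le that in auto)
    then have "admissible \<nu>" unfolding admissible_iff
      using t that by (intro conjI exI[of _ "y - \<nu>"]) auto
    then show False using none by blast
  qed
  have mono: "u x < u y" if "t \<le> x" "x < y" for x y
  proof -
    have "\<exists>z\<in>{t..y}. \<forall>r\<in>{t..y}. u r \<le> u z"
      by (rule continuous_attains_sup) (use that t h in \<open>auto intro!: cu'\<close>)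
    then obtain z where z: "z \<in> {t..y}" "\<And>r. r \<in> {t..y} \<Longrightarrow> u r \<le> u z" by blast
    then have "z = y" using none'[of z y] by (cases "z < y") force+
    moreover obtain r where "r \<in> {t..y}" "u x < u r" using none'[of x y] \<open>t \<le> x\<close> \<open>x < y\<close> by blast
    ultimately show ?thesis using z(2)[of r] by simp
  qed
  have UU: "U x = u x" if "t \<le> x" for x
  proof (rule U_eqI[of _ _ x])
    fix r assume r: "x - h \<le> r" "r \<le> x"
    show "u r \<le> u x"
    proof (cases "t \<le> r")
      case True then show ?thesis using mono[of r x] r by (cases "r = x") auto
    next
      case False
      then have "u r \<le> u t" using U_ge[of t r] Ut t \<open>t \<le> x\<close> r by auto
      also have "\<dots> \<le> u x" using mono[of t x] that by (cases "t = x") auto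
      finally show ?thesis .
    qed
  qed (use h in auto)
  obtain k0 where k0: "level k0 < orbit_const t" using level_unbounded by blast
  obtain k1 where k1: "t / T < real k1" using reals_Archimedean2 by blast
  \<comment> \<open>k0 makes the level small, k1 makes the time late\<close>
  define k where "k = max k0 k1"
  define s where "s = real k * T + \<beta>"
  have "level k < orbit_const t" using k0 level_antimono[of k0 k] by (simp add: k_def)
  have "t < real k1 * T" using k1 T by (simp add: pos_divide_less_eq)
  also have "\<dots> \<le> real k * T" using T by (intro mult_right_mono) (auto simp: k_def)
  finally have "t < s" using \<beta> by (simp add: s_def)
  have "orbit_const s = orbit_const t"
  proof (rule DERIV_isconst_end[OF \<open>t < s\<close>])
    show "continuous_on {t..s} orbit_const" using t by (intro orbit_const_cont) simp
    fix x assume "t < x" "x < s"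
    then show "(orbit_const has_real_derivative 0) (at x)"
      using orbit_const_deriv[of x] UU[of x] t by simp
  qed
  moreover have "0 \<le> a * u s + b * U s + f s"
    by (rule derivative_nonneg_if_right_minimum[OF du, of _ 1]) (use mono[of s] \<open>t < s\<close> t in \<open>auto intro: less_imp_le\<close>)
  then have "u s \<le> f s / c" using UU[of s] \<open>t < s\<close> c by (simp add: c_def field_simps)
  then have "orbit_const s \<le> level k" unfolding orbit_const_le_E[symmetric] level_def s_def .
  ultimately show False using \<open>level k < orbit_const t\<close> by simp
qed

text \<open>A value above U(x) after x would be attained at a time at which u equals its running maximum.\<close>
lemma U_antimono:
  assumes none: "\<And>\<nu>. \<not> admissible \<nu>" and t: "q \<le> x" "x \<le> y"
  shows "U y \<le> U x"
proof (rule ccontr)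
  assume less: "\<not> U y \<le> U x"
  obtain s where s: "y - h \<le> s" "s \<le> y" "U y = u s" using U_attained[of y] t by auto
  have "x < s"
  proof (rule ccontr)
    assume "\<not> x < s"
    then have "u s \<le> U x" using U_ge[of x s] s t by simp
    then show False using less s by simp
  qed
  have "\<exists>z\<in>{x..y}. \<forall>r\<in>{x..y}. u r \<le> u z"
    by (rule continuous_attains_sup) (use t h in \<open>auto intro!: cu'\<close>)
  then obtain z where z: "z \<in> {x..y}" "\<And>r. r \<in> {x..y} \<Longrightarrow> u r \<le> u z" by blast
  have gt: "U x < u z" using z(2)[of s] s \<open>x < s\<close> less by simp
  then have "x < z" using z(1) U_ge_u[OF t(1)] by (cases "x = z") auto
  have "U z = u z"
  proof (rule U_eqI[of _ _ z])
    fix r assume r: "z - h \<le> r" "r \<le> z"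
    show "u r \<le> u z"
    proof (cases "x \<le> r")
      case False
      then have "u r \<le> U x" using U_ge[of x r] r \<open>x < z\<close> t by simp
      then show ?thesis using gt by simp
    qed (use z r in auto)
  qed (use h in auto)
  then show False using strictly_below_maximum[OF none, of z] \<open>x < z\<close> t by simp
qed

lemma not_eventually_increasing:
  assumes none: "\<And>\<nu>. \<not> admissible \<nu>" and x: "q \<le> x" and nn: "\<And>t. x \<le> t \<Longrightarrow> 0 \<le> rhs t"
  shows False
proof -
  have "U (x + h) = u (x + h)"
  proof (rule U_eqI[of _ _ "x + h"])
    fix r assume r: "x + h - h \<le> r" "r \<le> x + h"
    show "u r \<le> u (x + h)"
    proof (rule DERIV_nonneg_imp_increasing_open[OF r(2)])
      show "\<exists>y. (u has_real_derivative y) (at s) \<and> 0 \<le> y" if "r < s" for s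
        using du[of s] nn[of s] that r x by auto
    qed (use r x h in \<open>auto intro!: cu'\<close>)
  qed (use h in auto)
  then show False using strictly_below_maximum[OF none, of "x + h"] x h by simp
qed

text \<open>The speed of descent reproduces itself: -u' = a (U - u) + c U - f, where U - u is at most h times the
largest recent speed and a h \<le> 1.  So -u' stays bounded by M + c U, and this becomes negative when U
tends to -\<infinity>.\<close>
lemma unbounded_below_impossible_small_delay:
  assumes none: "\<And>\<nu>. \<not> admissible \<nu>" and unb: "\<And>y. \<exists>t\<ge>q. U t < y" and ah: "a * h \<le> 1"
  shows False
proof -
  obtain t0 where t0: "q \<le> t0" "U t0 < 0" using unb by blast
  have "bounded (rhs ` {t0..t0 + h})"
    by (intro compact_imp_bounded compact_continuous_image rhs_cont t0(1) compact_Icc)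
  then obtain B where "\<forall>y\<in>rhs ` {t0..t0 + h}. \<bar>y\<bar> \<le> B" unfolding bounded_real by (rule exE)
  then have B: "\<bar>rhs t\<bar> \<le> B" if "t \<in> {t0..t0 + h}" for t using that by blast
  define M where "M = \<bar>B\<bar> + 1"
  have M: "M > 0" by (simp add: M_def)
  have est: "- rhs t \<le> M + c * U t" if t: "t0 + h \<le> t" and low: "\<And>s. t0 \<le> s \<Longrightarrow> s < t \<Longrightarrow> - rhs s < M" for t
  proof -
    have "q \<le> t" using t t0 h by simp
    then obtain s where s: "t - h \<le> s" "s \<le> t" "U t = u s" by (rule U_attained)
    have "u s + M * s \<le> u t + M * t"
    proof (rule DERIV_nonneg_imp_increasing_open[OF s(2)])
      fix x assume x: "s < x" "x < t"
      have "((\<lambda>x. u x + M * x) has_real_derivative rhs x + M) (at x)"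
        using du[of x] x s t t0 by (auto intro!: derivative_eq_intros)
      moreover have "0 \<le> rhs x + M" using low[of x] x s t by simp
      ultimately show "\<exists>y. ((\<lambda>x. u x + M * x) has_real_derivative y) (at x) \<and> 0 \<le> y" by blast
    qed (use s t t0 h in \<open>auto intro!: continuous_intros cu'\<close>)
    then have "U t - u t \<le> M * (t - s)" using s(3) by (simp add: algebra_simps)
    also have "\<dots> \<le> M * h" using M s by (intro mult_left_mono) auto
    finally have "a * (U t - u t) \<le> a * (M * h)" using a by (intro mult_left_mono) auto
    also have "\<dots> = (a * h) * M" by simp
    also have "\<dots> \<le> 1 * M" using ah M by (intro mult_right_mono) auto
    finally have "a * (U t - u t) \<le> M" by simp
    moreover have "- rhs t = a * (U t - u t) + c * U t - f t" by (simp add: c_def algebra_simps)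
    ultimately show ?thesis using fnn[of t] by simp
  qed
  have neg: "c * U t < 0" if "t0 \<le> t" for t
    using U_antimono[OF none t0(1) that] t0(2) c by (intro mult_pos_neg) auto
  have low: "- rhs t < M" if t: "t0 \<le> t" for t
  proof (rule ccontr)
    assume "\<not> - rhs t < M"
    moreover have "continuous_on {t0..t} (\<lambda>t. - rhs t - M)" using t0 by (intro continuous_intros rhs_cont)
    ultimately obtain r where r: "r \<in> {t0..t}" "0 \<le> - rhs r - M" "\<And>s. t0 \<le> s \<Longrightarrow> s < r \<Longrightarrow> - rhs s - M < 0"
      using first_nonneg_point[of t0 t "\<lambda>t. - rhs t - M" t] t by auto
    show False
    proof (cases "r \<le> t0 + h")
      case True
      then show False using B[of r] r by (auto simp: M_def)
    next
      case False
      then have "- rhs r \<le> M + c * U r" using r by (intro est) force+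
      then show False using neg[of r] r by auto
    qed
  qed
  obtain t1 where t1: "q \<le> t1" "U t1 < - M / c" using unb by blast
  define x where "x = max t1 (t0 + h)"
  show False
  proof (rule not_eventually_increasing[OF none, of x])
    show "q \<le> x" using t1 by (simp add: x_def)
    fix t assume t: "x \<le> t"
    have "U t < - M / c" using U_antimono[OF none t1(1), of t] t t1(2) by (simp add: x_def)
    then have "c * U t < - M" using c by (simp add: field_simps)
    moreover have "- rhs t \<le> M + c * U t" using t low by (intro est) (auto simp: x_def)
    ultimately show "0 \<le> rhs t" by simp
  qed
qed

text \<open>Let P(\<kappa>) say that eventually u' \<ge> (a - \<kappa>) u, that is, -u grows at most like e^((a-\<kappa>)t).  A growth
bound limits how much smaller -u was one delay ago, hence bounds -U from below, and the equation
then gives the better bound with -b e^((\<kappa>-a)h) in place of \<kappa>.  As e^x \<ge> e x, this improvement is at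
least the factor \<theta> = -b h e^(1-ah) > 1, so P(a) is reached and u is eventually increasing.\<close>
lemma eventually_negative_impossible_large_delay:
  assumes none: "\<And>\<nu>. \<not> admissible \<nu>" and neg: "q \<le> t0" "U t0 < 0" and bh: "b * h < - exp (a * h - 1)"
  shows False
proof -
  have Uneg: "U t < 0" if "t0 \<le> t" for t using U_antimono[OF none neg(1) that] neg(2) by simp
  have uneg: "u t < 0" if "t0 \<le> t" for t using U_ge_u[of t] Uneg[OF that] that neg(1) by simp
  define P where "P = (\<lambda>\<kappa>. \<exists>x\<ge>t0. \<forall>t\<ge>x. (a - \<kappa>) * u t \<le> rhs t)"
  have P_mono: "P \<kappa>'" if P: "P \<kappa>" and le: "\<kappa>' \<le> \<kappa>" for \<kappa> \<kappa>'
  proof -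
    obtain x where x: "x \<ge> t0" "\<And>t. t \<ge> x \<Longrightarrow> (a - \<kappa>) * u t \<le> rhs t" using P unfolding P_def by blast
    have "(a - \<kappa>') * u t \<le> rhs t" if "t \<ge> x" for t
    proof -
      have "(a - \<kappa>') * u t \<le> (a - \<kappa>) * u t"
        using le uneg[of t] that x(1) by (intro mult_right_mono_neg) auto
      then show ?thesis using x(2)[OF that] by simp
    qed
    then show ?thesis using x(1) unfolding P_def by blast
  qed
  have P0: "P 0" unfolding P_def
  proof (intro exI[of _ t0] conjI allI impI)
    fix t assume "t \<ge> t0"
    then have "b * U t \<ge> 0" using Uneg[of t] b by (intro mult_nonpos_nonpos) auto
    then show "(a - 0) * u t \<le> rhs t" using fnn[of t] by simp
  qed simp
  have step: "P (- b * exp ((\<kappa> - a) * h))" if P: "P \<kappa>" and \<kappa>: "\<kappa> \<le> a" for \<kappa>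
  proof -
    obtain x where x: "x \<ge> t0" "\<And>t. t \<ge> x \<Longrightarrow> (a - \<kappa>) * u t \<le> rhs t" using P unfolding P_def by blast
    have "(a - (- b * exp ((\<kappa> - a) * h))) * u t \<le> rhs t" if t: "t \<ge> x + h" for t
    proof -
      have "q \<le> t" using t x neg h by simp
      then obtain s where s: "t - h \<le> s" "s \<le> t" "U t = u s" by (rule U_attained)
      have "exp (- (a - \<kappa>) * s) * (u s - 0) \<le> exp (- (a - \<kappa>) * t) * (u t - 0)"
      proof (rule DERIV_nonneg_imp_increasing_open[OF s(2)])
        fix r assume r: "s < r" "r < t"
        have "0 \<le> exp (- (a - \<kappa>) * r) * (rhs r - (a - \<kappa>) * (u r - 0))"
          using x(2)[of r] r s t by simp
        moreover have "q < r" using r s t x neg by simp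
        ultimately show "\<exists>y. ((\<lambda>r. exp (- (a - \<kappa>) * r) * (u r - 0)) has_real_derivative y) (at r) \<and> 0 \<le> y"
          using has_derivative_exp_weight[OF du, of r "a - \<kappa>" 0] by blast
      qed (use s t x neg h in \<open>auto intro!: continuous_intros cu'\<close>)
      then have "u s \<le> exp ((a - \<kappa>) * (s - t)) * u t"
        unfolding exp_weight_cancel by simp
      also have "(a - \<kappa>) * (s - t) = - ((a - \<kappa>) * (t - s))" by (simp add: algebra_simps)
      also have "exp (- ((a - \<kappa>) * (t - s))) * u t \<le> exp ((\<kappa> - a) * h) * u t"
      proof (rule mult_right_mono_neg)
        have "(a - \<kappa>) * (t - s) \<le> (a - \<kappa>) * h" using \<kappa> s by (intro mult_left_mono) auto
        then show "exp ((\<kappa> - a) * h) \<le> exp (- ((a - \<kappa>) * (t - s)))" by (simp add: algebra_simps)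
        show "u t \<le> 0" using uneg[of t] t x h by simp
      qed
      finally have "b * (exp ((\<kappa> - a) * h) * u t) \<le> b * U t"
        using b s(3) by (intro mult_left_mono_neg) auto
      then show ?thesis using fnn[of t] by (simp add: algebra_simps)
    qed
    then show ?thesis unfolding P_def using x(1) h by (intro exI[of _ "x + h"]) auto
  qed
  define \<theta> where "\<theta> = - b * h * exp (1 - a * h)"
  have "exp (a * h - 1) * exp (1 - a * h) = 1" by (simp flip: exp_add)
  moreover have "exp (a * h - 1) * exp (1 - a * h) < - b * h * exp (1 - a * h)"
    using bh by (intro mult_strict_right_mono) auto
  ultimately have \<theta>: "1 < \<theta>" by (simp add: \<theta>_def)
  have grow: "\<theta> * \<kappa> \<le> - b * exp ((\<kappa> - a) * h)" for \<kappa>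
  proof -
    have "\<kappa> * h \<le> exp (\<kappa> * h - 1)" using exp_ge_add_one_self[of "\<kappa> * h - 1"] by simp
    then have "(- b * exp (1 - a * h)) * (\<kappa> * h) \<le> (- b * exp (1 - a * h)) * exp (\<kappa> * h - 1)"
      using b by (intro mult_left_mono) (auto intro: mult_nonpos_nonneg)
    also have "\<dots> = - b * exp ((\<kappa> - a) * h)"
      by (simp add: algebra_simps flip: exp_add)
    finally show ?thesis by (simp add: \<theta>_def algebra_simps)
  qed
  define \<kappa>1 where "\<kappa>1 = - b * exp (- a * h)"
  have \<kappa>1: "\<kappa>1 > 0" using b by (simp add: \<kappa>1_def mult_neg_pos)
  have "P \<kappa>1" using step[OF P0] a by (simp add: \<kappa>1_def)
  have Pn: "P (min a (\<theta> ^ n * \<kappa>1))" for n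
  proof (induction n)
    case 0 then show ?case using P_mono[OF \<open>P \<kappa>1\<close>] by simp
  next
    case (Suc n)
    let ?k = "min a (\<theta> ^ n * \<kappa>1)"
    have Pk: "P (- b * exp ((?k - a) * h))" by (rule step[OF Suc]) simp
    have "min a (\<theta> ^ Suc n * \<kappa>1) \<le> \<theta> * ?k"
    proof (cases "a \<le> \<theta> ^ n * \<kappa>1")
      case True
      have "1 * a \<le> \<theta> * a" using \<theta> a by (intro mult_right_mono) auto
      then show ?thesis using True by simp
    qed auto
    then have "min a (\<theta> ^ Suc n * \<kappa>1) \<le> - b * exp ((?k - a) * h)" using grow[of ?k] by linarith
    then show ?case by (rule P_mono[OF Pk])
  qed
  obtain n where "a / \<kappa>1 < \<theta> ^ n" using real_arch_pow[OF \<theta>] by blast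
  then have "a < \<theta> ^ n * \<kappa>1" using \<kappa>1 by (simp add: pos_divide_less_eq)
  then have "min a (\<theta> ^ n * \<kappa>1) = a" by simp
  then have "P a" using Pn[of n] by metis
  then obtain x where "x \<ge> t0" "\<forall>t\<ge>x. (a - a) * u t \<le> rhs t" unfolding P_def by blast
  then show False using not_eventually_increasing[OF none, of x] neg(1) by auto
qed

text \<open>If U decreases to a limit l, then u approaches a T-periodic solution \<psi> of \<psi>' = a \<psi> + b l + f, because
any other deviation grows like e^(at).  Then \<psi> \<le> l, with equality somewhere in every window of length
h.  But at a maximum of \<psi> the forcing takes the value c l while decreasing, which happens at most
once per period, and h < T leaves a window without such a point.\<close>
lemma bounded_below_impossible:
  assumes none: "\<And>\<nu>. \<not> admissible \<nu>" and bd: "\<And>t. q \<le> t \<Longrightarrow> y \<le> U t"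
  shows False
proof -
  define l where "l = Inf (U ` {q..})"
  have bdd: "bdd_below (U ` {q..})" using bd by (auto intro!: bdd_belowI2)
  have l_le: "l \<le> U t" if "q \<le> t" for t unfolding l_def using that bdd by (auto intro: cINF_lower)
  have ex_close: "\<exists>x>q. \<forall>t\<ge>x. U t \<le> l + \<epsilon>" if "\<epsilon> > 0" for \<epsilon>
  proof -
    have "\<exists>z\<in>U ` {q..}. z < l + \<epsilon>"
      by (rule cInf_lessD) (use that in \<open>auto simp: l_def\<close>)
    then obtain x where x: "q \<le> x" "U x < l + \<epsilon>" by auto
    have "\<forall>t\<ge>x + 1. U t \<le> l + \<epsilon>"
      using U_antimono[OF none x(1)] x(2) by (metis add_increasing2 le_add_same_cancel1 less_imp_le order_trans zero_le_one)
    then show ?thesis using x(1) by (intro exI[of _ "x + 1"]) auto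
  qed
  obtain \<psi> where per\<psi>: "\<And>t. 0 \<le> t \<Longrightarrow> \<psi> (t + T) = \<psi> t" and c\<psi>: "continuous_on {0..} \<psi>"
    and d\<psi>: "\<And>t. 0 < t \<Longrightarrow> (\<psi> has_real_derivative a * \<psi> t + b * l + f t) (at t)"
    using periodic_solution_exists[of "b * l"] by blast
  have c\<psi>': "continuous_on {x..z} \<psi>" if "0 \<le> x" for x z using that by (intro continuous_on_subset[OF c\<psi>]) auto
  have shift\<psi>: "\<psi> (t + real n * T) = \<psi> t" if "0 \<le> t" for t n by (rule periodic_reduce[of \<psi>, OF per\<psi> that])
  have "bounded (\<psi> ` {0..T})" by (intro compact_imp_bounded compact_continuous_image c\<psi>' compact_Icc) simp
  then obtain B where "\<forall>y\<in>\<psi> ` {0..T}. \<bar>y\<bar> \<le> B" unfolding bounded_real by (rule exE)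
  then have B0: "\<bar>\<psi> t\<bar> \<le> B" if "t \<in> {0..T}" for t using that by blast
  have B: "\<bar>\<psi> t\<bar> \<le> B" if t: "0 \<le> t" for t
  proof -
    obtain k where k: "real k * T \<le> t" "t < real (Suc k) * T" using phase_exists[OF t] by blast
    have "\<psi> t = \<psi> (t - real k * T)" using shift\<psi>[of "t - real k * T" k] k by simp
    moreover have "t - real k * T \<in> {0..T}" using k by (auto simp: algebra_simps)
    ultimately show ?thesis using B0 by simp
  qed
  define e where "e = (\<lambda>t. u t - \<psi> t)"
  have de: "(e has_real_derivative a * e t + b * (U t - l)) (at t)" if "q < t" for t
    using DERIV_diff[OF du[OF that] d\<psi>[of t]] that q0 unfolding e_def by (simp add: algebra_simps)
  have ce: "continuous_on {x..z} e" if "q \<le> x" for x z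
    unfolding e_def using that q0 h by (intro continuous_intros cu' c\<psi>') auto
  have e_nonneg: "0 \<le> e x" if x: "q < x" for x
  proof (rule ccontr)
    assume "\<not> 0 \<le> e x"
    then have ex: "e x < 0" by simp
    have decay: "e t \<le> e x * (1 + a * (t - x))" if t: "x \<le> t" for t
    proof -
      have "exp (- a * t) * (e t - 0) \<le> exp (- a * x) * (e x - 0)"
      proof (rule DERIV_nonpos_imp_decreasing_open[OF t])
        fix r assume r: "x < r" "r < t"
        have "a * e r + b * (U r - l) - a * (e r - 0) \<le> 0"
          using b l_le[of r] r x by (simp add: mult_nonpos_nonneg)
        then have "exp (- a * r) * (a * e r + b * (U r - l) - a * (e r - 0)) \<le> 0"
          by (intro mult_nonneg_nonpos) auto
        moreover have "q < r" using r x by simp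
        ultimately show "\<exists>y. ((\<lambda>r. exp (- a * r) * (e r - 0)) has_real_derivative y) (at r) \<and> y \<le> 0"
          using has_derivative_exp_weight[OF de, of r a 0] by blast
      qed (use x in \<open>auto intro!: continuous_intros ce\<close>)
      then have "e t \<le> exp (a * (t - x)) * e x" unfolding exp_weight_cancel by simp
      also have "\<dots> \<le> (1 + a * (t - x)) * e x"
        using ex exp_ge_add_one_self[of "a * (t - x)"] by (intro mult_right_mono_neg) auto
      finally show ?thesis by (simp only: mult.commute)
    qed
    define r where "r = - (a * e x)"
    have r: "r > 0" using a ex by (simp add: r_def mult_pos_neg)
    \<comment> \<open>after the time d the linear lower bound of the decay exceeds |y| + B\<close>
    define d where "d = (\<bar>y\<bar> + B + 1) / r"
    have d: "d > 0" using B[of 0] r by (auto simp: d_def intro!: divide_pos_pos)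
    have small: "u t < y" if "x + d \<le> t" for t
    proof -
      have rd: "r * d = \<bar>y\<bar> + B + 1" using r by (simp add: d_def)
      have "e t \<le> e x * (1 + a * (t - x))" using that d by (intro decay) simp
      also have "\<dots> = e x - r * (t - x)" by (simp add: r_def algebra_simps)
      also have "\<dots> \<le> e x - r * d"
        using that r by (intro diff_left_mono mult_left_mono) auto
      also have "\<dots> < - (\<bar>y\<bar> + B)" using rd ex by simp
      finally have "u t - \<psi> t < - (\<bar>y\<bar> + B)" by (simp add: e_def)
      moreover have "\<bar>\<psi> t\<bar> \<le> B" using that d x q0 by (intro B) simp
      ultimately show ?thesis by linarith
    qed
    have "q \<le> x + d + h" using x d h by simp
    then obtain s where "x + d + h - h \<le> s" "U (x + d + h) = u s" by (rule U_attained)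
    then show False using bd[OF \<open>q \<le> x + d + h\<close>] small[of s] by simp
  qed
  have e_small: "e t \<le> - b * \<epsilon> / a" if x: "q < x" "\<And>t. x \<le> t \<Longrightarrow> U t \<le> l + \<epsilon>" and xt: "x \<le> t" for x t \<epsilon>
  proof (rule ccontr)
    define \<eta> where "\<eta> = - b * \<epsilon> / a"
    have a\<eta>: "a * \<eta> = - b * \<epsilon>" using a by (simp add: \<eta>_def)
    assume "\<not> e t \<le> - b * \<epsilon> / a"
    then have et: "e t - \<eta> > 0" by (simp add: \<eta>_def)
    have grow: "(e t - \<eta>) * (1 + a * (s - t)) \<le> e s - \<eta>" if s: "t \<le> s" for s
    proof -
      have "exp (- a * t) * (e t - \<eta>) \<le> exp (- a * s) * (e s - \<eta>)"
      proof (rule DERIV_nonneg_imp_increasing_open[OF s])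
        fix r assume r: "t < r" "r < s"
        have "b * \<epsilon> \<le> b * (U r - l)" using b x(2)[of r] r xt by (intro mult_left_mono_neg) auto
        then have "0 \<le> a * e r + b * (U r - l) - a * (e r - \<eta>)" using a\<eta> by (simp add: algebra_simps)
        then have "0 \<le> exp (- a * r) * (a * e r + b * (U r - l) - a * (e r - \<eta>))" by simp
        moreover have "q < r" using r x xt by simp
        ultimately show "\<exists>y. ((\<lambda>r. exp (- a * r) * (e r - \<eta>)) has_real_derivative y) (at r) \<and> 0 \<le> y"
          using has_derivative_exp_weight[OF de, of r a \<eta>] by blast
      qed (use x xt in \<open>auto intro!: continuous_intros ce\<close>)
      then have "exp (- a * t) * (e t - \<eta>) \<le> exp (- a * s) * (e s - \<eta>)" .
      then have "e t - \<eta> \<le> exp (a * (t - s)) * (e s - \<eta>)" unfolding exp_weight_cancel .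
      then have "exp (a * (s - t)) * (e t - \<eta>) \<le> exp (a * (s - t)) * (exp (a * (t - s)) * (e s - \<eta>))"
        by (rule mult_left_mono) simp
      also have "\<dots> = exp (a * (s - t) + a * (t - s)) * (e s - \<eta>)" by (simp only: exp_add mult.assoc)
      also have "a * (s - t) + a * (t - s) = 0" by (simp add: algebra_simps)
      finally have "exp (a * (s - t)) * (e t - \<eta>) \<le> e s - \<eta>" by simp
      moreover have "(1 + a * (s - t)) * (e t - \<eta>) \<le> exp (a * (s - t)) * (e t - \<eta>)"
        using et exp_ge_add_one_self[of "a * (s - t)"] by (intro mult_right_mono) auto
      ultimately show ?thesis by (simp only: mult.commute)
    qed
    define d where "d = (\<bar>\<eta>\<bar> + B + \<bar>U q\<bar> + 1) / (a * (e t - \<eta>))"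
    have d: "d > 0" using B[of 0] a et by (auto simp: d_def intro!: divide_pos_pos mult_pos_pos)
    have "(e t - \<eta>) * (1 + a * d) \<le> e (t + d) - \<eta>" using grow[of "t + d"] d by simp
    moreover have "(e t - \<eta>) * (1 + a * d) = (e t - \<eta>) + (\<bar>\<eta>\<bar> + B + \<bar>U q\<bar> + 1)"
    proof -
      have "(a * (e t - \<eta>)) * d = \<bar>\<eta>\<bar> + B + \<bar>U q\<bar> + 1" using a et by (simp add: d_def)
      then show ?thesis by (simp add: algebra_simps)
    qed
    moreover have "u (t + d) \<le> U q"
      using U_ge_u[of "t + d"] U_antimono[OF none order_refl, of "t + d"] x xt d by simp
    moreover have "\<bar>\<psi> (t + d)\<bar> \<le> B" using d x xt q0 by (intro B) simp
    ultimately show False using et unfolding e_def by linarith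
  qed
  have far: "\<exists>n. x \<le> t + real n * T" for x t
  proof -
    obtain n where "(x - t) / T < real n" using reals_Archimedean2 by blast
    then have "x - t < real n * T" using T by (simp add: pos_divide_less_eq)
    then show ?thesis by (intro exI[of _ n]) simp
  qed
  have \<psi>_le: "\<psi> t \<le> l" if t: "0 \<le> t" for t
  proof (rule field_le_epsilon)
    fix \<epsilon> :: real assume "\<epsilon> > 0"
    then obtain x where x: "q < x" "\<forall>t\<ge>x. U t \<le> l + \<epsilon>" using ex_close by blast
    obtain n where n: "x \<le> t + real n * T" using far by blast
    have "\<psi> t = u (t + real n * T) - e (t + real n * T)" using shift\<psi>[OF t] by (simp add: e_def)
    also have "\<dots> \<le> U (t + real n * T)"
      using U_ge_u[of "t + real n * T"] e_nonneg[of "t + real n * T"] x n by simp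
    also have "\<dots> \<le> l + \<epsilon>" using x n by simp
    finally show "\<psi> t \<le> l + \<epsilon>" .
  qed
  have window: "\<exists>s\<in>{t - h..t}. \<psi> s = l" if t: "h \<le> t" for t
  proof -
    have "\<exists>z\<in>{t - h..t}. \<forall>r\<in>{t - h..t}. \<psi> r \<le> \<psi> z"
      by (rule continuous_attains_sup) (use t h in \<open>auto intro!: c\<psi>'\<close>)
    then obtain z where z: "z \<in> {t - h..t}" "\<And>r. r \<in> {t - h..t} \<Longrightarrow> \<psi> r \<le> \<psi> z" by blast
    have "l \<le> \<psi> z"
    proof (rule field_le_epsilon)
      fix \<epsilon>' :: real assume "\<epsilon>' > 0"
      \<comment> \<open>chosen such that the bound of e_small equals \<epsilon>'\<close>
      define \<epsilon> where "\<epsilon> = \<epsilon>' * a / - b"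
      have \<epsilon>: "\<epsilon> > 0" "- b * \<epsilon> / a = \<epsilon>'" using \<open>\<epsilon>' > 0\<close> a b by (auto simp: \<epsilon>_def divide_less_0_iff)
      obtain x where x: "q < x" "\<forall>t\<ge>x. U t \<le> l + \<epsilon>" using ex_close[OF \<epsilon>(1)] by blast
      obtain n where n: "x + h \<le> t + real n * T" using far by blast
      have qn: "q \<le> t + real n * T" using n x h by simp
      then obtain s where s: "t + real n * T - h \<le> s" "s \<le> t + real n * T" "U (t + real n * T) = u s"
        by (rule U_attained)
      define r where "r = s - real n * T"
      have r: "r \<in> {t - h..t}" using s by (auto simp: r_def)
      have "\<psi> r = \<psi> s" using shift\<psi>[of r n] r t by (simp add: r_def)
      moreover have "e s \<le> \<epsilon>'" using e_small[OF x(1) _, of \<epsilon> s] x s n \<epsilon>(2) by simp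
      moreover have "l \<le> u s" using l_le[OF qn] s by simp
      ultimately show "l \<le> \<psi> z + \<epsilon>'" using z(2)[OF r] by (simp add: e_def)
    qed
    then have "\<psi> z = l" using \<psi>_le[of z] z(1) t by simp
    then show ?thesis using z(1) by blast
  qed
  have maxpt: "f s = c * l \<and> (\<exists>k. real k * T \<le> s \<and> s < real k * T + \<beta>)" if s: "0 < s" "\<psi> s = l" for s
  proof -
    have "a * \<psi> s + b * l + f s = 0"
    proof (rule DERIV_local_max[OF d\<psi>[OF s(1)] s(1)], intro allI impI)
      fix y assume "\<bar>s - y\<bar> < s"
      then show "\<psi> y \<le> \<psi> s" using \<psi>_le[of y] s(2) by simp
    qed
    then have fs: "f s = c * l" using s(2) by (simp add: c_def algebra_simps)
    obtain k where k: "real k * T \<le> s" "s < real (Suc k) * T" using phase_exists[of s] s by auto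
    have "s < real k * T + \<beta>"
    proof (rule ccontr)
      assume "\<not> s < real k * T + \<beta>"
      then have k\<beta>: "real k * T + \<beta> \<le> s" by simp
      have "exp (- a * s) * (\<psi> s - l) < exp (- a * (real (Suc k) * T)) * (\<psi> (real (Suc k) * T) - l)"
      proof (rule DERIV_pos_imp_increasing_open[OF k(2)])
        fix r assume r: "s < r" "r < real (Suc k) * T"
        have "f s < f r" using f_inc[OF k\<beta> r(1)] r(2) by simp
        moreover have "a * \<psi> r + b * l + f r - a * (\<psi> r - l) = f r - f s"
          using fs by (simp add: c_def algebra_simps)
        ultimately have "0 < exp (- a * r) * (a * \<psi> r + b * l + f r - a * (\<psi> r - l))" by simp
        then show "\<exists>y. ((\<lambda>r. exp (- a * r) * (\<psi> r - l)) has_real_derivative y) (at r) \<and> 0 < y"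
          using has_derivative_exp_weight[OF d\<psi>, of r a l] r s by (meson less_trans)
      qed (use s in \<open>auto intro!: continuous_intros c\<psi>'\<close>)
      then have "\<psi> (real (Suc k) * T) > l" using s(2) by (simp add: zero_less_mult_iff)
      then show False using \<psi>_le[of "real (Suc k) * T"] T by simp
    qed
    then show ?thesis using fs k by blast
  qed
  \<comment> \<open>two contact points of \<psi> with l at a distance less than T\<close>
  obtain s1 where s1: "s1 \<in> {T + h - h..T + h}" "\<psi> s1 = l" using window[of "T + h"] T by auto
  define \<delta> where "\<delta> = (T - h) / 2"
  have \<delta>: "\<delta> > 0" "\<delta> + h < T" using hT by (auto simp: \<delta>_def field_simps)
  obtain s2 where s2: "s2 \<in> {s1 + \<delta> + h - h..s1 + \<delta> + h}" "\<psi> s2 = l"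
    using window[of "s1 + \<delta> + h"] s1 T \<delta> h by auto
  have pos: "0 < s1" "s1 < s2" "s2 < s1 + T" using s1 s2 T \<delta> h by auto
  obtain j where j: "real j * T \<le> s1" "s1 < real j * T + \<beta>" and f1: "f s1 = c * l"
    using maxpt[OF pos(1) s1(2)] by blast
  obtain k where k: "real k * T \<le> s2" "s2 < real k * T + \<beta>" and f2: "f s2 = c * l"
    using maxpt[of s2] pos s2(2) by fastforce
  have "real j * T < real (Suc k) * T" using j k pos \<beta>T by (simp add: algebra_simps)
  then have jk: "j \<le> k" using T by simp
  have "real k * T < real (j + 2) * T" using j k pos \<beta>T by (simp add: algebra_simps)
  then have "k < j + 2" using T by simp
  then have "k = j \<or> k = Suc j" using jk by auto
  then show False
  proof
    assume "k = j"
    then show False using f_dec[of j s1 s2] j k pos f1 f2 by simp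
  next
    assume "k = Suc j"
    then have "f s1 < f (s2 - T)" using j k pos by (intro f_dec[of j]) (auto simp: algebra_simps)
    moreover have "f (s2 - T) = f s2" using per[of "s2 - T"] by simp
    ultimately show False using f1 f2 by simp
  qed
qed

theorem admissible_exists:
  assumes stab: "a * h \<le> 1 \<or> b * h < - exp (a * h - 1)"
  shows "\<exists>\<nu>. admissible \<nu>"
proof (rule ccontr)
  assume "\<not> ?thesis"
  then have none: "\<And>\<nu>. \<not> admissible \<nu>" by blast
  show False
  proof (cases "\<exists>y. \<forall>t\<ge>q. y \<le> U t")
    case True then show False using bounded_below_impossible[OF none] by blast
  next
    case False
    then have unb: "\<And>y. \<exists>t\<ge>q. U t < y" by (meson not_le)
    then obtain t0 where "q \<le> t0" "U t0 < 0" by blast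
    then show False
      using stab unbounded_below_impossible_small_delay[OF none unb]
        eventually_negative_impossible_large_delay[OF none] by blast
  qed
qed

end

section \<open>The shape of a solution up to its return time\<close>

text \<open>If z dominates both end points, then the maximum over [x, y] is attained in the interior, at z if
not elsewhere.\<close>
lemma turning_point_between:
  fixes u :: "real \<Rightarrow> real"
  assumes cont: "continuous_on {x..y} u"
    and diff: "\<And>t. x < t \<Longrightarrow> t < y \<Longrightarrow> (u has_real_derivative u' t) (at t)"
    and z: "x < z" "z < y" "u x \<le> u z" "u y \<le> u z"
  shows "\<exists>w. x < w \<and> w < y \<and> turning_point u w"
proof -
  have "\<exists>w\<in>{x..y}. \<forall>r\<in>{x..y}. u r \<le> u w"
    by (rule continuous_attains_sup) (use z cont in auto)
  then obtain w0 where w0: "w0 \<in> {x..y}" "\<And>r. r \<in> {x..y} \<Longrightarrow> u r \<le> u w0" by blast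
  \<comment> \<open>a maximum at an end point has the same value as z\<close>
  define w where "w = (if w0 = x \<or> w0 = y then z else w0)"
  have w: "x < w" "w < y" using w0(1) z by (auto simp: w_def)
  have "u w0 \<le> u w" using z by (auto simp: w_def)
  then have max: "u r \<le> u w" if "r \<in> {x..y}" for r using w0(2)[OF that] by simp
  have "u' w = 0"
    by (rule DERIV_local_max[OF diff[OF w], of "min (w - x) (y - w)"])
      (use w max in \<open>auto simp: abs_less_iff\<close>)
  moreover have "\<forall>\<^sub>F s in at w. u s \<le> u w"
    unfolding eventually_at by (intro exI[of _ "min (w - x) (y - w)"])
      (use w max in \<open>auto simp: dist_real_def abs_less_iff\<close>)
  ultimately have "turning_point u w" using diff[OF w] by (auto simp: turning_point_def)
  then show ?thesis using w by blast
qed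

text \<open>The conclusions drawn from U-shapedness in the form in which they are used.  The point m is the
minimum.  The gap u(t) - u(t - h) is negative before \<mu> and positive after it; before \<mu> the running
maximum is the oldest value in the window, after \<mu> the newest.  For q = \<beta> the first branch is absent
and m = \<mu> = \<beta>.\<close>
locale shaped_solution = max_solution +
  fixes m \<mu> \<nu> :: real
  assumes adm: "admissible \<nu>"
    and qm: "q \<le> m" and m\<mu>: "m \<le> \<mu>" and \<mu>\<nu>: "\<mu> < \<nu>"
    and m_less: "q < \<beta> \<Longrightarrow> q < m \<and> m < \<mu>" and \<mu>\<beta>: "q = \<beta> \<Longrightarrow> \<mu> = \<beta>"
    and early: "q < t \<Longrightarrow> t < \<mu> \<Longrightarrow> u t < u (t - h)"
    and late: "\<mu> < t \<Longrightarrow> t < \<nu> \<Longrightarrow> u (t - h) < u t"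
    and U_early: "q \<le> t \<Longrightarrow> t \<le> \<mu> \<Longrightarrow> U t = u (t - h)"
    and U_late: "\<mu> \<le> t \<Longrightarrow> t \<le> \<nu> \<Longrightarrow> U t = u t"
    and gap_mono: "m \<le> s \<Longrightarrow> s \<le> t \<Longrightarrow> t \<le> \<mu> \<Longrightarrow> u s - u (s - h) \<le> u t - u (t - h)"
    and late_mono: "\<mu> \<le> s \<Longrightarrow> s < t \<Longrightarrow> t \<le> \<nu> \<Longrightarrow> u s < u t"
    and late_below: "\<mu> \<le> t \<Longrightarrow> t \<le> \<nu> \<Longrightarrow> u t \<le> f t / c"

context max_solution
begin

text \<open>Without turning points other than m the solution decreases to m and increases afterwards, so the
running maximum is the larger of the two end values of the window and the gap u(t) - u(t - h)
increases past m.  The scalar equation near \<nu> forces U = u there, so the gap vanishes before \<nu>.\<close>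
lemma shaped_if_single_turning_point:
  assumes \<nu>: "admissible \<nu>"
    and m: "{t \<in> {q<..<\<nu>}. turning_point u t} = {m}" "\<And>t. t \<in> {q<..<\<nu>} \<Longrightarrow> u m \<le> u t"
    and \<delta>: "\<delta> > 0" "\<And>t. t \<in> {\<nu> - \<delta><..<\<nu>} \<Longrightarrow> (u has_real_derivative (a + b) * u t + f t) (at t)"
    and q: "q < \<beta>"
  shows "\<exists>\<mu>. shaped_solution a b h T \<beta> f q u m \<mu> \<nu>"
proof -
  have m': "q < m" "m < \<nu>" and only: "\<And>t. q < t \<Longrightarrow> t < \<nu> \<Longrightarrow> turning_point u t \<Longrightarrow> t = m"
    using m(1) by auto
  have no_between: False if "q \<le> x" "y \<le> \<nu>" "x < z" "z < y" "u x \<le> u z" "u y \<le> u z" "y \<le> m \<or> m \<le> x" for x y z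
  proof -
    have "\<exists>w. x < w \<and> w < y \<and> turning_point u w"
      by (rule turning_point_between[OF _ du]) (use that h in \<open>auto intro!: cu'\<close>)
    then obtain w where "x < w" "w < y" "turning_point u w" by blast
    then show False using only[of w] that by auto
  qed
  have mq: "u m \<le> u q"
  proof -
    obtain r where "q < r" "r < min \<beta> m" using dense[of q "min \<beta> m"] m' q by auto
    then show ?thesis using below_start[of r] m(2)[of r] m' by simp
  qed
  have um: "u m \<le> u s" if "q \<le> s" "s < \<nu>" for s
    using m(2)[of s] mq that by (cases "s = q") auto
  have dec: "u t < u s" if st: "q \<le> s" "s < t" "t \<le> m" for s t
  proof (rule ccontr)
    assume "\<not> u t < u s"
    then have le: "u s \<le> u t" by simp
    show False
    proof (cases "t = m")
      case True
      have "u m \<le> u ((s + m) / 2)" by (rule um) (use st m' True in auto)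
      then show False using no_between[of s m "(s + m) / 2"] st m' le True by auto
    next
      case False
      then show False using no_between[of s m t] st m' le um[of t] by auto
    qed
  qed
  have inc: "u s < u t" if st: "m \<le> s" "s < t" "t \<le> \<nu>" for s t
  proof (rule ccontr)
    assume "\<not> u s < u t"
    then have le: "u t \<le> u s" by simp
    show False
    proof (cases "s = m")
      case True
      have "u m \<le> u ((m + t) / 2)" by (rule um) (use st m' True in auto)
      then show False using no_between[of m t "(m + t) / 2"] st m' le True by auto
    next
      case False
      then show False using no_between[of m t s] st m' le um[of s] by auto
    qed
  qed
  have anti: "u t \<le> u s" if st: "q - h \<le> s" "s \<le> t" "t \<le> m" for s t
  proof -
    consider "t \<le> q" | "s \<le> q" "q < t" | "q < s" by linarith
    then show ?thesis
    proof cases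
      case 1 then show ?thesis using hist[of s] hist[of t] st by simp
    next
      case 2 then show ?thesis using hist[of s] uq dec[of q t] st by simp
    next
      case 3 then show ?thesis using dec[of s t] st by (cases "s = t") auto
    qed
  qed
  have mono: "u s \<le> u t" if "m \<le> s" "s \<le> t" "t \<le> \<nu>" for s t
    using inc[of s t] that by (cases "s = t") auto
  have Umax: "U t = max (u (t - h)) (u t)" if t: "m \<le> t" "t \<le> \<nu>" for t
  proof -
    have le: "u r \<le> max (u (t - h)) (u t)" if "t - h \<le> r" "r \<le> t" for r
    proof (cases "m \<le> r")
      case True then show ?thesis using mono[of r t] that t by (simp add: le_max_iff_disj)
    next
      case False then show ?thesis using anti[of "t - h" r] that t m' by (simp add: le_max_iff_disj)
    qed
    show ?thesis
    proof (cases "u (t - h) \<le> u t")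
      case True then show ?thesis using le h by (intro U_eqI[of _ _ t]) auto
    next
      case False then show ?thesis using le h by (intro U_eqI[of _ _ "t - h"]) auto
    qed
  qed
  have early0: "u t < u (t - h)" if t: "q < t" "t \<le> m" for t
  proof (cases "q \<le> t - h")
    case True then show ?thesis using dec[of "t - h" t] h t by simp
  next
    case False then show ?thesis using hist[of "t - h"] uq dec[of q t] t h by simp
  qed
  \<comment> \<open>a time before \<nu> at which the scalar equation holds\<close>
  define z where "z = max ((m + \<nu>) / 2) (\<nu> - \<delta> / 2)"
  have z: "m < z" "z < \<nu>" "z \<in> {\<nu> - \<delta><..<\<nu>}" using m' \<delta>(1) by (auto simp: z_def max_def)
  have "a * u z + b * U z + f z = (a + b) * u z + f z"
    by (rule DERIV_unique[OF du \<delta>(2)]) (use z m' in auto)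
  then have "b * U z = b * u z" by (simp add: algebra_simps)
  then have Uz: "U z = u z" using b by simp
  then have gz: "0 \<le> u z - u (z - h)" using Umax[of z] z by (simp add: max_def split: if_splits)
  have "\<exists>\<mu>. m \<le> \<mu> \<and> \<mu> \<le> z \<and> u \<mu> - u (\<mu> - h) = 0"
  proof (rule IVT')
    show "u m - u (m - h) \<le> 0" using early0[of m] m' by simp
    show "continuous_on {m..z} (\<lambda>t. u t - u (t - h))"
      by (intro continuous_intros continuous_on_compose2[OF cu] continuous_on_subset[OF cu]) (use m' h in auto)
  qed (use gz z in auto)
  then obtain \<mu> where \<mu>: "m \<le> \<mu>" "\<mu> \<le> z" "u \<mu> = u (\<mu> - h)" by auto
  have m\<mu>: "m < \<mu>" using \<mu> early0[of m] m' by (cases "m = \<mu>") auto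
  \<comment> \<open>otherwise both ends of the window lie on the increasing branch\<close>
  have \<mu>h: "\<mu> - h \<le> m"
  proof (rule ccontr)
    assume "\<not> \<mu> - h \<le> m"
    then have "u (\<mu> - h) < u \<mu>" using inc[of "\<mu> - h" \<mu>] \<mu> z h by simp
    then show False using \<mu> by simp
  qed
  have gap_strict: "u s - u (s - h) < u t - u (t - h)" if "m \<le> s" "s < t" "t \<le> \<nu>" "t - h \<le> m" for s t
    using inc[of s t] anti[of "s - h" "t - h"] that m' by simp
  have late: "u (t - h) < u t" if t: "\<mu> < t" "t \<le> \<nu>" for t
  proof (cases "t - h \<le> m")
    case True then show ?thesis using gap_strict[of \<mu> t] \<mu> t by simp
  next
    case False then show ?thesis using inc[of "t - h" t] t h by simp
  qed
  have U_late: "U t = u t" if "\<mu> \<le> t" "t \<le> \<nu>" for t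
    using Umax[of t] late[of t] that \<mu> by (cases "t = \<mu>") (auto simp: max_def)
  have early: "u t < u (t - h)" if t: "q < t" "t < \<mu>" for t
  proof (cases "t \<le> m")
    case True then show ?thesis using early0 t by simp
  next
    case False then show ?thesis using gap_strict[of t \<mu>] \<mu> \<mu>h t z by simp
  qed
  have "shaped_solution a b h T \<beta> f q u m \<mu> \<nu>"
  proof unfold_locales
    show "U t = u (t - h)" if t: "q \<le> t" "t \<le> \<mu>" for t
    proof (cases "m \<le> t")
      case True
      have "u t \<le> u (t - h)" using early[of t] t m' True \<mu> by (cases "t = \<mu>") auto
      then show ?thesis using Umax[of t] True t \<mu> z by (simp add: max_def)
    next
      case False
      then show ?thesis using anti[of "t - h"] t h by (intro U_eqI[of _ _ "t - h"]) auto
    qed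
    show "u s - u (s - h) \<le> u t - u (t - h)" if "m \<le> s" "s \<le> t" "t \<le> \<mu>" for s t
      using gap_strict[of s t] that \<mu>h \<mu> z by (cases "s = t") auto
    show "u t \<le> f t / c" if t: "\<mu> \<le> t" "t \<le> \<nu>" for t
    proof (cases "t = \<nu>")
      case True then show ?thesis using admissible_critical[OF \<nu>] by simp
    next
      case False
      have "0 \<le> a * u t + b * U t + f t"
        by (rule derivative_nonneg_if_right_minimum[OF du, of _ "\<nu> - t"])
          (use t False m\<mu> m' mono[of t] in auto)
      then show ?thesis using U_late[OF t] c by (simp add: c_def field_simps)
    qed
  qed (use \<nu> m' m\<mu> \<mu> z q early late U_late inc in auto)
  then show ?thesis by blast
qed

text \<open>For q = \<beta> the solution can be written down: it is the orbit with constant level 0 = -G(\<beta>), which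
starts from zero and increases until E falls back to that level in the phase [T, T + \<beta>].\<close>
lemma shaped_from_minimum:
  assumes q: "q = \<beta>" and \<nu>: "admissible \<nu>" "\<And>x. admissible x \<Longrightarrow> \<nu> \<le> x"
  shows "shaped_solution a b h T \<beta> f q u \<beta> \<beta> \<nu>"
proof -
  have E\<beta>: "E \<beta> = level 0" by (simp add: level_def)
  have ET: "level 0 < E T" using E_inc[of 0 \<beta> T] \<beta>T E\<beta> by simp
  have "E (T + \<beta>) = level 1" by (simp add: level_def)
  then have "\<exists>s. T \<le> s \<and> s \<le> T + \<beta> \<and> E s = level 0"
    using ET level_Suc[of 0] \<beta> T by (intro IVT2') (auto intro: continuous_on_subset[OF E_cont])
  then obtain \<nu>0 where \<nu>0: "T \<le> \<nu>0" "\<nu>0 \<le> T + \<beta>" "E \<nu>0 = level 0" by blast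
  have \<nu>0': "T < \<nu>0" "\<nu>0 < T + \<beta>"
    using \<nu>0 ET \<open>E (T + \<beta>) = level 1\<close> level_Suc[of 0] by (auto simp: less_le)
  have above: "level 0 < E t" if t: "\<beta> < t" "t < \<nu>0" for t
  proof (cases "t \<le> T")
    case True then show ?thesis using E_inc[of 0 \<beta> t] t E\<beta> by simp
  next
    case False then show ?thesis using E_dec[of 1 t \<nu>0] t \<nu>0 by simp
  qed
  define z where "z = (\<lambda>t. if t \<le> \<beta> then 0 else exp (- c * t) * (G t - G \<beta>))"
  have orbit: "exp (c * t) * z t - G t = level 0" if "\<beta> \<le> t" for t
  proof -
    have "exp (c * t) * (exp (- c * t) * (G t - G \<beta>)) = G t - G \<beta>"
      by (simp flip: mult.assoc exp_add)
    then have "exp (c * t) * z t = G t - G \<beta>" using that by (auto simp: z_def)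
    then show ?thesis using level_eq[of 0] by simp
  qed
  have z_le: "z t < f t / c" if "\<beta> < t" "t < \<nu>0" for t
  proof -
    have "exp (c * t) * z t < exp (c * t) * (f t / c)"
      using above[OF that] orbit[of t] that unfolding E_def by simp
    then show ?thesis by (simp only: mult_less_cancel_left_pos exp_gt_zero)
  qed
  have cz: "continuous_on {q - h..\<nu>0} z"
  proof -
    have "continuous_on ({q - h..\<beta>} \<union> {\<beta>..\<nu>0}) z"
      unfolding z_def
      by (rule continuous_on_If) (use \<beta> in \<open>auto intro!: continuous_intros G_cont'\<close>)
    moreover have "{q - h..\<beta>} \<union> {\<beta>..\<nu>0} = {q - h..\<nu>0}" using q h \<nu>0 \<beta>T by auto
    ultimately show ?thesis by simp
  qed
  have dz: "(z has_real_derivative (a + b) * z t + f t) (at t)" if t: "\<beta> < t" for t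
  proof -
    have "((\<lambda>t. exp (- c * t) * (G t - G \<beta>)) has_real_derivative
        exp (- c * t) * (exp (c * t) * f t - c * (G t - G \<beta>))) (at t)"
      by (rule has_derivative_exp_weight[OF G_deriv]) (use t \<beta> in simp)
    also have "exp (- c * t) * (exp (c * t) * f t - c * (G t - G \<beta>)) =
        exp (- c * t) * exp (c * t) * f t - c * (exp (- c * t) * (G t - G \<beta>))"
      by (simp add: algebra_simps)
    also have "exp (- c * t) * exp (c * t) = 1" by (simp flip: exp_add)
    also have "1 * f t - c * (exp (- c * t) * (G t - G \<beta>)) = f t - c * z t" using t by (simp add: z_def)
    also have "\<dots> = (a + b) * z t + f t" by (simp add: c_def algebra_simps)
    finally show ?thesis
      by (rule has_field_derivative_transform_within_open[of _ _ _ "{\<beta><..}"]) (use t in \<open>auto simp: z_def\<close>)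
  qed
  have z_inc: "z s < z t" if st: "\<beta> \<le> s" "s < t" "t \<le> \<nu>0" for s t
  proof (rule DERIV_pos_imp_increasing_open[OF st(2)])
    fix r assume r: "s < r" "r < t"
    have "0 < (a + b) * z r + f r" using z_le[of r] r st c by (simp add: c_def field_simps)
    then show "\<exists>y. (z has_real_derivative y) (at r) \<and> 0 < y" using dz[of r] r st by auto
  qed (use st q h in \<open>auto intro: continuous_on_subset[OF cz]\<close>)
  have z_mono: "z s \<le> z t" if "s \<le> t" "t \<le> \<nu>0" for s t
  proof (cases "s \<le> \<beta>")
    case True
    then show ?thesis using z_inc[of \<beta> t] that by (cases "t \<le> \<beta>") (auto simp: z_def)
  next
    case False then show ?thesis using z_inc[of s t] that by (cases "s = t") auto
  qed
  have Uz: "running_max h z t = z t" if "t \<le> \<nu>0" for t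
    using z_mono that h by (intro running_max_eqI[of _ _ _ _ t]) auto
  have uz: "u t = z t" if "t \<in> {q - h..\<nu>0}" for t
  proof (rule max_equation_unique[where u = u and w = z and h = h and q = q and S = \<nu>0 and a = a and b = b and f = f])
    show "u s = z s" if "s \<in> {q - h..q}" for s using hist[of s] that q f\<beta> by (auto simp: z_def)
    show "(z has_real_derivative a * z t + b * running_max h z t + f t) (at t)" if "q < t" "t < \<nu>0" for t
      using dz[of t] Uz[of t] that q by (simp add: algebra_simps)
  qed (use h that cz du in \<open>auto intro!: cu'\<close>)
  have UU: "U t = u t" if "q \<le> t" "t \<le> \<nu>0" for t
  proof -
    have "U t = running_max h z t" by (rule running_max_cong) (use uz that in auto)
    then show ?thesis using Uz[of t] uz[of t] that h by simp
  qed
  have "exp (c * \<nu>0) * u \<nu>0 = exp (c * \<nu>0) * (f \<nu>0 / c)"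
    using \<nu>0 orbit[of \<nu>0] uz[of \<nu>0] q h \<beta>T unfolding E_def by simp
  then have u\<nu>0: "u \<nu>0 = f \<nu>0 / c" unfolding mult_cancel_left by simp
  have adm0: "admissible \<nu>0"
    by (rule admissibleI[of _ 1]) (use UU[of \<nu>0] u\<nu>0 q \<nu>0 \<nu>0' \<beta>T in auto)
  obtain k where k: "real k * T \<le> \<nu>" "\<nu> < real k * T + \<beta>" using admissible_phase[OF \<nu>(1)] by blast
  have "k \<ge> 1" using admissible_phase_ge1[OF \<nu>(1) k] .
  have "real k * T < 2 * T" using k \<nu>(2)[OF adm0] \<nu>0' \<beta>T by linarith
  then have "k = 1" using \<open>k \<ge> 1\<close> T by simp
  then have \<nu>\<nu>0: "\<nu> = \<nu>0"
    using admissible_phase_unique[OF \<nu>(1) adm0, of 1] k \<nu>0 \<nu>0' by simp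
  show ?thesis
  proof unfold_locales
    show "u (t - h) < u t" if "\<beta> < t" "t < \<nu>" for t
    proof (cases "t - h \<le> \<beta>")
      case True
      then show ?thesis using z_inc[of \<beta> t] uz[of t] uz[of "t - h"] that \<nu>\<nu>0 q h by (auto simp: z_def)
    next
      case False
      then show ?thesis using z_inc[of "t - h" t] uz[of t] uz[of "t - h"] that \<nu>\<nu>0 q h by auto
    qed
    show "U t = u (t - h)" if "q \<le> t" "t \<le> \<beta>" for t
      using that q Uq hist[of "q - h"] h by auto
    show "u t \<le> f t / c" if t: "\<beta> \<le> t" "t \<le> \<nu>" for t
    proof -
      consider "t = \<beta>" | "t = \<nu>0" | "\<beta> < t" "t < \<nu>0" using t \<nu>\<nu>0 by linarith
      then show ?thesis
      proof cases
        case 1 then show ?thesis using uq q by simp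
      next
        case 2 then show ?thesis using u\<nu>0 by simp
      next
        case 3 then show ?thesis using z_le[of t] uz[of t] q h by auto
      qed
    qed
    show "u s < u t" if "\<beta> \<le> s" "s < t" "t \<le> \<nu>" for s t
      using z_inc[of s t] uz[of s] uz[of t] that \<nu>\<nu>0 q h by auto
    show "u s - u (s - h) \<le> u t - u (t - h)" if "\<beta> \<le> s" "s \<le> t" "t \<le> \<beta>" for s t
    proof -
      have "s = t" using that by simp
      then show ?thesis by simp
    qed
  qed (use \<nu> q \<nu>0 \<nu>\<nu>0 \<beta>T UU in auto)
qed

end

context shaped_solution
begin

lemma \<nu>_phase: obtains k where "k \<ge> 1" "real k * T \<le> \<nu>" "\<nu> < real k * T + \<beta>"
  using admissible_phase[OF adm] admissible_phase_ge1[OF adm] by blast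

lemma \<nu>_ge_T: "T \<le> \<nu>"
proof -
  obtain k where k: "k \<ge> 1" "real k * T \<le> \<nu>" using \<nu>_phase by blast
  have "1 * T \<le> real k * T" using k T by (intro mult_right_mono) auto
  then show ?thesis using k by simp
qed

lemma \<mu>_ge_\<beta>: "\<beta> \<le> \<mu>"
proof (rule ccontr)
  assume "\<not> \<beta> \<le> \<mu>"
  then have lt: "\<mu> < \<beta>" by simp
  have t: "\<mu> < \<beta>" "\<beta> < \<nu>" using lt \<nu>_ge_T \<beta>T by auto
  have "u (\<beta> - h) < u \<beta>" using late[OF t] .
  moreover have "u (\<beta> - h) = u q" using hist[of "\<beta> - h"] uq q\<beta> q0 \<beta>h by simp
  moreover have "u \<beta> < u q" using below_start[of \<beta>] lt qm m\<mu> by simp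
  ultimately show False by simp
qed

lemma orbit_const_late:
  assumes "\<mu> \<le> t" "t \<le> \<nu>" shows "orbit_const t = orbit_const \<mu>"
proof (cases "t = \<mu>")
  case False
  show ?thesis
  proof (rule DERIV_isconst_end[of \<mu> t orbit_const])
    show "\<mu> < t" using False assms by simp
    show "continuous_on {\<mu>..t} orbit_const" using qm m\<mu> by (intro orbit_const_cont) simp
    show "(orbit_const has_real_derivative 0) (at x)" if "\<mu> < x" "x < t" for x
      using orbit_const_deriv[of x] U_late[of x] that assms qm m\<mu> by simp
  qed
qed simp

lemma E_late: "\<mu> \<le> t \<Longrightarrow> t \<le> \<nu> \<Longrightarrow> orbit_const \<mu> \<le> E t"
  using orbit_const_le_E[of t] late_below[of t] orbit_const_late[of t] by simp

lemma u\<nu>: "u \<nu> = f \<nu> / c" by (rule admissible_critical[OF adm])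

lemma E_\<nu>: "E \<nu> = orbit_const \<mu>"
  using orbit_const_late[of \<nu>] \<mu>\<nu> u\<nu> by (simp add: orbit_const_def E_def)

text \<open>Two different candidates would make U equal both to u(t) and to u(t - h) or to the initial value on
some interval, but u - u(\<cdot> - h) has a strict sign on either side of \<mu> and u increases strictly after
\<mu>.\<close>
lemma switching_unique:
  assumes u: "u = sol a b h f q" and \<nu>: "\<nu> = nu_star a b h f q"
  shows "mu a b h f q = \<mu>"
  unfolding mu_def
proof (rule the_equality)
  have ft: "ftilde a b f q = f q / c" using ab by (simp add: ftilde_def c_def abs_if)
  have sw: "switching a b h f q l m' \<longleftrightarrow> q \<le> l \<and> l \<le> m' \<and> m' < \<nu> \<and> (l = q + h \<or> l = m') \<and>
        (\<forall>t\<in>{q<..l}. U t = f q / c) \<and> (\<forall>t\<in>{l<..m'}. U t = u (t - h)) \<and> (\<forall>t\<in>{m'<..<\<nu>}. U t = u t)" for l m'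
    unfolding switching_def Let_def u[symmetric] \<nu>[symmetric] ft by simp
  have "switching a b h f q (min (q + h) \<mu>) \<mu>"
    unfolding sw
  proof (intro conjI ballI)
    fix t assume t: "t \<in> {q<..min (q + h) \<mu>}"
    then show "U t = f q / c" using U_early[of t] hist[of "t - h"] by simp
  qed (use qm m\<mu> \<mu>\<nu> h U_early U_late in auto)
  then show "\<exists>l. switching a b h f q l \<mu>" ..
  fix m' assume "\<exists>l. switching a b h f q l m'"
  then obtain l where l: "q \<le> l" "l \<le> m'" "m' < \<nu>" "\<forall>t\<in>{q<..l}. U t = f q / c"
    "\<forall>t\<in>{l<..m'}. U t = u (t - h)" "\<forall>t\<in>{m'<..<\<nu>}. U t = u t" unfolding sw by blast
  show "m' = \<mu>"
  proof (rule ccontr)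
    assume "m' \<noteq> \<mu>"
    then consider "m' < \<mu>" | "\<mu> < m'" by linarith
    then show False
    proof cases
      case 1
      define t where "t = (m' + \<mu>) / 2"
      have t: "m' < t" "t < \<mu>" using 1 by (auto simp: t_def)
      have "U t = u t" using l(6) t \<mu>\<nu> by simp
      then show False using U_early[of t] early[of t] t l by simp
    next
      case 2
      have p: "u t = f q / c" if t: "\<mu> < t" "t \<le> m'" for t
      proof -
        have "U t = u t" using U_late[of t] t l by simp
        moreover have "t \<le> l" using l(5) late[of t] t l(3) \<open>U t = u t\<close> by force
        ultimately show ?thesis using l(4) t qm m\<mu> by auto
      qed
      have "u ((\<mu> + m') / 2) < u m'" using 2 l(3) by (intro late_mono) auto
      then show False using p[of m'] p[of "(\<mu> + m') / 2"] 2 by simp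
    qed
  qed
qed

end

section \<open>Dependence on the initial point\<close>

lemma abs_diff_le_derivative_bound:
  fixes \<phi> :: "real \<Rightarrow> real"
  assumes "x \<le> y" "continuous_on {x..y} \<phi>"
    and der: "\<And>t. x < t \<Longrightarrow> t < y \<Longrightarrow> (\<phi> has_real_derivative \<phi>' t) (at t)"
    and bd: "\<And>t. x < t \<Longrightarrow> t < y \<Longrightarrow> \<bar>\<phi>' t\<bar> \<le> B"
  shows "\<bar>\<phi> y - \<phi> x\<bar> \<le> B * (y - x)"
proof -
  have "\<phi> x + B * x \<le> \<phi> y + B * y"
  proof (rule DERIV_nonneg_imp_increasing_open[of x y "\<lambda>t. \<phi> t + B * t"])
    fix t assume t: "x < t" "t < y"
    have "((\<lambda>t. \<phi> t + B * t) has_real_derivative \<phi>' t + B) (at t)"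
      using der[OF t] by (auto intro!: derivative_eq_intros)
    then show "\<exists>d. ((\<lambda>t. \<phi> t + B * t) has_real_derivative d) (at t) \<and> 0 \<le> d"
      using bd[OF t] by (intro exI[of _ "\<phi>' t + B"]) auto
  qed (use assms in \<open>auto intro!: continuous_intros\<close>)
  moreover have "\<phi> y - B * y \<le> \<phi> x - B * x"
  proof (rule DERIV_nonpos_imp_decreasing_open[of x y "\<lambda>t. \<phi> t - B * t"])
    fix t assume t: "x < t" "t < y"
    have "((\<lambda>t. \<phi> t - B * t) has_real_derivative \<phi>' t - B) (at t)"
      using der[OF t] by (auto intro!: derivative_eq_intros)
    then show "\<exists>d. ((\<lambda>t. \<phi> t - B * t) has_real_derivative d) (at t) \<and> d \<le> 0"
      using bd[OF t] by (intro exI[of _ "\<phi>' t - B"]) auto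
  qed (use assms in \<open>auto intro!: continuous_intros\<close>)
  ultimately show ?thesis by (simp add: algebra_simps abs_le_iff)
qed

context max_solution
begin

text \<open>On [q, s] the forcing differs from f(q) by at most f(q) - f(s), so u leaves its initial value by a
quantity of second order in s - q.  This makes the shift of the initial time invisible in the
derivative with respect to the initial value.\<close>
lemma start_deviation:
  assumes s: "q \<le> t" "t \<le> s" "s \<le> \<beta>"
  shows "\<bar>u t - f q / c\<bar> \<le> exp (a * \<beta>) * (f q - f s) * (s - q)"
proof (cases "q < t")
  case True
  have f_le: "f s \<le> f r" if "r \<le> s" "0 \<le> r" for r
    using f_dec[of 0 r s] that s by (cases "r = s") auto
  have z: "(a + b) * (f q / c) + f q = 0" using equilibrium_iff by blast
  have "exp (- a * q) * (u q - f q / c) + (f q - f s) * q \<le> exp (- a * t) * (u t - f q / c) + (f q - f s) * t"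
  proof (rule DERIV_nonneg_imp_increasing_open[OF s(1)])
    fix r assume r: "q < r" "r < t"
    have "U r = f q / c"
    proof (rule U_eqI[of _ _ q])
      fix x assume x: "r - h \<le> x" "x \<le> r"
      show "u x \<le> f q / c"
      proof (cases "x \<le> q")
        case True then show ?thesis using hist[of x] x r by simp
      next
        case False then show ?thesis using below_start[of x] uq x r s by simp
      qed
    qed (use r s q0 \<beta>h uq in auto)
    then have d: "((\<lambda>r. exp (- a * r) * (u r - f q / c)) has_real_derivative exp (- a * r) * (f r - f q)) (at r)"
      using weighted_deriv[OF r(1) z] by simp
    have fr: "f s \<le> f r" "f r \<le> f q" using f_le r s q0 f_dec[of 0 q r] by auto
    have "exp (- a * r) \<le> 1" using a r q0 by simp
    then have "exp (- a * r) * (f q - f r) \<le> 1 * (f q - f s)" using fr by (intro mult_mono) auto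
    moreover have "exp (- a * r) * (f r - f q) = - (exp (- a * r) * (f q - f r))" by (simp add: algebra_simps)
    ultimately have "0 \<le> exp (- a * r) * (f r - f q) + (f q - f s)" by simp
    then show "\<exists>y. ((\<lambda>r. exp (- a * r) * (u r - f q / c) + (f q - f s) * r) has_real_derivative y) (at r) \<and> 0 \<le> y"
      using DERIV_add[OF d DERIV_cmult[OF DERIV_ident]]
      by (intro exI[of _ "exp (- a * r) * (f r - f q) + (f q - f s)"] conjI) auto
  qed (use s h in \<open>auto intro!: continuous_intros cu'\<close>)
  then have 1: "exp (- a * t) * (f q / c - u t) \<le> (f q - f s) * (t - q)"
    using uq by (simp add: algebra_simps)
  have fqs: "0 \<le> f q - f s" using f_le[of q] s q0 by simp
  have "f q / c - u t = exp (a * t) * (exp (- a * t) * (f q / c - u t))" by (simp flip: mult.assoc exp_add)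
  also have "\<dots> \<le> exp (a * t) * ((f q - f s) * (t - q))" using 1 by (rule mult_left_mono) simp
  also have "\<dots> \<le> exp (a * \<beta>) * ((f q - f s) * (s - q))"
    using fqs s a by (intro mult_mono mult_left_mono) auto
  finally have "f q / c - u t \<le> exp (a * \<beta>) * (f q - f s) * (s - q)" by (simp add: mult.assoc)
  moreover have "u t < f q / c" using below_start[of t] True s uq by simp
  ultimately show ?thesis by simp
next
  case False
  then have "u t = f q / c" using s uq by simp
  moreover have "f s \<le> f q" using f_dec[of 0 q s] s q0 by (cases "q = s") auto
  ultimately show ?thesis using s by simp
qed

end

context shaped_solution
begin

lemma gap_zero: "u \<mu> = u (\<mu> - h)"
  using U_early[of \<mu>] U_late[of \<mu>] qm m\<mu> \<mu>\<nu> by simp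

end

text \<open>The function Y solves the equation linearized before the switching time, for the perturbation of
the initial value by 1.\<close>
locale shaped_family = unimodal_forcing +
  fixes \<alpha> :: real and u :: "real \<Rightarrow> real \<Rightarrow> real" and m \<mu> \<nu> :: "real \<Rightarrow> real" and Y :: "real \<Rightarrow> real"
  assumes \<alpha>: "0 < \<alpha>" "\<alpha> < \<beta>"
    and shaped: "\<And>q. \<alpha> < q \<Longrightarrow> q \<le> \<beta> \<Longrightarrow> shaped_solution a b h T \<beta> f q (u q) (m q) (\<mu> q) (\<nu> q)"
    and cY: "continuous_on UNIV Y" and Y1: "\<And>s. s \<le> 0 \<Longrightarrow> Y s = 1"
    and dY: "\<And>s. 0 < s \<Longrightarrow> (Y has_real_derivative a * Y s + b * Y (s - h)) (at s)"
begin

definition lip :: "real \<Rightarrow> real" where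
  "lip S = (1 + exp (a * \<beta>) * c * \<beta>) * exp ((\<bar>a\<bar> + \<bar>b\<bar>) * S)"

abbreviation "\<Lambda> \<equiv> \<bar>a\<bar> + \<bar>b\<bar>"

lemma f_anti: "\<alpha> < q1 \<Longrightarrow> q1 < q2 \<Longrightarrow> q2 \<le> \<beta> \<Longrightarrow> f q2 < f q1"
  using f_dec[of 0 q1 q2] \<alpha> by simp

lemma initial_difference:
  assumes q: "\<alpha> < q1" "q1 < q2" "q2 \<le> \<beta>" and t: "t \<in> {q2 - h..q2}"
  shows "\<bar>(u q1 t - u q2 t) - (f q1 - f q2) / c\<bar> \<le> exp (a * \<beta>) * c * (q2 - q1) * ((f q1 - f q2) / c)"
proof -
  interpret S1: shaped_solution a b h T \<beta> f q1 "u q1" "m q1" "\<mu> q1" "\<nu> q1" by (rule shaped) (use q in auto)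
  interpret S2: shaped_solution a b h T \<beta> f q2 "u q2" "m q2" "\<mu> q2" "\<nu> q2" by (rule shaped) (use q in auto)
  have 2: "u q2 t = f q2 / c" using S2.hist t by simp
  have "\<bar>u q1 t - f q1 / c\<bar> \<le> exp (a * \<beta>) * (f q1 - f q2) * (q2 - q1)"
  proof (cases "t \<le> q1")
    case True
    then have "u q1 t = f q1 / c" using S1.hist[of t] t q by simp
    then show ?thesis using f_anti[OF q] q by simp
  next
    case False then show ?thesis using S1.start_deviation[of t q2] t q by simp
  qed
  moreover have "exp (a * \<beta>) * (f q1 - f q2) * (q2 - q1) = exp (a * \<beta>) * c * (q2 - q1) * ((f q1 - f q2) / c)"
    using c by simp
  ultimately show ?thesis using 2 by (simp add: diff_divide_distrib)
qed

lemma difference_deriv: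
  assumes q: "\<alpha> < q1" "q1 < q2" "q2 \<le> \<beta>" and t: "q2 < t"
  shows "((\<lambda>t. u q1 t - u q2 t) has_real_derivative
      a * (u q1 t - u q2 t) + b * (running_max h (u q1) t - running_max h (u q2) t)) (at t)"
proof -
  interpret S1: shaped_solution a b h T \<beta> f q1 "u q1" "m q1" "\<mu> q1" "\<nu> q1" by (rule shaped) (use q in auto)
  interpret S2: shaped_solution a b h T \<beta> f q2 "u q2" "m q2" "\<mu> q2" "\<nu> q2" by (rule shaped) (use q in auto)
  show ?thesis using DERIV_diff[OF S1.du[of t] S2.du[of t]] q t by (simp add: algebra_simps)
qed

lemma difference_rhs_bound:
  assumes q: "\<alpha> < q1" "q1 < q2" "q2 \<le> \<beta>" and t: "q2 \<le> t"
    and N: "\<And>r. r \<in> {t - h..t} \<Longrightarrow> \<bar>u q1 r - u q2 r\<bar> \<le> N"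
  shows "\<bar>running_max h (u q1) t - running_max h (u q2) t\<bar> \<le> N"
    and "\<bar>a * (u q1 t - u q2 t) + b * (running_max h (u q1) t - running_max h (u q2) t)\<bar> \<le> \<Lambda> * N"
proof -
  interpret S1: shaped_solution a b h T \<beta> f q1 "u q1" "m q1" "\<mu> q1" "\<nu> q1" by (rule shaped) (use q in auto)
  interpret S2: shaped_solution a b h T \<beta> f q2 "u q2" "m q2" "\<mu> q2" "\<nu> q2" by (rule shaped) (use q in auto)
  show 2: "\<bar>running_max h (u q1) t - running_max h (u q2) t\<bar> \<le> N"
    by (rule running_max_lipschitz[OF _ _ _ N])
      (use t q h in \<open>auto intro!: S1.cu' S2.cu'\<close>)
  have 1: "\<bar>u q1 t - u q2 t\<bar> \<le> N" using N[of t] h by simp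
  have "\<bar>a * (u q1 t - u q2 t) + b * (running_max h (u q1) t - running_max h (u q2) t)\<bar>
      \<le> \<bar>a\<bar> * \<bar>u q1 t - u q2 t\<bar> + \<bar>b\<bar> * \<bar>running_max h (u q1) t - running_max h (u q2) t\<bar>"
    by (metis abs_mult abs_triangle_ineq)
  also have "\<dots> \<le> \<bar>a\<bar> * N + \<bar>b\<bar> * N" using 1 2 by (intro add_mono mult_left_mono) auto
  finally show "\<bar>a * (u q1 t - u q2 t) + b * (running_max h (u q1) t - running_max h (u q2) t)\<bar> \<le> \<Lambda> * N"
    by (simp add: distrib_right)
qed

lemma difference_cont:
  assumes q: "\<alpha> < q1" "q1 < q2" "q2 \<le> \<beta>" and x: "q2 - h \<le> x"
  shows "continuous_on {x..y} (\<lambda>t. u q1 t - u q2 t)"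
proof -
  interpret S1: shaped_solution a b h T \<beta> f q1 "u q1" "m q1" "\<mu> q1" "\<nu> q1" by (rule shaped) (use q in auto)
  interpret S2: shaped_solution a b h T \<beta> f q2 "u q2" "m q2" "\<mu> q2" "\<nu> q2" by (rule shaped) (use q in auto)
  show ?thesis using x q by (intro continuous_intros S1.cu' S2.cu') auto
qed

lemma difference_lipschitz_ordered:
  assumes q: "\<alpha> < q1" "q1 < q2" "q2 \<le> \<beta>" and t: "q2 - h \<le> t" "t \<le> S" and S: "0 \<le> S"
  shows "\<bar>u q1 t - u q2 t\<bar> \<le> lip S * ((f q1 - f q2) / c)"
proof -
  define P where "P = (f q1 - f q2) / c"
  define M where "M = (1 + exp (a * \<beta>) * c * \<beta>) * P"
  have P: "P > 0" using f_anti[OF q] c by (simp add: P_def)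
  have M: "M \<ge> 0" using P c \<beta> by (simp add: M_def)
  have init: "\<bar>u q1 t - u q2 t\<bar> \<le> M" if "t \<in> {q2 - h..q2}" for t
  proof -
    have "\<bar>u q1 t - u q2 t\<bar> \<le> P + exp (a * \<beta>) * c * (q2 - q1) * P"
      using initial_difference[OF q that] P unfolding P_def[symmetric] by (simp add: abs_le_iff)
    also have "\<dots> \<le> P + exp (a * \<beta>) * c * \<beta> * P"
      using q \<alpha> c P by (intro add_left_mono mult_right_mono mult_left_mono) auto
    finally show ?thesis by (simp add: M_def algebra_simps)
  qed
  have "\<bar>u q1 t - u q2 t\<bar> \<le> M * exp (\<Lambda> * S)"
  proof (cases "t \<le> q2")
    case True
    have "M * 1 \<le> M * exp (\<Lambda> * S)" using M S by (intro mult_left_mono) auto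
    then show ?thesis using init[of t] True t by simp
  next
    case False
    have "\<bar>u q1 t - u q2 t\<bar> \<le> M * exp (\<Lambda> * (t - q2))"
    proof (rule delay_gronwall[where h = h and S = t and D = "\<lambda>t. u q1 t - u q2 t" and
        D' = "\<lambda>t. a * (u q1 t - u q2 t) + b * (running_max h (u q1) t - running_max h (u q2) t)"])
      show "continuous_on {q2 - h..t} (\<lambda>t. u q1 t - u q2 t)" by (rule difference_cont[OF q]) simp
      show "((\<lambda>t. u q1 t - u q2 t) has_real_derivative
        a * (u q1 r - u q2 r) + b * (running_max h (u q1) r - running_max h (u q2) r)) (at r)" if "q2 < r" for r
        by (rule difference_deriv[OF q that])
      show "\<bar>a * (u q1 r - u q2 r) + b * (running_max h (u q1) r - running_max h (u q2) r)\<bar> \<le> \<Lambda> * N"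
        if "q2 < r" "\<And>s. s \<in> {r - h..r} \<Longrightarrow> \<bar>u q1 s - u q2 s\<bar> \<le> N" for r N
        by (rule difference_rhs_bound(2)[OF q _ that(2)]) (use that in auto)
    qed (use M h init False in auto)
    also have "\<dots> \<le> M * exp (\<Lambda> * S)"
      using M t q \<alpha> by (intro mult_left_mono) (auto intro!: mult_left_mono)
    finally show ?thesis .
  qed
  also have "M * exp (\<Lambda> * S) = lip S * P" by (simp add: M_def lip_def)
  finally show ?thesis by (simp add: P_def)
qed

lemma lip_pos: "lip S > 0"
proof -
  have "exp (a * \<beta>) * c * \<beta> > 0" by (intro mult_pos_pos c \<beta>) simp
  then have "1 + exp (a * \<beta>) * c * \<beta> > 0" by linarith
  then show ?thesis unfolding lip_def by (rule mult_pos_pos) simp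
qed

lemma difference_lipschitz:
  assumes q: "\<alpha> < q" "q \<le> \<beta>" "\<alpha> < q'" "q' \<le> \<beta>" and t: "\<beta> - h \<le> t" "t \<le> S" and S: "0 \<le> S"
  shows "\<bar>u q t - u q' t\<bar> \<le> lip S * (\<bar>f q - f q'\<bar> / c)"
proof -
  consider "q = q'" | "q < q'" | "q' < q" by linarith
  then show ?thesis
  proof cases
    case 2 then show ?thesis
      using difference_lipschitz_ordered[of q q' t S] f_anti[of q q'] assms by simp
  next
    case 3 then show ?thesis
      using difference_lipschitz_ordered[of q' q t S] f_anti[of q' q] assms by (simp add: abs_minus_commute)
  qed simp
qed

lemma Y_near_one: obtains B where "B \<ge> 0" "\<And>s. s \<le> \<beta> \<Longrightarrow> \<bar>Y s - 1\<bar> \<le> B * \<bar>s\<bar>"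
proof -
  have "bounded ((\<lambda>s. a * Y s + b * Y (s - h)) ` {0..\<beta>})"
    by (intro compact_imp_bounded compact_continuous_image compact_Icc continuous_intros
        continuous_on_compose2[OF cY]) auto
  then obtain B where "\<forall>y\<in>(\<lambda>s. a * Y s + b * Y (s - h)) ` {0..\<beta>}. \<bar>y\<bar> \<le> B" unfolding bounded_real by (rule exE)
  then have B: "\<bar>a * Y s + b * Y (s - h)\<bar> \<le> B" if "s \<in> {0..\<beta>}" for s using that by blast
  have B0: "B \<ge> 0" using B[of 0] \<beta> by simp
  have "\<bar>Y s - 1\<bar> \<le> B * \<bar>s\<bar>" if s: "s \<le> \<beta>" for s
  proof (cases "0 \<le> s")
    case True
    have "\<bar>Y s - Y 0\<bar> \<le> B * (s - 0)"
      by (rule abs_diff_le_derivative_bound[OF True, of Y "\<lambda>s. a * Y s + b * Y (s - h)"])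
        (use s B dY in \<open>auto intro: continuous_on_subset[OF cY]\<close>)
    then show ?thesis using Y1[of 0] True by simp
  next
    case False then show ?thesis using Y1[of s] B0 by (simp add: mult_nonneg_nonpos)
  qed
  then show thesis using B0 that by blast
qed

text \<open>Before both switching times the running maxima are the delayed values, so the difference of two
solutions solves the linear delay equation exactly; only its history deviates from a constant.\<close>
lemma linearization_ordered:
  assumes q: "\<alpha> < q1" "q1 < q2" "q2 \<le> \<beta>" and q0: "q0 = q1 \<or> q0 = q2"
    and B: "B \<ge> 0" "\<And>s. s \<le> \<beta> \<Longrightarrow> \<bar>Y s - 1\<bar> \<le> B * \<bar>s\<bar>"
    and t: "q2 \<le> t" "t \<le> \<mu> q1" "t \<le> \<mu> q2" "t \<le> S"
  shows "\<bar>(u q1 t - u q2 t) - (f q1 - f q2) / c * Y (t - q0)\<bar>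
     \<le> (exp (a * \<beta>) * c + B) * exp (\<Lambda> * S) * (q2 - q1) * ((f q1 - f q2) / c)"
proof -
  interpret S1: shaped_solution a b h T \<beta> f q1 "u q1" "m q1" "\<mu> q1" "\<nu> q1" by (rule shaped) (use q in auto)
  interpret S2: shaped_solution a b h T \<beta> f q2 "u q2" "m q2" "\<mu> q2" "\<nu> q2" by (rule shaped) (use q in auto)
  define P where "P = (f q1 - f q2) / c"
  define M where "M = (exp (a * \<beta>) * c + B) * (q2 - q1) * P"
  define D where "D = (\<lambda>t. (u q1 t - u q2 t) - P * Y (t - q0))"
  have P: "P > 0" using f_anti[OF q] c by (simp add: P_def)
  have M: "M \<ge> 0" using P c B q by (simp add: M_def)
  have "\<bar>D t\<bar> \<le> M * exp (\<Lambda> * (t - q2))"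
  proof (rule delay_gronwall[where h = h and S = t and D' = "\<lambda>t. a * D t + b * D (t - h)"])
    show "continuous_on {q2 - h..t} D"
      unfolding D_def by (intro continuous_intros difference_cont[OF q] continuous_on_compose2[OF cY]) auto
    show "\<bar>D r\<bar> \<le> M" if r: "r \<in> {q2 - h..q2}" for r
    proof -
      have 1: "\<bar>(u q1 r - u q2 r) - P\<bar> \<le> exp (a * \<beta>) * c * (q2 - q1) * P"
        using initial_difference[OF q r] unfolding P_def .
      have "\<bar>Y (r - q0) - 1\<bar> \<le> B * (q2 - q1)"
      proof (cases "r \<le> q0")
        case True then show ?thesis using Y1[of "r - q0"] B q by simp
      next
        case False
        have "\<bar>Y (r - q0) - 1\<bar> \<le> B * \<bar>r - q0\<bar>" by (rule B(2)) (use r q q0 \<alpha> in auto)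
        also have "\<dots> \<le> B * (q2 - q1)" using B(1) False r q q0 by (intro mult_left_mono) auto
        finally show ?thesis .
      qed
      then have "P * \<bar>Y (r - q0) - 1\<bar> \<le> P * (B * (q2 - q1))" using P by (intro mult_left_mono) auto
      then have 2: "\<bar>P * (Y (r - q0) - 1)\<bar> \<le> B * (q2 - q1) * P" using P by (simp add: abs_mult ac_simps)
      have "D r = ((u q1 r - u q2 r) - P) - P * (Y (r - q0) - 1)" by (simp add: D_def algebra_simps)
      then have "\<bar>D r\<bar> \<le> exp (a * \<beta>) * c * (q2 - q1) * P + B * (q2 - q1) * P" using 1 2 by linarith
      then show ?thesis by (simp add: M_def algebra_simps)
    qed
    fix r assume r: "q2 < r" "r < t"
    have "running_max h (u q1) r = u q1 (r - h)" "running_max h (u q2) r = u q2 (r - h)"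
      using S1.U_early[of r] S2.U_early[of r] r t q by auto
    then have "((\<lambda>t. u q1 t - u q2 t) has_real_derivative
        a * (u q1 r - u q2 r) + b * (u q1 (r - h) - u q2 (r - h))) (at r)"
      using difference_deriv[OF q r(1)] by simp
    moreover have "((\<lambda>t. Y (t - q0)) has_real_derivative (a * Y (r - q0) + b * Y (r - q0 - h)) * 1) (at r)"
      by (rule DERIV_chain2[OF dY]) (use r q q0 in \<open>auto intro!: derivative_eq_intros\<close>)
    ultimately have "(D has_real_derivative (a * (u q1 r - u q2 r) + b * (u q1 (r - h) - u q2 (r - h)))
        - P * ((a * Y (r - q0) + b * Y (r - q0 - h)) * 1)) (at r)"
      unfolding D_def by (intro DERIV_diff DERIV_cmult)
    moreover have "(a * (u q1 r - u q2 r) + b * (u q1 (r - h) - u q2 (r - h)))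
        - P * ((a * Y (r - q0) + b * Y (r - q0 - h)) * 1) = a * D r + b * D (r - h)"
    proof -
      have "r - q0 - h = r - h - q0" by simp
      then show ?thesis unfolding D_def by (simp only:) (simp add: algebra_simps)
    qed
    ultimately show "(D has_real_derivative a * D r + b * D (r - h)) (at r)" by simp
    fix N assume N: "\<And>s. s \<in> {r - h..r} \<Longrightarrow> \<bar>D s\<bar> \<le> N"
    have "\<bar>a * D r + b * D (r - h)\<bar> \<le> \<bar>a\<bar> * \<bar>D r\<bar> + \<bar>b\<bar> * \<bar>D (r - h)\<bar>"
      by (metis abs_mult abs_triangle_ineq)
    also have "\<dots> \<le> \<bar>a\<bar> * N + \<bar>b\<bar> * N"
      using N[of r] N[of "r - h"] h by (intro add_mono mult_left_mono) auto
    finally show "\<bar>a * D r + b * D (r - h)\<bar> \<le> \<Lambda> * N" by (simp add: distrib_right)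
  qed (use h M t in auto)
  also have "\<dots> \<le> M * exp (\<Lambda> * S)"
    using M t q \<alpha> by (intro mult_left_mono) (auto intro!: mult_left_mono)
  finally show ?thesis by (simp add: D_def P_def M_def ac_simps)
qed

lemma \<mu>_ge: "\<alpha> < q \<Longrightarrow> q \<le> \<beta> \<Longrightarrow> \<beta> \<le> \<mu> q"
  by (rule shaped_solution.\<mu>_ge_\<beta>[OF shaped])

text \<open>Between the two switching times only the crude Lipschitz bound is available, which suffices because
these times approach each other.\<close>
lemma late_difference_ordered:
  assumes q: "\<alpha> < q1" "q1 < q2" "q2 \<le> \<beta>" and t: "\<beta> \<le> s" "s \<le> t" "t \<le> S"
  shows "\<bar>(u q1 t - u q2 t) - (u q1 s - u q2 s)\<bar> \<le> \<Lambda> * lip S * ((f q1 - f q2) / c) * (t - s)"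
proof (rule abs_diff_le_derivative_bound[OF t(2)])
  show "continuous_on {s..t} (\<lambda>t. u q1 t - u q2 t)" using t q h by (intro difference_cont[OF q]) auto
  fix r assume r: "s < r" "r < t"
  show "((\<lambda>t. u q1 t - u q2 t) has_real_derivative
      a * (u q1 r - u q2 r) + b * (running_max h (u q1) r - running_max h (u q2) r)) (at r)"
    using r t q by (intro difference_deriv[OF q]) auto
  have "\<bar>a * (u q1 r - u q2 r) + b * (running_max h (u q1) r - running_max h (u q2) r)\<bar>
      \<le> \<Lambda> * (lip S * ((f q1 - f q2) / c))"
  proof (rule difference_rhs_bound(2)[OF q])
    fix x assume "x \<in> {r - h..r}"
    then show "\<bar>u q1 x - u q2 x\<bar> \<le> lip S * ((f q1 - f q2) / c)"
      using r t q \<beta> by (intro difference_lipschitz_ordered[OF q]) auto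
  qed (use r t q in auto)
  then show "\<bar>a * (u q1 r - u q2 r) + b * (running_max h (u q1) r - running_max h (u q2) r)\<bar>
      \<le> \<Lambda> * lip S * ((f q1 - f q2) / c)" by (simp add: mult.assoc)
qed

text \<open>Evaluated at \<mu>(q), the difference quotient in p is compared with Y in three steps: back to the
earlier switching time, replacement by Y there, and forward to \<mu>(q0) along Y.\<close>
lemma slope_estimate:
  assumes q: "\<alpha> < q" "q \<le> \<beta>" "q \<noteq> q0" and q0: "\<alpha> < q0" "q0 \<le> \<beta>"
    and B: "B \<ge> 0" "\<And>s. s \<le> \<beta> \<Longrightarrow> \<bar>Y s - 1\<bar> \<le> B * \<bar>s\<bar>"
    and S: "\<mu> q \<le> S" "\<mu> q0 \<le> S"
  shows "\<bar>(u q (\<mu> q) - u q0 (\<mu> q)) / ((f q - f q0) / c) - Y (\<mu> q0 - q0)\<bar>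
    \<le> (\<Lambda> * lip S) * \<bar>\<mu> q - \<mu> q0\<bar> + ((exp (a * \<beta>) * c + B) * exp (\<Lambda> * S)) * \<bar>q - q0\<bar>
      + \<bar>Y (min (\<mu> q) (\<mu> q0) - q0) - Y (\<mu> q0 - q0)\<bar>"
proof -
  \<comment> \<open>t is the earlier switching time; q1 and q2 order the two initial points\<close>
  define t where "t = min (\<mu> q) (\<mu> q0)"
  define q1 where "q1 = min q q0"
  define q2 where "q2 = max q q0"
  define D where "D = (\<lambda>t. u q1 t - u q2 t)"
  define P where "P = (f q1 - f q2) / c"
  define E1 where "E1 = (exp (a * \<beta>) * c + B) * exp (\<Lambda> * S)"
  have q12: "\<alpha> < q1" "q1 < q2" "q2 \<le> \<beta>" using q q0 by (auto simp: q1_def q2_def)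
  have P: "P > 0" using f_anti[OF q12] c by (simp add: P_def)
  have \<beta>t: "\<beta> \<le> t" using \<mu>_ge q q0 by (simp add: t_def)
  have "(q1 = q \<and> q2 = q0) \<or> (q1 = q0 \<and> q2 = q)" by (auto simp: q1_def q2_def)
  then have ratio: "(u q (\<mu> q) - u q0 (\<mu> q)) / ((f q - f q0) / c) = D (\<mu> q) / P"
    and q00: "q0 = q1 \<or> q0 = q2" and dist: "q2 - q1 = \<bar>q - q0\<bar>"
    and t\<mu>: "t \<le> \<mu> q1" "t \<le> \<mu> q2"
  proof -
    assume *: "(q1 = q \<and> q2 = q0) \<or> (q1 = q0 \<and> q2 = q)"
    then show "q0 = q1 \<or> q0 = q2" "t \<le> \<mu> q1" "t \<le> \<mu> q2" by (auto simp: t_def)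
    show "q2 - q1 = \<bar>q - q0\<bar>" by (auto simp: q1_def q2_def)
    show "(u q (\<mu> q) - u q0 (\<mu> q)) / ((f q - f q0) / c) = D (\<mu> q) / P"
      using *
    proof
      assume "q1 = q0 \<and> q2 = q"
      then have "D (\<mu> q) = - (u q (\<mu> q) - u q0 (\<mu> q))" "P = - ((f q - f q0) / c)"
        by (simp_all add: D_def P_def minus_divide_left)
      then show ?thesis by (simp only: minus_divide_divide)
    qed (simp add: D_def P_def)
  qed
  have 1: "\<bar>D (\<mu> q) - D t\<bar> \<le> \<Lambda> * lip S * P * (\<mu> q - t)"
    using late_difference_ordered[OF q12 \<beta>t, of "\<mu> q" S] S by (simp add: D_def P_def t_def)
  have "\<mu> q - t \<le> \<bar>\<mu> q - \<mu> q0\<bar>" by (simp add: t_def)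
  then have "\<Lambda> * lip S * P * (\<mu> q - t) \<le> \<Lambda> * lip S * P * \<bar>\<mu> q - \<mu> q0\<bar>"
    using lip_pos[of S] P by (intro mult_left_mono) auto
  then have 1: "\<bar>D (\<mu> q) - D t\<bar> \<le> (\<Lambda> * lip S * \<bar>\<mu> q - \<mu> q0\<bar>) * P" using 1 by (simp add: ac_simps)
  have 2: "\<bar>D t - P * Y (t - q0)\<bar> \<le> (E1 * \<bar>q - q0\<bar>) * P"
    using linearization_ordered[OF q12 q00 B, of t S] t\<mu> \<beta>t q12 S
    by (simp add: D_def P_def E1_def dist t_def ac_simps)
  have 3: "\<bar>P * Y (t - q0) - P * Y (\<mu> q0 - q0)\<bar> = \<bar>Y (t - q0) - Y (\<mu> q0 - q0)\<bar> * P"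
    using P by (simp add: abs_mult flip: right_diff_distrib)
  have "\<bar>D (\<mu> q) - P * Y (\<mu> q0 - q0)\<bar>
      \<le> (\<Lambda> * lip S * \<bar>\<mu> q - \<mu> q0\<bar>) * P + (E1 * \<bar>q - q0\<bar>) * P + \<bar>Y (t - q0) - Y (\<mu> q0 - q0)\<bar> * P"
    using 1 2 3 by linarith
  also have "\<dots> = (\<Lambda> * lip S * \<bar>\<mu> q - \<mu> q0\<bar> + E1 * \<bar>q - q0\<bar> + \<bar>Y (t - q0) - Y (\<mu> q0 - q0)\<bar>) * P"
    by (simp add: distrib_right)
  finally have "\<bar>D (\<mu> q) - P * Y (\<mu> q0 - q0)\<bar> / P
      \<le> \<Lambda> * lip S * \<bar>\<mu> q - \<mu> q0\<bar> + E1 * \<bar>q - q0\<bar> + \<bar>Y (t - q0) - Y (\<mu> q0 - q0)\<bar>"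
    using P by (simp add: pos_divide_le_eq)
  moreover have "\<bar>D (\<mu> q) - P * Y (\<mu> q0 - q0)\<bar> / P = \<bar>D (\<mu> q) / P - Y (\<mu> q0 - q0)\<bar>"
  proof -
    have "D (\<mu> q) / P - Y (\<mu> q0 - q0) = (D (\<mu> q) - P * Y (\<mu> q0 - q0)) / P" using P by (simp add: field_simps)
    then show ?thesis using P by simp
  qed
  ultimately show ?thesis unfolding ratio E1_def t_def by simp
qed

end

context unimodal_forcing
begin

lemma ftilde_eq: "ftilde a b f t = f t / c"
  using ab by (simp add: ftilde_def c_def abs_if)

lemma q_of_eq:
  assumes "0 \<le> q" "q \<le> \<beta>"
  shows "q_of a b \<beta> f (f q / c) = q"
  unfolding q_of_def ftilde_eq
proof (rule the_equality)
  fix x assume x: "x \<in> {0..\<beta>} \<and> f x / c = f q / c"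
  then have "f x = f q" using c by simp
  then show "x = q" using f_dec[of 0 x q] f_dec[of 0 q x] x assms by (cases x q rule: linorder_cases) auto
qed (use assms in auto)

lemma q_of_cont: "continuous_on ((\<lambda>q. f q / c) ` {0..\<beta>}) (q_of a b \<beta> f)"
  by (rule continuous_on_inv)
    (use q_of_eq c in \<open>auto intro!: continuous_intros continuous_on_subset[OF fc]\<close>)

lemma q_of_mem:
  assumes \<alpha>: "0 \<le> \<alpha>" "\<alpha> < \<beta>" and p: "0 \<le> p" "p < f \<alpha> / c"
  shows "\<alpha> < q_of a b \<beta> f p" "q_of a b \<beta> f p \<le> \<beta>" "f (q_of a b \<beta> f p) / c = p"
proof -
  have "\<exists>q. \<alpha> \<le> q \<and> q \<le> \<beta> \<and> f q / c = p"
    by (rule IVT2') (use p f\<beta> \<alpha> c in \<open>auto intro!: continuous_intros continuous_on_subset[OF fc]\<close>)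
  then obtain q where q: "\<alpha> \<le> q" "q \<le> \<beta>" "f q / c = p" by blast
  have "q_of a b \<beta> f p = q" using q_of_eq[of q] q \<alpha> by simp
  moreover have "q \<noteq> \<alpha>" using q p by auto
  ultimately show "\<alpha> < q_of a b \<beta> f p" "q_of a b \<beta> f p \<le> \<beta>" "f (q_of a b \<beta> f p) / c = p" using q by auto
qed

end

context shaped_family
begin

abbreviation "near q0 \<equiv> at q0 within {\<alpha><..\<beta>}"

lemma eventually_near: "eventually (\<lambda>q. \<alpha> < q \<and> q \<le> \<beta> \<and> q \<noteq> q0) (near q0)"
  by (auto simp: eventually_at_filter)

lemma f_near: "(f \<longlongrightarrow> f q0) (near q0)"
  using fc by (metis UNIV_I continuous_on_def subset_UNIV tendsto_within_subset)

lemma lipschitz_term_near: "((\<lambda>q. k * (\<bar>f q - f q0\<bar> / c)) \<longlongrightarrow> 0) (near q0)"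
proof -
  have "((\<lambda>q. k * (\<bar>f q - f q0\<bar> / c)) \<longlongrightarrow> k * (\<bar>f q0 - f q0\<bar> / c)) (near q0)"
    using c by (intro tendsto_intros f_near) auto
  then show ?thesis by simp
qed

lemma u_near:
  assumes q0: "\<alpha> < q0" "q0 \<le> \<beta>" and t: "\<beta> - h \<le> t"
  shows "((\<lambda>q. u q t) \<longlongrightarrow> u q0 t) (near q0)"
proof -
  have "((\<lambda>q. u q t - u q0 t) \<longlongrightarrow> 0) (near q0)"
  proof (rule Lim_null_comparison[OF _ lipschitz_term_near[of "lip (max 0 t)" q0]])
    show "\<forall>\<^sub>F q in near q0. norm (u q t - u q0 t) \<le> lip (max 0 t) * (\<bar>f q - f q0\<bar> / c)"
      using eventually_near
    proof eventually_elim
      case (elim q)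
      then show ?case using difference_lipschitz[of q q0 t "max 0 t"] q0 t by simp
    qed
  qed
  then show ?thesis by (simp add: LIM_zero_iff)
qed

lemma \<mu>_eventually_less:
  assumes q0: "\<alpha> < q0" "q0 \<le> \<beta>" and s: "\<mu> q0 < s"
  shows "\<forall>\<^sub>F q in near q0. \<mu> q < s"
proof -
  interpret S0: shaped_solution a b h T \<beta> f q0 "u q0" "m q0" "\<mu> q0" "\<nu> q0" by (rule shaped[OF q0])
  obtain t where t: "\<mu> q0 < t" "t < min s (\<nu> q0)" using dense[of "\<mu> q0" "min s (\<nu> q0)"] s S0.\<mu>\<nu> by auto
  have \<beta>t: "\<beta> < t" using \<mu>_ge[OF q0] t by simp
  have "((\<lambda>q. u q t - u q (t - h)) \<longlongrightarrow> u q0 t - u q0 (t - h)) (near q0)"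
    using \<beta>t h by (intro tendsto_intros u_near q0) auto
  moreover have "0 < u q0 t - u q0 (t - h)" using S0.late[of t] t by simp
  ultimately have "\<forall>\<^sub>F q in near q0. 0 < u q t - u q (t - h)" by (rule order_tendstoD(1))
  with eventually_near show ?thesis
  proof eventually_elim
    case (elim q)
    then interpret S: shaped_solution a b h T \<beta> f q "u q" "m q" "\<mu> q" "\<nu> q" by (intro shaped) auto
    have "\<not> t < \<mu> q" using S.early[of t] elim \<beta>t by auto
    moreover have "t \<noteq> \<mu> q" using S.gap_zero elim by auto
    ultimately show ?case using t by simp
  qed
qed

text \<open>On the compact interval from T to s the limit solution stays below its running maximum by a
positive amount, and this persists for nearby q, so none of them returns there.\<close>
lemma \<nu>_eventually_greater:
  assumes q0: "\<alpha> < q0" "q0 \<le> \<beta>" and s: "s < \<mu> q0"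
  shows "\<forall>\<^sub>F q in near q0. s < \<nu> q"
proof (cases "s < T")
  case True
  show ?thesis using eventually_near
  proof eventually_elim
    case (elim q)
    then interpret S: shaped_solution a b h T \<beta> f q "u q" "m q" "\<mu> q" "\<nu> q" by (intro shaped) auto
    show ?case using S.\<nu>_ge_T True by simp
  qed
next
  case False
  interpret S0: shaped_solution a b h T \<beta> f q0 "u q0" "m q0" "\<mu> q0" "\<nu> q0" by (rule shaped[OF q0])
  have "\<exists>r\<in>{T..s}. \<forall>t\<in>{T..s}. S0.U r - u q0 r \<le> S0.U t - u q0 t"
    by (rule continuous_attains_inf)
      (use False q0 \<beta>T h in \<open>auto intro!: continuous_intros S0.cu' S0.cU'\<close>)
  then obtain r where r: "r \<in> {T..s}" "\<And>t. t \<in> {T..s} \<Longrightarrow> S0.U r - u q0 r \<le> S0.U t - u q0 t" by blast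
  have pos: "0 < S0.U r - u q0 r"
    using S0.U_early[of r] S0.early[of r] r s q0 \<beta>T by simp
  have "\<forall>\<^sub>F q in near q0. lip s * (\<bar>f q - f q0\<bar> / c) < (S0.U r - u q0 r) / 2"
    by (rule order_tendstoD(2)[OF lipschitz_term_near]) (use pos in simp)
  with eventually_near show ?thesis
  proof eventually_elim
    case (elim q)
    then interpret S: shaped_solution a b h T \<beta> f q "u q" "m q" "\<mu> q" "\<nu> q" by (intro shaped) auto
    define d where "d = lip s * (\<bar>f q - f q0\<bar> / c)"
    show ?case
    proof (rule ccontr)
      assume "\<not> s < \<nu> q"
      then have \<nu>: "\<nu> q \<in> {T..s}" using S.\<nu>_ge_T by simp
      have close: "\<bar>u q t - u q0 t\<bar> \<le> d" if "\<beta> - h \<le> t" "t \<le> s" for t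
        unfolding d_def using that elim q0 False T by (intro difference_lipschitz) auto
      have "\<bar>S.U (\<nu> q) - S0.U (\<nu> q)\<bar> \<le> d"
        by (rule running_max_lipschitz)
          (use \<nu> h q0 elim \<beta>T in \<open>auto intro!: S.cu' S0.cu' close\<close>)
      moreover have "\<bar>u q (\<nu> q) - u q0 (\<nu> q)\<bar> \<le> d" using \<nu> h \<beta>T by (intro close) auto
      moreover have "S.U (\<nu> q) = u q (\<nu> q)" by (rule S.admissibleD_max[OF S.adm])
      ultimately have "S0.U (\<nu> q) - u q0 (\<nu> q) \<le> 2 * d" by linarith
      moreover have "2 * d < S0.U r - u q0 r" using elim(2) unfolding d_def[symmetric] by (simp add: field_simps)
      ultimately show False using r(2)[OF \<nu>] by simp
    qed
  qed
qed

lemma \<mu>_eventually_greater: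
  assumes q0: "\<alpha> < q0" "q0 \<le> \<beta>" and s: "s < \<mu> q0"
  shows "\<forall>\<^sub>F q in near q0. s < \<mu> q"
proof (cases "s < \<beta>")
  case True
  show ?thesis using eventually_near
    by eventually_elim (use \<mu>_ge True in force)
next
  case False
  interpret S0: shaped_solution a b h T \<beta> f q0 "u q0" "m q0" "\<mu> q0" "\<nu> q0" by (rule shaped[OF q0])
  have q0s: "q0 < s" using S0.\<mu>\<beta> s False q0 by (cases "q0 = \<beta>") auto
  have "((\<lambda>q. u q s - u q (s - h)) \<longlongrightarrow> u q0 s - u q0 (s - h)) (near q0)"
    using False h by (intro tendsto_intros u_near q0) auto
  moreover have "u q0 s - u q0 (s - h) < 0" using S0.early[of s] s q0s by simp
  ultimately have "\<forall>\<^sub>F q in near q0. u q s - u q (s - h) < 0" by (rule order_tendstoD(2))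
  with eventually_near \<nu>_eventually_greater[OF q0 s] show ?thesis
  proof eventually_elim
    case (elim q)
    then interpret S: shaped_solution a b h T \<beta> f q "u q" "m q" "\<mu> q" "\<nu> q" by (intro shaped) auto
    have "\<not> \<mu> q < s" using S.late[of s] elim by auto
    moreover have "s \<noteq> \<mu> q" using S.gap_zero elim by auto
    ultimately show ?case by simp
  qed
qed

text \<open>The sign of the gap u(t) - u(t - h) at a fixed time t locates t relative to \<mu>, and it is stable under
small changes of q.  Knowing \<nu> to be late enough excludes an early return before \<mu>(q0).\<close>
lemma \<mu>_near: "\<alpha> < q0 \<Longrightarrow> q0 \<le> \<beta> \<Longrightarrow> (\<mu> \<longlongrightarrow> \<mu> q0) (near q0)"
  by (intro order_tendstoI \<mu>_eventually_less \<mu>_eventually_greater)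

text \<open>The constant C of the orbit followed after the switching time.\<close>
definition orbit_level :: "real \<Rightarrow> real" where
  "orbit_level q = exp (c * \<mu> q) * u q (\<mu> q) - G (\<mu> q)"

text \<open>At the time \<mu>(q) the solution u(q0) may not have switched yet, and its orbit constant still decreases.
The rate is the gap of u(q0), which is largest at \<mu>(q) and of order |f(q) - f(q0)| there, since the gap
of u(q) vanishes.  With the length of the interval this is a product of two small quantities.  This
covers the case in which u(q) returns before \<mu>(q0), as happens when u(q0) touches f/c at its switch.\<close>
lemma orbit_level_defect:
  assumes q: "\<alpha> < q" "q \<le> \<beta>" and q0: "\<alpha> < q0" "q0 \<le> \<beta>"
    and m: "q0 < \<beta> \<Longrightarrow> m q0 < \<mu> q" and \<nu>: "\<mu> q < \<nu> q0"
  shows "\<bar>(exp (c * \<mu> q) * u q0 (\<mu> q) - G (\<mu> q)) - orbit_level q0\<bar>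
    \<le> exp (c * \<mu> q0) * \<bar>b\<bar> * (2 * lip (\<mu> q0)) * (\<bar>f q - f q0\<bar> / c) * \<bar>\<mu> q - \<mu> q0\<bar>"
proof -
  interpret S0: shaped_solution a b h T \<beta> f q0 "u q0" "m q0" "\<mu> q0" "\<nu> q0" by (rule shaped[OF q0])
  interpret S: shaped_solution a b h T \<beta> f q "u q" "m q" "\<mu> q" "\<nu> q" by (rule shaped[OF q])
  define d where "d = lip (\<mu> q0) * (\<bar>f q - f q0\<bar> / c)"
  have d0: "0 \<le> d" unfolding d_def using lip_pos c by (intro mult_nonneg_nonneg divide_nonneg_nonneg) (auto intro: less_imp_le)
  have "\<bar>S0.orbit_const (\<mu> q) - S0.orbit_const (\<mu> q0)\<bar> \<le> (exp (c * \<mu> q0) * (\<bar>b\<bar> * (2 * d))) * \<bar>\<mu> q - \<mu> q0\<bar>"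
  proof (cases "\<mu> q0 \<le> \<mu> q")
    case True
    then show ?thesis using S0.orbit_const_late[of "\<mu> q"] \<nu> d0 by simp
  next
    case False
    have "q0 < \<beta>" using False S0.\<mu>\<beta> \<mu>_ge[OF q] q0 by (cases "q0 = \<beta>") auto
    then have mlt: "m q0 < \<mu> q" "q0 < m q0" using m S0.m_less by auto
    have close: "\<bar>u q t - u q0 t\<bar> \<le> d" if "\<beta> - h \<le> t" "t \<le> \<mu> q0" for t
      unfolding d_def using that q q0 \<mu>_ge[OF q0] \<beta> by (intro difference_lipschitz) auto
    have gap: "u q0 (\<mu> q - h) - u q0 (\<mu> q) \<le> 2 * d"
      using close[of "\<mu> q"] close[of "\<mu> q - h"] S.gap_zero \<mu>_ge[OF q] False h by force
    have "\<bar>S0.orbit_const (\<mu> q0) - S0.orbit_const (\<mu> q)\<bar>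
        \<le> (exp (c * \<mu> q0) * (\<bar>b\<bar> * (2 * d))) * (\<mu> q0 - \<mu> q)"
    proof (rule abs_diff_le_derivative_bound)
      show "continuous_on {\<mu> q..\<mu> q0} S0.orbit_const" using mlt by (intro S0.orbit_const_cont) simp
      fix t assume t: "\<mu> q < t" "t < \<mu> q0"
      show "(S0.orbit_const has_real_derivative exp (c * t) * (b * (S0.U t - u q0 t))) (at t)"
        using t mlt by (intro S0.orbit_const_deriv) simp
      have "S0.U t = u q0 (t - h)" using t mlt by (intro S0.U_early) auto
      moreover have "u q0 t < u q0 (t - h)" using t mlt by (intro S0.early) auto
      moreover have "u q0 (\<mu> q) - u q0 (\<mu> q - h) \<le> u q0 t - u q0 (t - h)"
        using t mlt by (intro S0.gap_mono) auto
      ultimately have "\<bar>S0.U t - u q0 t\<bar> \<le> 2 * d" using gap by simp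
      then show "\<bar>exp (c * t) * (b * (S0.U t - u q0 t))\<bar> \<le> exp (c * \<mu> q0) * (\<bar>b\<bar> * (2 * d))"
        unfolding abs_mult using t c by (intro mult_mono) (auto intro!: mult_nonneg_nonneg)
    qed (use False in simp)
    moreover have "\<bar>\<mu> q - \<mu> q0\<bar> = \<mu> q0 - \<mu> q" using False by simp
    ultimately show ?thesis by (simp add: abs_minus_commute)
  qed
  moreover have "(exp (c * \<mu> q) * u q0 (\<mu> q) - G (\<mu> q)) - orbit_level q0
      = S0.orbit_const (\<mu> q) - S0.orbit_const (\<mu> q0)"
    by (simp add: S0.orbit_const_def orbit_level_def)
  moreover have "(exp (c * \<mu> q0) * (\<bar>b\<bar> * (2 * d))) * \<bar>\<mu> q - \<mu> q0\<bar>
      = exp (c * \<mu> q0) * \<bar>b\<bar> * (2 * lip (\<mu> q0)) * (\<bar>f q - f q0\<bar> / c) * \<bar>\<mu> q - \<mu> q0\<bar>"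
    by (simp add: d_def)
  ultimately show ?thesis by (simp only:)
qed

lemma orbit_level_slope:
  assumes q0: "\<alpha> < q0" "q0 \<le> \<beta>"
  shows "((\<lambda>q. (orbit_level q - orbit_level q0) / ((f q - f q0) / c))
    \<longlongrightarrow> exp (c * \<mu> q0) * Y (\<mu> q0 - q0)) (near q0)"
proof -
  interpret S0: shaped_solution a b h T \<beta> f q0 "u q0" "m q0" "\<mu> q0" "\<nu> q0" by (rule shaped[OF q0])
  obtain B where B: "B \<ge> 0" "\<And>s. s \<le> \<beta> \<Longrightarrow> \<bar>Y s - 1\<bar> \<le> B * \<bar>s\<bar>" using Y_near_one by blast
  note \<mu>lim = \<mu>_near[OF q0]
  define S where "S = \<mu> q0 + 1"
  have ev: "\<forall>\<^sub>F q in near q0. \<mu> q < S" by (rule order_tendstoD(2)[OF \<mu>lim]) (simp add: S_def)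
  have Ylim: "((\<lambda>q. Y (g q)) \<longlongrightarrow> Y l) (near q0)" if "(g \<longlongrightarrow> l) (near q0)" for g l
    using continuous_on_tendsto_compose[OF cY that] by simp
  have slope: "((\<lambda>q. (u q (\<mu> q) - u q0 (\<mu> q)) / ((f q - f q0) / c) - Y (\<mu> q0 - q0)) \<longlongrightarrow> 0) (near q0)"
  proof (rule Lim_null_comparison)
    show "\<forall>\<^sub>F q in near q0. norm ((u q (\<mu> q) - u q0 (\<mu> q)) / ((f q - f q0) / c) - Y (\<mu> q0 - q0))
      \<le> (\<Lambda> * lip S) * \<bar>\<mu> q - \<mu> q0\<bar> + ((exp (a * \<beta>) * c + B) * exp (\<Lambda> * S)) * \<bar>q - q0\<bar>
      + \<bar>Y (min (\<mu> q) (\<mu> q0) - q0) - Y (\<mu> q0 - q0)\<bar>"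
      using eventually_near ev
    proof eventually_elim
      case (elim q)
      then show ?case using slope_estimate[of q q0 B S] q0 B by (simp add: S_def)
    qed
    have "((\<lambda>q. (\<Lambda> * lip S) * \<bar>\<mu> q - \<mu> q0\<bar> + ((exp (a * \<beta>) * c + B) * exp (\<Lambda> * S)) * \<bar>q - q0\<bar>
      + \<bar>Y (min (\<mu> q) (\<mu> q0) - q0) - Y (\<mu> q0 - q0)\<bar>) \<longlongrightarrow>
      (\<Lambda> * lip S) * \<bar>\<mu> q0 - \<mu> q0\<bar> + ((exp (a * \<beta>) * c + B) * exp (\<Lambda> * S)) * \<bar>q0 - q0\<bar>
      + \<bar>Y (min (\<mu> q0) (\<mu> q0) - q0) - Y (\<mu> q0 - q0)\<bar>) (near q0)"
      by (intro tendsto_add tendsto_mult tendsto_rabs tendsto_diff tendsto_const \<mu>lim tendsto_ident_at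
          Ylim tendsto_min)
    then show "((\<lambda>q. (\<Lambda> * lip S) * \<bar>\<mu> q - \<mu> q0\<bar> + ((exp (a * \<beta>) * c + B) * exp (\<Lambda> * S)) * \<bar>q - q0\<bar>
      + \<bar>Y (min (\<mu> q) (\<mu> q0) - q0) - Y (\<mu> q0 - q0)\<bar>) \<longlongrightarrow> 0) (near q0)" by simp
  qed
  \<comment> \<open>r collects the orbit constant lost by u(q0) between the switching times\<close>
  define r where "r = (\<lambda>q. ((exp (c * \<mu> q) * u q0 (\<mu> q) - G (\<mu> q)) - orbit_level q0) / ((f q - f q0) / c))"
  have r: "(r \<longlongrightarrow> 0) (near q0)"
  proof (rule Lim_null_comparison)
    have ev1: "\<forall>\<^sub>F q in near q0. \<mu> q < \<nu> q0" by (rule order_tendstoD(2)[OF \<mu>lim S0.\<mu>\<nu>])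
    have ev2: "\<forall>\<^sub>F q in near q0. q0 < \<beta> \<longrightarrow> m q0 < \<mu> q"
      using order_tendstoD(1)[OF \<mu>lim, of "m q0"] S0.m_less by (cases "q0 < \<beta>") auto
    show "\<forall>\<^sub>F q in near q0. norm (r q) \<le> exp (c * \<mu> q0) * \<bar>b\<bar> * (2 * lip (\<mu> q0)) * \<bar>\<mu> q - \<mu> q0\<bar>"
      using eventually_near ev1 ev2
    proof eventually_elim
      case (elim q)
      define P where "P = \<bar>f q - f q0\<bar> / c"
      have "f q \<noteq> f q0" using f_anti[of q q0] f_anti[of q0 q] elim q0 by (cases q q0 rule: linorder_cases) auto
      then have P: "P > 0" using c by (simp add: P_def)
      have "norm (r q) = \<bar>(exp (c * \<mu> q) * u q0 (\<mu> q) - G (\<mu> q)) - orbit_level q0\<bar> / P"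
        by (simp only: r_def P_def real_norm_def abs_divide abs_of_pos[OF c])
      also have "\<dots> \<le> (exp (c * \<mu> q0) * \<bar>b\<bar> * (2 * lip (\<mu> q0)) * P * \<bar>\<mu> q - \<mu> q0\<bar>) / P"
        using orbit_level_defect[of q q0] elim q0 P unfolding P_def[symmetric]
        by (intro divide_right_mono) auto
      also have "\<dots> = exp (c * \<mu> q0) * \<bar>b\<bar> * (2 * lip (\<mu> q0)) * \<bar>\<mu> q - \<mu> q0\<bar>" using P by simp
      finally show ?case .
    qed
    have "((\<lambda>q. exp (c * \<mu> q0) * \<bar>b\<bar> * (2 * lip (\<mu> q0)) * \<bar>\<mu> q - \<mu> q0\<bar>) \<longlongrightarrow>
        exp (c * \<mu> q0) * \<bar>b\<bar> * (2 * lip (\<mu> q0)) * \<bar>\<mu> q0 - \<mu> q0\<bar>) (near q0)"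
      by (intro tendsto_intros \<mu>lim)
    then show "((\<lambda>q. exp (c * \<mu> q0) * \<bar>b\<bar> * (2 * lip (\<mu> q0)) * \<bar>\<mu> q - \<mu> q0\<bar>) \<longlongrightarrow> 0) (near q0)" by simp
  qed
  have "((\<lambda>q. exp (c * \<mu> q) * (((u q (\<mu> q) - u q0 (\<mu> q)) / ((f q - f q0) / c) - Y (\<mu> q0 - q0))
      + Y (\<mu> q0 - q0)) + r q) \<longlongrightarrow> exp (c * \<mu> q0) * (0 + Y (\<mu> q0 - q0)) + 0) (near q0)"
    by (intro tendsto_intros \<mu>lim slope r)
  moreover have "exp (c * \<mu> q) * (((u q (\<mu> q) - u q0 (\<mu> q)) / ((f q - f q0) / c) - Y (\<mu> q0 - q0))
      + Y (\<mu> q0 - q0)) + r q = (orbit_level q - orbit_level q0) / ((f q - f q0) / c)" for q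
  proof -
    have "orbit_level q - orbit_level q0 = exp (c * \<mu> q) * (u q (\<mu> q) - u q0 (\<mu> q))
        + ((exp (c * \<mu> q) * u q0 (\<mu> q) - G (\<mu> q)) - orbit_level q0)"
      by (simp add: orbit_level_def algebra_simps)
    then show ?thesis
      unfolding r_def by (simp only: add_divide_distrib diff_add_cancel times_divide_eq_right)
  qed
  ultimately show ?thesis by simp
qed

abbreviation "pmax \<equiv> f \<alpha> / c"

abbreviation "qp \<equiv> q_of a b \<beta> f"

lemma qp_mem: "p \<in> {0..<pmax} \<Longrightarrow> \<alpha> < qp p" "p \<in> {0..<pmax} \<Longrightarrow> qp p \<le> \<beta>" "p \<in> {0..<pmax} \<Longrightarrow> f (qp p) / c = p"
  using q_of_mem[of \<alpha> p] \<alpha> by auto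

lemma qp_cont: "continuous_on {0..<pmax} qp"
proof (rule continuous_on_subset[OF q_of_cont], rule subsetI)
  fix p assume p: "p \<in> {0..<pmax}"
  then have "p = f (qp p) / c" "qp p \<in> {0..\<beta>}" using qp_mem[OF p] \<alpha> by auto
  then show "p \<in> (\<lambda>q. f q / c) ` {0..\<beta>}" by blast
qed

lemma qp_filterlim:
  assumes p: "p \<in> {0..<pmax}"
  shows "filterlim qp (near (qp p)) (at p within {0..<pmax})"
  unfolding filterlim_at
proof
  show "(qp \<longlongrightarrow> qp p) (at p within {0..<pmax})" using qp_cont p by (simp add: continuous_on_def)
  have "\<forall>\<^sub>F x in at p within {0..<pmax}. x \<in> {0..<pmax} \<and> x \<noteq> p" by (auto simp: eventually_at_filter)
  then show "\<forall>\<^sub>F x in at p within {0..<pmax}. qp x \<in> {\<alpha><..\<beta>} \<and> qp x \<noteq> qp p"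
  proof eventually_elim
    case (elim x)
    then show ?case using qp_mem[of x] qp_mem(3)[OF p] by auto
  qed
qed

lemma \<mu>_qp_cont: "continuous_on {0..<pmax} (\<lambda>p. \<mu> (qp p))"
  unfolding continuous_on_def
proof
  fix p assume p: "p \<in> {0..<pmax}"
  show "((\<lambda>p. \<mu> (qp p)) \<longlongrightarrow> \<mu> (qp p)) (at p within {0..<pmax})"
    by (rule filterlim_compose[OF \<mu>_near qp_filterlim[OF p]]) (use qp_mem[OF p] in auto)
qed

lemma orbit_level_qp_deriv:
  assumes p: "p \<in> {0..<pmax}"
  shows "((\<lambda>p. orbit_level (qp p)) has_real_derivative
    exp (c * \<mu> (qp p)) * Y (\<mu> (qp p) - qp p)) (at p within {0..<pmax})"
  unfolding has_field_derivative_iff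
proof (rule Lim_transform_eventually)
  show "((\<lambda>x. (orbit_level (qp x) - orbit_level (qp p)) / ((f (qp x) - f (qp p)) / c)) \<longlongrightarrow>
      exp (c * \<mu> (qp p)) * Y (\<mu> (qp p) - qp p)) (at p within {0..<pmax})"
    by (rule filterlim_compose[OF orbit_level_slope qp_filterlim[OF p]]) (use qp_mem[OF p] in auto)
  have "\<forall>\<^sub>F x in at p within {0..<pmax}. x \<in> {0..<pmax}" by (auto simp: eventually_at_filter)
  then show "\<forall>\<^sub>F x in at p within {0..<pmax}.
      (orbit_level (qp x) - orbit_level (qp p)) / ((f (qp x) - f (qp p)) / c) =
      (orbit_level (qp x) - orbit_level (qp p)) / (x - p)"
  proof eventually_elim
    case (elim x)
    have "(f (qp x) - f (qp p)) / c = x - p" using qp_mem(3)[OF elim] qp_mem(3)[OF p] by (simp add: diff_divide_distrib)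
    then show ?case by simp
  qed
qed

lemma orbit_slope_cont: "continuous_on {0..<pmax} (\<lambda>p. exp (c * \<mu> (qp p)) * Y (\<mu> (qp p) - qp p))"
  by (intro continuous_intros \<mu>_qp_cont qp_cont continuous_on_compose2[OF cY]) auto

end

section \<open>The return map\<close>

context unimodal_forcing
begin

abbreviation "phase k \<equiv> {real k * T..real k * T + \<beta>}"

lemma phase_nonneg:
  assumes "t \<in> phase k" shows "0 \<le> t"
proof -
  have "0 \<le> real k * T" using T by simp
  also have "\<dots> \<le> t" using assms by simp
  finally show ?thesis .
qed

definition E_inv :: "nat \<Rightarrow> real \<Rightarrow> real" where
  "E_inv k = inv_into (phase k) E"

lemma E_inj: "inj_on E (phase k)"
proof (rule inj_onI)
  fix x y assume "x \<in> phase k" "y \<in> phase k" "E x = E y"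
  then show "x = y" using E_dec[of k x y] E_dec[of k y x] by (cases x y rule: linorder_cases) auto
qed

lemma E_inv_eq: "t \<in> phase k \<Longrightarrow> E_inv k (E t) = t"
  unfolding E_inv_def by (rule inv_into_f_f[OF E_inj])

lemma E_inv_cont: "continuous_on (E ` phase k) (E_inv k)"
proof (rule continuous_on_inv)
  have "phase k \<subseteq> {0..}" by (meson atLeast_iff phase_nonneg subsetI)
  then show "continuous_on (phase k) E" by (rule continuous_on_subset[OF E_cont])
  show "\<forall>t\<in>phase k. E_inv k (E t) = t" by (rule ballI) (rule E_inv_eq)
qed (rule compact_Icc)

lemma level_Suc_eq: "level (Suc j) = exp (c * T) * level j - G T"
proof -
  have "0 \<le> real j * T + \<beta>" using T \<beta> by simp
  then have "E ((real j * T + \<beta>) + T) = exp (c * T) * E (real j * T + \<beta>) - G T" by (rule E_shift)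
  moreover have "(real j * T + \<beta>) + T = real (Suc j) * T + \<beta>" by (simp add: algebra_simps)
  ultimately show ?thesis unfolding level_def by simp
qed

text \<open>The time shift by T acts on E by the affine map y \<mapsto> e^(cT) y - G(T), which maps level j to
level (j + 1).\<close>
lemma E_level_shift:
  assumes "0 \<le> t" "E t = level 0"
  shows "E (t + real j * T) = level j"
proof (induction j)
  case 0 then show ?case using assms by simp
next
  case (Suc j)
  have "E (t + real (Suc j) * T) = E ((t + real j * T) + T)" by (simp add: algebra_simps)
  also have "\<dots> = exp (c * T) * E (t + real j * T) - G T" using assms T by (intro E_shift) simp
  finally show ?case using Suc level_Suc_eq by simp
qed

text \<open>The solution of u' = -c u + f with orbit constant y.\<close>
definition orbit :: "real \<Rightarrow> real \<Rightarrow> real" where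
  "orbit y t = exp (- c * t) * (y + G t)"

lemma orbit_at_equilibrium:
  assumes "E t = y" shows "orbit y t = f t / c"
proof -
  have "y + G t = exp (c * t) * (f t / c)" using assms by (simp add: E_def)
  then have "orbit y t = (exp (- c * t) * exp (c * t)) * (f t / c)" by (simp only: orbit_def mult.assoc)
  also have "exp (- c * t) * exp (c * t) = 1" by (simp flip: exp_add)
  finally show ?thesis by simp
qed

text \<open>The derivative of the orbit has the sign of E - y, and E decreases through y at s.\<close>
lemma orbit_le_maximum:
  assumes s: "s \<in> phase k" and t: "t \<in> phase k" and y: "E s = y"
  shows "orbit y t \<le> f s / c"
proof -
  have d: "(orbit y has_real_derivative exp (- c * r) * c * (E r - y)) (at r)" if "0 < r" for r
  proof -
    have "((\<lambda>r. exp (- c * r) * (G r - (- y))) has_real_derivative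
        exp (- c * r) * (exp (c * r) * f r - c * (G r - (- y)))) (at r)"
      by (rule has_derivative_exp_weight[OF G_deriv[OF that]])
    moreover have "exp (c * r) * f r - c * (G r - (- y)) = c * (E r - y)"
      using c by (simp add: E_def algebra_simps)
    ultimately show ?thesis unfolding orbit_def by (simp add: add.commute mult.assoc)
  qed
  have ct: "continuous_on {x..z} (orbit y)" if "0 \<le> x" for x z
    unfolding orbit_def by (intro continuous_intros G_cont' that)
  have "orbit y t \<le> orbit y s"
  proof (cases "t \<le> s")
    case True
    show ?thesis
    proof (rule DERIV_nonneg_imp_increasing_open[OF True _ ct[OF phase_nonneg[OF t]]])
      fix r assume r: "t < r" "r < s"
      have "y < E r" using E_dec[of k r s] r s t y by auto
      then have "0 \<le> exp (- c * r) * c * (E r - y)" using c by simp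
      then show "\<exists>z. (orbit y has_real_derivative z) (at r) \<and> 0 \<le> z"
        using d[of r] phase_nonneg[OF t] r by auto
    qed
  next
    case False
    then have le: "s \<le> t" by simp
    show ?thesis
    proof (rule DERIV_nonpos_imp_decreasing_open[OF le _ ct[OF phase_nonneg[OF s]]])
      fix r assume r: "s < r" "r < t"
      have "E r < y" using E_dec[of k s r] r s t y by auto
      then have "exp (- c * r) * c * (E r - y) \<le> 0" using c by (intro mult_nonneg_nonpos) auto
      then show "\<exists>z. (orbit y has_real_derivative z) (at r) \<and> z \<le> 0"
        using d[of r] phase_nonneg[OF s] r by auto
    qed
  qed
  then show ?thesis using orbit_at_equilibrium[OF y] by simp
qed

text \<open>Envelope argument: the maximal value for one constant dominates the orbit with that constant at the
maximizing time of the other.  Exchanging the roles gives the opposite estimate, and the two squeeze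
the difference quotient.\<close>
lemma maximum_difference_lower:
  assumes s: "s \<in> phase k" and t: "t \<in> phase k"
  shows "exp (- c * s) * (E t - E s) \<le> f t / c - f s / c"
proof -
  have "orbit (E t) s \<le> f t / c" by (rule orbit_le_maximum[OF t s refl])
  moreover have "orbit (E s) s = f s / c" by (rule orbit_at_equilibrium[OF refl])
  moreover have "orbit (E t) s - orbit (E s) s = exp (- c * s) * (E t - E s)"
    by (simp add: orbit_def algebra_simps)
  ultimately show ?thesis by simp
qed

end

context shaped_family
begin

abbreviation "Dom \<equiv> {0..<pmax}"

text \<open>From here on everything is a function of p: C is the orbit constant, C' its derivative, M the
switching time and N the return time.\<close>
definition C :: "real \<Rightarrow> real" where "C p = orbit_level (qp p)"
definition C' :: "real \<Rightarrow> real" where "C' p = exp (c * \<mu> (qp p)) * Y (\<mu> (qp p) - qp p)"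
definition M :: "real \<Rightarrow> real" where "M p = \<mu> (qp p)"
definition N :: "real \<Rightarrow> real" where "N p = \<nu> (qp p)"

lemma pmax_pos: "0 < pmax"
  using f_dec[of 0 \<alpha> \<beta>] \<alpha> f\<beta> c by simp

lemma qp_0: "qp 0 = \<beta>" using q_of_eq[of \<beta>] \<beta> f\<beta> by simp

lemma shaped_p:
  assumes "p \<in> Dom"
  shows "shaped_solution a b h T \<beta> f (qp p) (u (qp p)) (m (qp p)) (M p) (N p)"
  unfolding M_def N_def by (rule shaped[OF qp_mem(1)[OF assms] qp_mem(2)[OF assms]])

lemma C_eq_orbit_const:
  assumes "p \<in> Dom" shows "C p = max_solution.orbit_const a b f (u (qp p)) (M p)"
proof -
  interpret S: shaped_solution a b h T \<beta> f "qp p" "u (qp p)" "m (qp p)" "M p" "N p" by (rule shaped_p[OF assms])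
  show ?thesis by (simp add: C_def orbit_level_def S.orbit_const_def M_def)
qed

lemma C_le_E:
  assumes "p \<in> Dom" "M p \<le> t" "t \<le> N p" shows "C p \<le> E t"
proof -
  interpret S: shaped_solution a b h T \<beta> f "qp p" "u (qp p)" "m (qp p)" "M p" "N p" by (rule shaped_p[OF assms(1)])
  show ?thesis using S.E_late[OF assms(2,3)] C_eq_orbit_const[OF assms(1)] by simp
qed

lemma E_N: "p \<in> Dom \<Longrightarrow> E (N p) = C p"
  using shaped_solution.E_\<nu>[OF shaped_p] C_eq_orbit_const by simp

lemma M_less_N: "p \<in> Dom \<Longrightarrow> M p < N p"
  using shaped_solution.\<mu>\<nu>[OF shaped_p] .

lemma N_phase:
  assumes "p \<in> Dom" obtains k where "k \<ge> 1" "real k * T \<le> N p" "N p < real k * T + \<beta>"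
  using shaped_solution.\<nu>_phase[OF shaped_p[OF assms]] by blast

lemma M_0: "M 0 = \<beta>"
  using shaped_solution.\<mu>\<beta>[OF shaped[of \<beta>]] \<alpha> by (simp add: M_def qp_0)

lemma C_0: "C 0 = level 0"
proof -
  interpret S: shaped_solution a b h T \<beta> f \<beta> "u \<beta>" "m \<beta>" "\<mu> \<beta>" "\<nu> \<beta>" by (rule shaped) (use \<alpha> in auto)
  show ?thesis using S.\<mu>\<beta> S.uq f\<beta> by (simp add: C_def orbit_level_def qp_0 level_eq)
qed

lemma C_deriv: "p \<in> Dom \<Longrightarrow> (C has_real_derivative C' p) (at p within Dom)"
  using orbit_level_qp_deriv unfolding C_def[abs_def] C'_def .

lemma C_cont: "continuous_on Dom C"
  using C_deriv by (intro DERIV_continuous_on) auto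

lemma C'_cont: "continuous_on Dom C'"
  using orbit_slope_cont unfolding C'_def[abs_def] .

lemma M_cont: "continuous_on Dom M"
  using \<mu>_qp_cont unfolding M_def[abs_def] .

text \<open>The switching time cannot pass (j+1)T + \<beta> as long as C stays above level (j + 1): it starts at \<beta>, is
continuous, and at that value C \<le> E(M) would contradict the lower bound.  Then E(N) = C selects the
phase.\<close>
lemma N_in_phase:
  assumes x: "x \<in> Dom" and low: "\<And>y. 0 \<le> y \<Longrightarrow> y \<le> x \<Longrightarrow> level (Suc j) < C y"
    and up: "1 \<le> j \<Longrightarrow> C x \<le> level j"
  shows "real (Suc j) * T \<le> N x" "N x < real (Suc j) * T + \<beta>"
proof -
  define s where "s = real (Suc j) * T + \<beta>"
  have Es: "E s = level (Suc j)" by (simp add: s_def level_def)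
  have Ms: "M x < s"
  proof (rule ccontr)
    assume "\<not> M x < s"
    moreover have "\<beta> \<le> s" using T by (simp add: s_def)
    ultimately have "\<exists>y. 0 \<le> y \<and> y \<le> x \<and> M y = s"
      using x M_0 by (intro IVT') (auto intro!: continuous_on_subset[OF M_cont])
    then obtain y where y: "0 \<le> y" "y \<le> x" "M y = s" by blast
    then have "y \<in> Dom" using x by simp
    then have "C y \<le> E s" using C_le_E[of y s] M_less_N[of y] y by simp
    then show False using low[OF y(1,2)] Es by simp
  qed
  show Ns: "N x < real (Suc j) * T + \<beta>"
  proof (rule ccontr)
    assume "\<not> ?thesis"
    then have "C x \<le> E s" using C_le_E[OF x, of s] Ms by (simp add: s_def)
    then show False using low[of x] x Es by simp
  qed
  obtain k where k: "k \<ge> 1" "real k * T \<le> N x" "N x < real k * T + \<beta>" using N_phase[OF x] by blast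
  have "level k < C x" using E_dec[OF k(2,3)] E_N[OF x] by (simp add: level_def)
  have "Suc j \<le> k"
  proof (rule ccontr)
    assume "\<not> Suc j \<le> k"
    then have "k \<le> j" by simp
    then have "C x \<le> level k" using up k(1) level_antimono[of k j] by force
    then show False using \<open>level k < C x\<close> by simp
  qed
  then have "real (Suc j) * T \<le> real k * T" using T by (intro mult_right_mono) auto
  then show "real (Suc j) * T \<le> N x" using k by simp
qed

lemma R_difference_lower:
  assumes "x \<in> Dom" "y \<in> Dom" "N x \<in> phase k" "N y \<in> phase k"
  shows "exp (- c * N x) * (C y - C x) \<le> f (N y) / c - f (N x) / c"
  using maximum_difference_lower[OF assms(3,4)] E_N assms(1,2) by simp

lemma N_cont:
  assumes D: "D \<subseteq> Dom" and ph: "\<And>x. x \<in> D \<Longrightarrow> N x \<in> phase k"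
  shows "continuous_on D N"
proof -
  have EC: "E (N x) = C x" if "x \<in> D" for x using E_N D that by blast
  have "C ` D \<subseteq> E ` phase k"
  proof
    fix z assume "z \<in> C ` D"
    then obtain x where "x \<in> D" "z = E (N x)" using EC by auto
    then show "z \<in> E ` phase k" using ph by blast
  qed
  then have "continuous_on D (\<lambda>x. E_inv k (C x))"
    by (intro continuous_on_compose2[OF E_inv_cont continuous_on_subset[OF C_cont D]])
  moreover have "E_inv k (C x) = N x" if "x \<in> D" for x
    unfolding EC[OF that, symmetric] by (rule E_inv_eq[OF ph[OF that]])
  ultimately show ?thesis by (simp cong: continuous_on_cong)
qed

lemma R_deriv:
  assumes D: "D \<subseteq> Dom" and ph: "\<And>x. x \<in> D \<Longrightarrow> N x \<in> phase k" and x: "x \<in> D"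
  shows "((\<lambda>p. f (N p) / c) has_real_derivative C' x * exp (- c * N x)) (at x within D)"
  unfolding has_field_derivative_iff
proof -
  let ?F = "at x within D"
  define dC where "dC = (\<lambda>y. (C y - C x) / (y - x))"
  define dR where "dR = (\<lambda>y. (f (N y) / c - f (N x) / c) / (y - x))"
  have Clim: "(dC \<longlongrightarrow> C' x) ?F"
    using DERIV_subset[OF C_deriv D] D x unfolding has_field_derivative_iff dC_def by blast
  have Nlim: "(N \<longlongrightarrow> N x) ?F" using N_cont[OF D ph] x by (simp add: continuous_on_def)
  have "((\<lambda>y. dR y - exp (- c * N x) * dC y) \<longlongrightarrow> 0) ?F"
  proof (rule Lim_null_comparison)
    have "\<forall>\<^sub>F y in ?F. y \<in> D \<and> y \<noteq> x" by (auto simp: eventually_at_filter)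
    then show "\<forall>\<^sub>F y in ?F. norm (dR y - exp (- c * N x) * dC y) \<le> \<bar>exp (- c * N y) - exp (- c * N x)\<bar> * \<bar>dC y\<bar>"
    proof eventually_elim
      case (elim y)
      have lo: "exp (- c * N x) * (C y - C x) \<le> f (N y) / c - f (N x) / c"
        by (rule R_difference_lower) (use elim D x ph in auto)
      have "exp (- c * N y) * (C x - C y) \<le> f (N x) / c - f (N y) / c"
        by (rule R_difference_lower) (use elim D x ph in auto)
      then have hi: "f (N y) / c - f (N x) / c \<le> exp (- c * N y) * (C y - C x)" by (simp add: algebra_simps)
      have "\<bar>(f (N y) / c - f (N x) / c) - exp (- c * N x) * (C y - C x)\<bar>
          \<le> (exp (- c * N y) - exp (- c * N x)) * (C y - C x)"
        using lo hi by (simp add: left_diff_distrib)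
      also have "\<dots> \<le> \<bar>exp (- c * N y) - exp (- c * N x)\<bar> * \<bar>C y - C x\<bar>"
        by (metis abs_ge_self abs_mult)
      finally have "\<bar>(f (N y) / c - f (N x) / c) - exp (- c * N x) * (C y - C x)\<bar> / \<bar>y - x\<bar>
          \<le> \<bar>exp (- c * N y) - exp (- c * N x)\<bar> * \<bar>C y - C x\<bar> / \<bar>y - x\<bar>"
        by (rule divide_right_mono) simp
      moreover have "dR y - exp (- c * N x) * dC y
          = ((f (N y) / c - f (N x) / c) - exp (- c * N x) * (C y - C x)) / (y - x)"
        by (simp only: dR_def dC_def diff_divide_distrib[of _ "exp (- c * N x) * (C y - C x)"] times_divide_eq_right)
      ultimately show ?case by (simp only: real_norm_def abs_divide dC_def times_divide_eq_right)
    qed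
    have "((\<lambda>y. \<bar>exp (- c * N y) - exp (- c * N x)\<bar> * \<bar>dC y\<bar>) \<longlongrightarrow>
        \<bar>exp (- c * N x) - exp (- c * N x)\<bar> * \<bar>C' x\<bar>) ?F"
      by (intro tendsto_intros Nlim Clim)
    then show "((\<lambda>y. \<bar>exp (- c * N y) - exp (- c * N x)\<bar> * \<bar>dC y\<bar>) \<longlongrightarrow> 0) ?F" by simp
  qed
  moreover have "((\<lambda>y. exp (- c * N x) * dC y) \<longlongrightarrow> exp (- c * N x) * C' x) ?F"
    by (intro tendsto_intros Clim)
  ultimately have "((\<lambda>y. (dR y - exp (- c * N x) * dC y) + exp (- c * N x) * dC y) \<longlongrightarrow> 0 + exp (- c * N x) * C' x) ?F"
    by (rule tendsto_add)
  then show "((\<lambda>y. (f (N y) / c - f (N x) / c) / (y - x)) \<longlongrightarrow> C' x * exp (- c * N x)) ?F"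
    by (simp add: dR_def mult.commute)
qed

end

text \<open>The slope of C has a single change of sign, at p = f(\<tau>)/c.\<close>
locale peaked_family = shaped_family +
  fixes \<tau> :: real
  assumes \<tau>: "\<alpha> < \<tau>" "\<tau> < \<beta>"
    and Y_pos: "\<And>q. \<tau> < q \<Longrightarrow> q \<le> \<beta> \<Longrightarrow> 0 < Y (\<mu> q - q)"
    and Y_neg: "\<And>q. \<alpha> < q \<Longrightarrow> q < \<tau> \<Longrightarrow> Y (\<mu> q - q) < 0"
begin

definition ptop :: real where "ptop = f \<tau> / c"

lemma ptop: "0 < ptop" "ptop < pmax"
  using f_dec[of 0 \<tau> \<beta>] f_dec[of 0 \<alpha> \<tau>] \<alpha> \<tau> f\<beta> c by (auto simp: ptop_def divide_strict_right_mono)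

lemma qp_ptop:
  assumes p: "p \<in> Dom"
  shows "p < ptop \<Longrightarrow> \<tau> < qp p" "ptop < p \<Longrightarrow> qp p < \<tau>"
proof -
  note q = qp_mem[OF p]
  have fq: "f (qp p) = c * p" using q(3) c by (simp add: field_simps)
  have ft: "f \<tau> = c * ptop" using c by (simp add: ptop_def)
  show "\<tau> < qp p" if "p < ptop"
  proof (rule ccontr)
    assume "\<not> \<tau> < qp p"
    then have "f \<tau> \<le> f (qp p)" using f_dec[of 0 "qp p" \<tau>] q \<alpha> \<tau> by (cases "qp p = \<tau>") auto
    then show False using fq ft that c by simp
  qed
  show "qp p < \<tau>" if "ptop < p"
  proof (rule ccontr)
    assume "\<not> qp p < \<tau>"
    then have "f (qp p) \<le> f \<tau>" using f_dec[of 0 \<tau> "qp p"] q \<alpha> \<tau> by (cases "qp p = \<tau>") auto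
    then show False using fq ft that c by simp
  qed
qed

lemma C'_sign:
  "p \<in> Dom \<Longrightarrow> p < ptop \<Longrightarrow> 0 < C' p" "p \<in> Dom \<Longrightarrow> ptop < p \<Longrightarrow> C' p < 0"
  using qp_ptop[of p] qp_mem[of p] Y_pos[of "qp p"] Y_neg[of "qp p"]
  by (auto simp: C'_def mult_pos_neg)

lemma C_deriv_at: "0 < p \<Longrightarrow> p < pmax \<Longrightarrow> (C has_real_derivative C' p) (at p)"
  using C_deriv[of p] at_within_interior[of p Dom] by simp

lemma C_inc:
  assumes "0 \<le> x" "x < y" "y \<le> ptop" shows "C x < C y"
proof (rule DERIV_pos_imp_increasing_open[OF assms(2)])
  show "\<exists>d. (C has_real_derivative d) (at r) \<and> 0 < d" if "x < r" "r < y" for r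
    using C_deriv_at[of r] C'_sign(1)[of r] that assms ptop by (intro exI[of _ "C' r"]) auto
qed (use assms ptop in \<open>auto intro!: continuous_on_subset[OF C_cont]\<close>)

lemma C_dec:
  assumes "ptop \<le> x" "x < y" "y < pmax" shows "C y < C x"
proof (rule DERIV_neg_imp_decreasing_open[OF assms(2)])
  show "\<exists>d. (C has_real_derivative d) (at r) \<and> d < 0" if "x < r" "r < y" for r
    using C_deriv_at[of r] C'_sign(2)[of r] that assms ptop by (intro exI[of _ "C' r"]) auto
qed (use assms ptop in \<open>auto intro!: continuous_on_subset[OF C_cont]\<close>)

lemma C_before_top: "0 \<le> x \<Longrightarrow> x \<le> ptop \<Longrightarrow> level 0 \<le> C x"
  using C_inc[of 0 x] C_0 by (cases "x = 0") auto

definition reached :: "nat \<Rightarrow> bool" where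
  "reached j \<longleftrightarrow> (\<exists>x. ptop < x \<and> x < pmax \<and> C x = level j)"

text \<open>The points p_j.  The value for the first j that is not reached is the right end of the range of p, which is
the convention for a finite sequence.\<close>
definition jump :: "nat \<Rightarrow> real" where
  "jump j = (if j = 0 then 0 else if reached j then (SOME x. ptop < x \<and> x < pmax \<and> C x = level j) else pmax)"

definition jump_count :: enat where
  "jump_count = (if \<forall>n. reached (Suc n) then \<infinity> else enat (LEAST n. \<not> reached (Suc n)))"

lemma jump_0: "jump 0 = 0" by (simp add: jump_def)

lemma jump_reached:
  assumes "j \<ge> 1" "reached j"
  shows "ptop < jump j" "jump j < pmax" "C (jump j) = level j"
proof -
  have "ptop < jump j \<and> jump j < pmax \<and> C (jump j) = level j"
    using assms someI_ex[OF assms(2)[unfolded reached_def]] by (auto simp: jump_def)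
  then show "ptop < jump j" "jump j < pmax" "C (jump j) = level j" by auto
qed

lemma reached_if_le_count: "enat j \<le> jump_count \<Longrightarrow> 1 \<le> j \<Longrightarrow> reached j"
proof -
  assume j: "enat j \<le> jump_count" "1 \<le> j"
  then obtain i where i: "j = Suc i" by (cases j) auto
  show "reached j"
  proof (cases "\<forall>n. reached (Suc n)")
    case False
    then have "jump_count = enat (LEAST n. \<not> reached (Suc n))" unfolding jump_count_def by (rule if_not_P)
    then have "i < (LEAST n. \<not> reached (Suc n))" using j i by simp
    then show ?thesis using not_less_Least i by blast
  qed (use i in auto)
qed

lemma not_reached_count:
  assumes "jump_count = enat n" shows "\<not> reached (Suc n)"
proof -
  have ex: "\<exists>n. \<not> reached (Suc n)"
  proof (rule ccontr)
    assume "\<not> ?thesis"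
    then have "jump_count = \<infinity>" by (simp add: jump_count_def)
    then show False using assms by simp
  qed
  then have "\<not> (\<forall>n. reached (Suc n))" by simp
  then have "jump_count = enat (LEAST n. \<not> reached (Suc n))" unfolding jump_count_def by (rule if_not_P)
  then show ?thesis using LeastI_ex[OF ex] assms by simp
qed

lemma jump_le_pmax: "jump j \<le> pmax" using jump_reached[of j] pmax_pos by (cases "reached j") (auto simp: jump_def)

lemma ptop_less_jump: "ptop < jump (Suc j)"
  using jump_reached[of "Suc j"] ptop by (cases "reached (Suc j)") (auto simp: jump_def)

lemma jump_less:
  assumes j: "enat j \<le> jump_count" shows "jump j < jump (Suc j)"
proof (cases "j = 0")
  case True then show ?thesis using ptop_less_jump[of 0] ptop by (simp add: jump_0)
next
  case False
  then have r: "reached j" using reached_if_le_count[OF j] by simp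
  note J = jump_reached[OF _ r]
  show ?thesis
  proof (cases "reached (Suc j)")
    case True
    note J' = jump_reached[OF _ True]
    show ?thesis
    proof (rule ccontr)
      assume "\<not> ?thesis"
      then have "C (jump j) \<le> C (jump (Suc j))"
        using C_dec[of "jump (Suc j)" "jump j"] J J' False by (cases "jump j = jump (Suc j)") auto
      then show False using J J' False level_Suc[of j] by simp
    qed
  next
    case nr: False then show ?thesis using J False by (simp add: jump_def)
  qed
qed

text \<open>Before the top C is at least level 0; after it C decreases strictly and meets level (j + 1) only at
jump (j + 1), or not at all.\<close>
lemma C_above_next_level:
  assumes x: "0 \<le> x" "x < jump (Suc j)" shows "level (Suc j) < C x"
proof (cases "x \<le> ptop")
  case True
  then show ?thesis using C_before_top[of x] x level_strict_antimono[of 0 "Suc j"] by simp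
next
  case False
  show ?thesis
  proof (cases "reached (Suc j)")
    case True
    then show ?thesis using C_dec[of x "jump (Suc j)"] jump_reached[of "Suc j"] False x by simp
  next
    case nr: False
    then have xp: "x < pmax" using x by (simp add: jump_def)
    have top: "level (Suc j) < C ptop"
      using C_before_top[of ptop] ptop level_strict_antimono[of 0 "Suc j"] by simp
    show ?thesis
    proof (rule ccontr)
      assume "\<not> ?thesis"
      then have "\<exists>y. ptop \<le> y \<and> y \<le> x \<and> C y = level (Suc j)"
        using top False xp ptop by (intro IVT2') (auto intro!: continuous_on_subset[OF C_cont])
      then obtain y where y: "ptop \<le> y" "y \<le> x" "C y = level (Suc j)" by blast
      then have "reached (Suc j)" unfolding reached_def using top xp by (intro exI[of _ y]) (auto simp: less_le)
      then show False using nr by blast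
    qed
  qed
qed

lemma C_below_level:
  assumes j: "enat j \<le> jump_count" "1 \<le> j" and x: "jump j \<le> x" "x < pmax"
  shows "C x \<le> level j"
  using jump_reached[OF j(2) reached_if_le_count[OF j]] C_dec[of "jump j" x] x
  by (cases "x = jump j") auto

abbreviation "piece j \<equiv> {jump j..<jump (Suc j)}"

lemma jump_nonneg: "0 \<le> jump j"
  using ptop_less_jump[of "j - 1"] ptop by (cases j) (auto simp: jump_0)

lemma piece_subset: "piece j \<subseteq> Dom"
  using jump_nonneg[of j] jump_le_pmax[of "Suc j"] by auto

lemma N_piece:
  assumes j: "enat j \<le> jump_count" and x: "x \<in> piece j"
  shows "real (Suc j) * T \<le> N x" "N x < real (Suc j) * T + \<beta>"
proof -
  have xD: "x \<in> Dom" using piece_subset x by blast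
  have low: "level (Suc j) < C y" if "0 \<le> y" "y \<le> x" for y using C_above_next_level[of y j] that x by simp
  have up: "C x \<le> level j" if "1 \<le> j" using C_below_level[OF j that, of x] x xD by simp
  show "real (Suc j) * T \<le> N x" "N x < real (Suc j) * T + \<beta>" using N_in_phase[OF xD low up] by auto
qed

lemma N_piece_phase: "enat j \<le> jump_count \<Longrightarrow> x \<in> piece j \<Longrightarrow> N x \<in> phase (Suc j)"
  using N_piece[of j x] by auto

definition return_value :: "real \<Rightarrow> real" where "return_value p = f (N p) / c"
definition return_slope :: "real \<Rightarrow> real" where "return_slope p = C' p * exp (- c * N p)"

lemma return_value_deriv:
  assumes j: "enat j \<le> jump_count" and x: "x \<in> piece j"
  shows "(return_value has_real_derivative return_slope x) (at x within piece j)"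
  unfolding return_value_def[abs_def] return_slope_def by (rule R_deriv[OF piece_subset N_piece_phase[OF j] x])

lemma return_slope_cont:
  assumes j: "enat j \<le> jump_count" shows "continuous_on (piece j) return_slope"
  unfolding return_slope_def[abs_def]
  by (intro continuous_intros continuous_on_subset[OF C'_cont piece_subset] N_cont[OF piece_subset N_piece_phase[OF j]])

lemma return_value_compare:
  assumes j: "enat j \<le> jump_count" and x: "x \<in> piece j" and y: "y \<in> piece j" and C: "C x < C y"
  shows "return_value x < return_value y"
proof -
  have "exp (- c * N x) * (C y - C x) \<le> return_value y - return_value x"
    unfolding return_value_def using j x y piece_subset N_piece_phase by (intro R_difference_lower) blast+
  moreover have "0 < exp (- c * N x) * (C y - C x)" using C by simp
  ultimately show ?thesis by simp
qed

lemma N_left_limit: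
  assumes j: "enat j \<le> jump_count" "1 \<le> j"
  shows "(N \<longlongrightarrow> real j * T + \<beta>) (at_left (jump j))"
proof -
  obtain i where i: "j = Suc i" using j(2) by (cases j) auto
  have i_le: "enat i \<le> jump_count" using j(1) i by (metis Suc_ile_eq less_imp_le)
  note J = jump_reached[OF j(2) reached_if_le_count[OF j]]
  have lt: "jump i < jump j" using jump_less[OF i_le] i by simp
  have inD: "\<forall>\<^sub>F x in at_left (jump j). x \<in> piece i"
    using eventually_at_left_real[OF lt] by eventually_elim (simp add: i)
  have mem: "real j * T + \<beta> \<in> phase j" using \<beta> by simp
  have lev: "level j = E (real j * T + \<beta>)" by (simp add: level_def)
  have "(C \<longlongrightarrow> C (jump j)) (at (jump j))"
    using DERIV_isCont[OF C_deriv_at[OF less_trans[OF ptop(1) J(1)] J(2)]] by (simp only: isCont_def)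
  then have Clim: "(C \<longlongrightarrow> level j) (at_left (jump j))"
    using J by (simp add: filterlim_at_split)
  have "((\<lambda>x. E_inv j (C x)) \<longlongrightarrow> E_inv j (level j)) (at_left (jump j))"
  proof (rule continuous_on_tendsto_compose[OF E_inv_cont Clim])
    show "level j \<in> E ` phase j" using mem lev by blast
    show "\<forall>\<^sub>F x in at_left (jump j). C x \<in> E ` phase j" using inD
    proof eventually_elim
      case (elim x)
      then show ?case using N_piece_phase[OF i_le elim] E_N[of x] piece_subset[of i] i by force
    qed
  qed
  then have "((\<lambda>x. E_inv j (C x)) \<longlongrightarrow> real j * T + \<beta>) (at_left (jump j))"
    using E_inv_eq[OF mem] lev by simp
  then show ?thesis
  proof (rule Lim_transform_eventually)
    show "\<forall>\<^sub>F x in at_left (jump j). E_inv j (C x) = N x" using inD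
    proof eventually_elim
      case (elim x)
      then show ?case using E_inv_eq[OF N_piece_phase[OF i_le elim]] E_N[of x] piece_subset[of i] i by force
    qed
  qed
qed

lemma return_value_left_limit:
  assumes j: "enat j \<le> jump_count" "1 \<le> j"
  shows "(return_value \<longlongrightarrow> 0) (at_left (jump j))"
proof -
  have "((\<lambda>x. f (N x) / c) \<longlongrightarrow> f (real j * T + \<beta>) / c) (at_left (jump j))"
    using c by (intro tendsto_divide tendsto_const continuous_on_tendsto_compose[OF fc N_left_limit[OF j]]) auto
  then show ?thesis by (simp add: f_zero return_value_def[abs_def])
qed

text \<open>At a jump the orbit constant is level j, and the time shift by jT carries the orbit that starts at \<beta>
with constant level 0 into it.\<close>
lemma return_value_jump:
  assumes j: "enat j \<le> jump_count" "1 \<le> j"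
  shows "return_value 0 = return_value (jump j)"
proof -
  have 0: "0 \<in> piece 0" using jump_less[of 0] by (simp add: jump_0 zero_enat_def[symmetric])
  have z: "enat 0 \<le> jump_count" by (simp add: zero_enat_def[symmetric])
  have N0: "N 0 \<in> phase 1" using N_piece_phase[OF z 0] by simp
  have "E (N 0) = level 0" using E_N[of 0] C_0 pmax_pos by simp
  then have E0: "E (N 0 + real j * T) = level j" by (rule E_level_shift[OF phase_nonneg[OF N0]])
  have jp: "jump j \<in> piece j" using jump_less[OF j(1)] by simp
  have Ej: "E (N (jump j)) = level j"
    using E_N[OF subsetD[OF piece_subset jp]] jump_reached(3)[OF j(2) reached_if_le_count[OF j]] by simp
  have eq: "E (N (jump j)) = E (N 0 + real j * T)" by (simp only: Ej E0)
  have "N 0 + real j * T \<in> phase (Suc j)" using N0 by (auto simp: algebra_simps)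
  then have "N (jump j) = N 0 + real j * T"
    by (rule inj_onD[OF E_inj eq N_piece_phase[OF j(1) jp]])
  then show ?thesis by (simp add: return_value_def f_shift)
qed

text \<open>Both one-sided limits carry the same factor C' < 0, but on the left \<nu> tends to jT + \<beta>, while on the
right it is already in the next phase, which makes e^(-c \<nu>) smaller.\<close>
lemma return_slope_limits:
  assumes j: "enat j \<le> jump_count" "1 \<le> j"
  shows "\<exists>l r. (return_slope \<longlongrightarrow> l) (at_left (jump j)) \<and> (return_slope \<longlongrightarrow> r) (at_right (jump j)) \<and> l < r"
proof (intro exI conjI)
  note J = jump_reached[OF j(2) reached_if_le_count[OF j]]
  have jpos: "0 < jump j" using ptop(1) J(1) by (rule less_trans)
  have jD: "jump j \<in> Dom" using jpos J by simp
  have "isCont C' (jump j)"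
    by (rule continuous_on_interior[OF C'_cont]) (use J jpos in simp)
  then have "(C' \<longlongrightarrow> C' (jump j)) (at_left (jump j))" by (simp add: isCont_def filterlim_at_split)
  then show "(return_slope \<longlongrightarrow> C' (jump j) * exp (- c * (real j * T + \<beta>))) (at_left (jump j))"
    unfolding return_slope_def[abs_def] by (intro tendsto_intros N_left_limit[OF j])
  have jp: "jump j \<in> piece j" using jump_less[OF j(1)] by simp
  have within: "at (jump j) within piece j = at_right (jump j)"
    by (rule at_within_nhd[of _ "{..<jump (Suc j)}"]) (use jump_less[OF j(1)] in auto)
  have "(return_slope \<longlongrightarrow> return_slope (jump j)) (at (jump j) within piece j)"
    using return_slope_cont[OF j(1)] jp by (simp add: continuous_on_def)
  then show "(return_slope \<longlongrightarrow> return_slope (jump j)) (at_right (jump j))"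
    using within by simp
  have "real j * T + \<beta> < N (jump j)"
    using N_piece(1)[OF j(1) jp] \<beta>T by (simp add: algebra_simps)
  then have "exp (- c * N (jump j)) < exp (- c * (real j * T + \<beta>))" using c by simp
  then show "C' (jump j) * exp (- c * (real j * T + \<beta>)) < return_slope (jump j)"
    unfolding return_slope_def using C'_sign(2)[OF jD J(1)] by (intro mult_strict_left_mono_neg)
qed

end

section \<open>The sign of the linearized response\<close>

context shaped_solution
begin

lemma first_phase_deriv:
  assumes r: "q < r" "r < \<mu>" "r \<le> q + h"
  shows "((\<lambda>r. exp (- a * r) * (u r - f q / c)) has_real_derivative exp (- a * r) * (f r - f q)) (at r)"
proof -
  have "U r = f q / c" using U_early[of r] hist[of "r - h"] r by simp
  moreover have "(a + b) * (f q / c) + f q = 0" using equilibrium_iff by blast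
  ultimately show ?thesis using weighted_deriv[OF r(1), of "f q / c" q] by simp
qed

text \<open>Before the first delay interval is over the running maximum is the constant initial value, and the
equation integrates explicitly.\<close>
lemma forward_integral:
  assumes t: "q \<le> t" "t \<le> \<mu>" "t \<le> q + h"
  shows "((\<lambda>s. exp (- a * s) * (f (q + s) - f q)) has_integral exp (- a * (t - q)) * (u t - f q / c)) {0..t - q}"
proof -
  define W where "W = (\<lambda>r. exp (- a * r) * (u r - f q / c))"
  have "((\<lambda>s. exp (- a * s) * (f (q + s) - f q)) has_integral
      exp (a * q) * W (q + (t - q)) - exp (a * q) * W (q + 0)) {0..t - q}"
  proof (rule fundamental_theorem_of_calculus_interior)
    show "continuous_on {0..t - q} (\<lambda>s. exp (a * q) * W (q + s))"
      unfolding W_def using h by (intro continuous_intros continuous_on_compose2[OF cu]) auto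
    fix s assume "s \<in> {0<..<t - q}"
    then have s: "q < q + s" "q + s < \<mu>" "q + s \<le> q + h" using t by auto
    have "((\<lambda>s. W (q + s)) has_real_derivative (exp (- a * (q + s)) * (f (q + s) - f q)) * 1) (at s)"
      by (rule DERIV_chain2[of W], rule first_phase_deriv[OF s, folded W_def]) (auto intro!: derivative_eq_intros)
    then have "((\<lambda>s. exp (a * q) * W (q + s)) has_real_derivative
        exp (a * q) * ((exp (- a * (q + s)) * (f (q + s) - f q)) * 1)) (at s)"
      by (rule DERIV_cmult)
    also have "exp (a * q) * ((exp (- a * (q + s)) * (f (q + s) - f q)) * 1) =
        exp (a * q + - a * (q + s)) * (f (q + s) - f q)"
      unfolding exp_add by simp
    also have "a * q + - a * (q + s) = - a * s" by (simp add: algebra_simps)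
    finally show "((\<lambda>s. exp (a * q) * W (q + s)) has_vector_derivative exp (- a * s) * (f (q + s) - f q)) (at s)"
      by (simp add: has_real_derivative_iff_has_vector_derivative)
  qed (use t in simp)
  moreover have "exp (a * q) * W (q + (t - q)) = exp (a * q + - a * t) * (u t - f q / c)"
    unfolding W_def exp_add by simp
  moreover have "a * q + - a * t = - a * (t - q)" by (simp add: algebra_simps)
  moreover have "W (q + 0) = 0" using uq by (simp add: W_def)
  ultimately show ?thesis by simp
qed

text \<open>The same integration with the time reversed; its value is the gap at q + h.\<close>
lemma backward_integral:
  assumes le: "q + h \<le> \<mu>"
  shows "((\<lambda>s. exp (a * s) * (f (q + h - s) - f q)) has_integral (u (q + h) - f q / c)) {0..h}"
proof -
  define W where "W = (\<lambda>r. exp (- a * r) * (u r - f q / c))"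
  have "((\<lambda>s. exp (a * s) * (f (q + h - s) - f q)) has_integral
      - exp (a * (q + h)) * W (q + h - h) - - exp (a * (q + h)) * W (q + h - 0)) {0..h}"
  proof (rule fundamental_theorem_of_calculus_interior)
    show "continuous_on {0..h} (\<lambda>s. - exp (a * (q + h)) * W (q + h - s))"
      unfolding W_def using h by (intro continuous_intros continuous_on_compose2[OF cu]) auto
    fix s assume "s \<in> {0<..<h}"
    then have s: "q < q + h - s" "q + h - s < \<mu>" "q + h - s \<le> q + h" using le by auto
    have "((\<lambda>s. W (q + h - s)) has_real_derivative (exp (- a * (q + h - s)) * (f (q + h - s) - f q)) * - 1) (at s)"
      by (rule DERIV_chain2[of W], rule first_phase_deriv[OF s, folded W_def]) (auto intro!: derivative_eq_intros)
    then have "((\<lambda>s. - exp (a * (q + h)) * W (q + h - s)) has_real_derivative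
        - exp (a * (q + h)) * ((exp (- a * (q + h - s)) * (f (q + h - s) - f q)) * - 1)) (at s)"
      by (rule DERIV_cmult)
    also have "- exp (a * (q + h)) * ((exp (- a * (q + h - s)) * (f (q + h - s) - f q)) * - 1) =
        exp (a * (q + h) + - a * (q + h - s)) * (f (q + h - s) - f q)"
      unfolding exp_add by simp
    also have "a * (q + h) + - a * (q + h - s) = a * s" by (simp add: algebra_simps)
    finally show "((\<lambda>s. - exp (a * (q + h)) * W (q + h - s)) has_vector_derivative
        exp (a * s) * (f (q + h - s) - f q)) (at s)"
      by (simp add: has_real_derivative_iff_has_vector_derivative)
  qed (use h in simp)
  moreover have "exp (a * (q + h)) * W (q + h) = exp (a * (q + h) + - a * (q + h)) * (u (q + h) - f q / c)"
    unfolding W_def exp_add by simp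
  moreover have "W q = 0" using uq by (simp add: W_def)
  ultimately show ?thesis by simp
qed

lemma \<mu>_le_if_integral_nonneg:
  assumes "0 \<le> integral {0..h} (\<lambda>s. exp (a * s) * (f (q + h - s) - f q))"
  shows "\<mu> \<le> q + h"
proof (rule ccontr)
  assume "\<not> \<mu> \<le> q + h"
  then have lt: "q + h < \<mu>" by simp
  then have "integral {0..h} (\<lambda>s. exp (a * s) * (f (q + h - s) - f q)) = u (q + h) - f q / c"
    by (intro integral_unique backward_integral) simp
  moreover have "u (q + h) < u q" using early[of "q + h"] lt h by simp
  ultimately show False using assms uq by simp
qed

text \<open>At \<mu> the solution is back at its initial value, so the integral of e^(-as) (f(q + s) - f(q)) up to
\<mu> - q vanishes; with e^(-as) = (a + b)/b at the upper end this is the stated equation.\<close>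
lemma switching_time_equation:
  assumes \<mu>h: "\<mu> \<le> q + h" and eq: "\<mu> - q = 1 / a * ln (b / (a + b))"
  shows "f q + b * integral {0..1 / a * ln (b / (a + b))} (\<lambda>s. exp (- a * s) * f (s + q)) = 0"
proof -
  define S where "S = \<mu> - q"
  have S: "0 \<le> S" using qm m\<mu> by (simp add: S_def)
  have "u \<mu> = f q / c" using gap_zero hist[of "\<mu> - h"] \<mu>h qm m\<mu> by simp
  then have 1: "((\<lambda>s. exp (- a * s) * (f (q + s) - f q)) has_integral 0) {0..S}"
    using forward_integral[of \<mu>] qm m\<mu> \<mu>h by (simp add: S_def)
  have "((\<lambda>s. f q * exp (- a * s)) has_integral
      (f q * (- exp (- a * S) / a) - f q * (- exp (- a * 0) / a))) {0..S}"
  proof (rule fundamental_theorem_of_calculus[OF S])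
    fix s
    have "((\<lambda>s. f q * (- exp (- a * s) / a)) has_real_derivative f q * exp (- a * s)) (at s within {0..S})"
      using a by (auto intro!: derivative_eq_intros)
    then show "((\<lambda>s. f q * (- exp (- a * s) / a)) has_vector_derivative f q * exp (- a * s)) (at s within {0..S})"
      by (simp add: has_real_derivative_iff_has_vector_derivative)
  qed
  from has_integral_add[OF 1 this]
  have "((\<lambda>s. exp (- a * s) * f (s + q)) has_integral f q * (1 - exp (- a * S)) / a) {0..S}"
    by (simp add: algebra_simps diff_divide_distrib add.commute)
  then have int: "integral {0..S} (\<lambda>s. exp (- a * s) * f (s + q)) = f q * (1 - exp (- a * S)) / a"
    by (rule integral_unique)
  have "0 < b / (a + b)" using b ab by (simp add: divide_neg_neg)
  moreover have "- a * S = - ln (b / (a + b))" using eq a by (simp add: S_def)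
  ultimately have "exp (- a * S) = (a + b) / b" by (simp add: exp_minus)
  then have "1 - exp (- a * S) = - a / b" using b by (simp add: field_simps)
  then have "b * (f q * (1 - exp (- a * S)) / a) = - f q"
    using a b by (simp only:) simp
  then show ?thesis using int eq by (simp add: S_def)
qed

end

context shaped_family
begin

text \<open>On the first delay interval the delayed term is still the constant 1.\<close>
lemma Y_explicit:
  assumes s: "0 \<le> s" "s \<le> h"
  shows "Y s = ((a + b) * exp (a * s) - b) / a"
proof (cases "s = 0")
  case True then show ?thesis using Y1[of 0] a by simp
next
  case False
  have "exp (- a * s) * (Y s - (- (b / a))) = exp (- a * 0) * (Y 0 - (- (b / a)))"
  proof (rule DERIV_isconst_end[of 0 s "\<lambda>s. exp (- a * s) * (Y s - (- (b / a)))"])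
    show "continuous_on {0..s} (\<lambda>s. exp (- a * s) * (Y s - (- (b / a))))"
      by (intro continuous_intros continuous_on_subset[OF cY]) auto
    fix r assume r: "0 < r" "r < s"
    have "a * Y r + b * Y (r - h) - a * (Y r - (- (b / a))) = 0"
      using Y1[of "r - h"] r s a by (simp add: algebra_simps)
    then show "((\<lambda>s. exp (- a * s) * (Y s - (- (b / a)))) has_real_derivative 0) (at r)"
      using has_derivative_exp_weight[OF dY[OF r(1)], of a "- (b / a)"] by simp
  qed (use s False in simp)
  then have e: "exp (- a * s) * (Y s + b / a) = 1 + b / a" using Y1[of 0] by simp
  have "exp (a * s) * (exp (- a * s) * (Y s + b / a)) = Y s + b / a" by (simp flip: mult.assoc exp_add)
  then have "Y s + b / a = exp (a * s) * (1 + b / a)" unfolding e by simp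
  then show ?thesis using a by (simp add: field_simps)
qed

lemma Y_sign:
  assumes s: "0 \<le> s" "s \<le> h"
  shows "0 < Y s \<longleftrightarrow> s < 1 / a * ln (b / (a + b))" "Y s < 0 \<longleftrightarrow> 1 / a * ln (b / (a + b)) < s"
proof -
  have pos: "0 < b / (a + b)" using b ab by (simp add: divide_neg_neg)
  have "0 < Y s \<longleftrightarrow> b < (a + b) * exp (a * s)" using a by (simp add: Y_explicit[OF s] zero_less_divide_iff)
  also have "\<dots> \<longleftrightarrow> exp (a * s) < b / (a + b)" using ab by (simp add: neg_less_divide_eq mult.commute)
  also have "\<dots> \<longleftrightarrow> a * s < ln (b / (a + b))" using pos by (metis exp_less_cancel_iff exp_ln)
  also have "\<dots> \<longleftrightarrow> s < 1 / a * ln (b / (a + b))" using a by (simp add: pos_less_divide_eq mult.commute)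
  finally show "0 < Y s \<longleftrightarrow> s < 1 / a * ln (b / (a + b))" .
  have "Y s < 0 \<longleftrightarrow> (a + b) * exp (a * s) < b" using a by (simp add: Y_explicit[OF s] divide_less_0_iff)
  also have "\<dots> \<longleftrightarrow> b / (a + b) < exp (a * s)" using ab by (simp add: neg_divide_less_eq mult.commute)
  also have "\<dots> \<longleftrightarrow> ln (b / (a + b)) < a * s" using pos by (metis exp_less_cancel_iff exp_ln)
  also have "\<dots> \<longleftrightarrow> 1 / a * ln (b / (a + b)) < s" using a by (simp add: pos_divide_less_eq mult.commute)
  finally show "Y s < 0 \<longleftrightarrow> 1 / a * ln (b / (a + b)) < s" .
qed

text \<open>The time \<mu> - q is 0 at \<beta> and exceeds the zero s0 of Y at \<beta>1, where Y < 0 is assumed.  It can equal s0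
only at \<tau>, so by the intermediate value theorem it is below s0 to the right of \<tau> and above s0 to the
left.\<close>
lemma peaked_if_unique_root:
  assumes \<beta>1: "\<alpha> < \<beta>1" "\<beta>1 < \<tau>" "\<tau> < \<beta>"
    and int: "\<And>q. \<beta>1 < q \<Longrightarrow> q < \<beta> \<Longrightarrow> 0 \<le> integral {0..h} (\<lambda>s. exp (a * s) * (f (q + h - s) - f q))"
    and root: "\<And>q. \<beta>1 < q \<Longrightarrow> q < \<beta> \<Longrightarrow>
      f q + b * integral {0..1 / a * ln (b / (a + b))} (\<lambda>s. exp (- a * s) * f (s + q)) = 0 \<Longrightarrow> q = \<tau>"
    and neg: "\<And>q. \<alpha> < q \<Longrightarrow> q \<le> \<beta>1 \<Longrightarrow> Y (\<mu> q - q) < 0"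
  shows "peaked_family a b h T \<beta> f \<alpha> u m \<mu> \<nu> Y \<tau>"
proof unfold_locales
  define s0 where "s0 = 1 / a * ln (b / (a + b))"
  define S where "S = (\<lambda>q. \<mu> q - q)"
  have s0: "0 < s0"
  proof -
    have "1 < b / (a + b)" using a ab by (simp add: neg_less_divide_eq)
    then show ?thesis unfolding s0_def using a by simp
  qed
  have c\<mu>: "continuous_on {\<alpha><..\<beta>} \<mu>"
    unfolding continuous_on_def using \<mu>_near by auto
  have cS: "continuous_on {x..y} S" if "\<alpha> < x" "y \<le> \<beta>" for x y
    unfolding S_def using that by (intro continuous_intros continuous_on_subset[OF c\<mu>]) auto
  have S_nonneg: "0 \<le> S q" if "\<alpha> < q" "q \<le> \<beta>" for q using \<mu>_ge[OF that] that by (simp add: S_def)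
  have S_le: "S q \<le> h" if q: "\<beta>1 < q" "q < \<beta>" for q
    using shaped_solution.\<mu>_le_if_integral_nonneg[OF shaped int[OF q]] q \<beta>1 by (simp add: S_def)
  have S_\<beta>: "S \<beta> = 0"
    using shaped_solution.\<mu>\<beta>[OF shaped[of \<beta>]] \<alpha> by (simp add: S_def)
  have hit: "q = \<tau>" if q: "\<beta>1 < q" "q < \<beta>" "S q = s0" for q
  proof (rule root[OF q(1,2)])
    have sh: "shaped_solution a b h T \<beta> f q (u q) (m q) (\<mu> q) (\<nu> q)" using q \<beta>1 by (intro shaped) auto
    show "f q + b * integral {0..1 / a * ln (b / (a + b))} (\<lambda>s. exp (- a * s) * f (s + q)) = 0"
      by (rule shaped_solution.switching_time_equation[OF sh])
        (use S_le[OF q(1,2)] q(3) in \<open>simp_all add: S_def s0_def\<close>)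
  qed
  have "S \<beta>1 \<le> h"
  proof (rule continuous_le_on_closure[of "{\<beta>1<..<\<beta>}" S])
    show "continuous_on (closure {\<beta>1<..<\<beta>}) S" using cS[of \<beta>1 \<beta>] \<beta>1 by simp
    show "\<beta>1 \<in> closure {\<beta>1<..<\<beta>}" using \<beta>1 by simp
    show "S x \<le> h" if "x \<in> {\<beta>1<..<\<beta>}" for x using S_le[of x] that by simp
  qed
  then have S1: "s0 < S \<beta>1"
    using Y_sign(2)[of "S \<beta>1"] S_nonneg[of \<beta>1] neg[of \<beta>1] \<beta>1 by (simp add: S_def s0_def)
  have after: "S q < s0" if q: "\<tau> < q" "q \<le> \<beta>" for q
  proof (rule ccontr)
    assume "\<not> S q < s0"
    then have "\<exists>x. q \<le> x \<and> x \<le> \<beta> \<and> S x = s0"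
      using S_\<beta> s0 q \<beta>1 by (intro IVT2' cS) auto
    then obtain x where x: "q \<le> x" "x \<le> \<beta>" "S x = s0" by blast
    then have "x \<noteq> \<beta>" using S_\<beta> s0 by auto
    then show False using hit[of x] x q \<beta>1 by simp
  qed
  have before: "s0 < S q" if q: "\<beta>1 < q" "q < \<tau>" for q
  proof (rule ccontr)
    assume "\<not> s0 < S q"
    then have "\<exists>x. \<beta>1 \<le> x \<and> x \<le> q \<and> S x = s0"
      using S1 q \<beta>1 by (intro IVT2' cS) auto
    then obtain x where x: "\<beta>1 \<le> x" "x \<le> q" "S x = s0" by blast
    then have "x \<noteq> \<beta>1" using S1 by auto
    then show False using hit[of x] x q \<beta>1 by simp
  qed
  show "\<alpha> < \<tau>" "\<tau> < \<beta>" using \<beta>1 by auto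
  show "0 < Y (\<mu> q - q)" if q: "\<tau> < q" "q \<le> \<beta>" for q
  proof -
    have "S q \<le> h" using S_le[of q] S_\<beta> h q \<beta>1 by (cases "q = \<beta>") auto
    then show ?thesis using Y_sign(1)[of "S q"] after[OF q] S_nonneg[of q] q \<beta>1 by (simp add: S_def s0_def)
  qed
  show "Y (\<mu> q - q) < 0" if q: "\<alpha> < q" "q < \<tau>" for q
  proof (cases "q \<le> \<beta>1")
    case True then show ?thesis using neg q by simp
  next
    case False
    then show ?thesis
      using Y_sign(2)[of "S q"] before[of q] S_le[of q] S_nonneg[of q] q \<beta>1 by (simp add: S_def s0_def)
  qed
qed

end

text \<open>Reduced to one period, a zero anywhere but at \<beta> would force f(\<beta>) < 0.\<close>
lemma periodic_zero_unimodal: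
  fixes f :: "real \<Rightarrow> real"
  assumes per: "\<And>t. f (t + T) = f t" and \<beta>: "0 < \<beta>" "\<beta> < T"
    and dec: "strict_antimono_on {0..\<beta>} f" and inc: "strict_mono_on {\<beta>..T} f"
    and nn: "\<And>t. 0 \<le> f t" and z: "f t = 0"
  shows "f \<beta> = 0"
proof -
  have T: "T > 0" using \<beta> by simp
  have shift: "f (t + real n * T) = f t" for n t
  proof (induction n)
    case (Suc n)
    have "f (t + real (Suc n) * T) = f ((t + real n * T) + T)" by (simp add: algebra_simps)
    then show ?case using Suc per by simp
  qed simp
  define k where "k = \<lfloor>t / T\<rfloor>"
  define s where "s = t - of_int k * T"
  have "of_int k \<le> t / T" "t / T < of_int k + 1" unfolding k_def by linarith+
  then have s: "0 \<le> s" "s < T" using T by (auto simp: s_def field_simps)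
  have "f s = 0"
  proof (cases "0 \<le> k")
    case True
    then have "t = s + real (nat k) * T" by (simp add: s_def)
    then show ?thesis using shift[of s "nat k"] z by simp
  next
    case False
    then have "s = t + real (nat (- k)) * T" by (simp add: s_def)
    then show ?thesis using shift[of t "nat (- k)"] z by simp
  qed
  moreover have "s < \<beta> \<Longrightarrow> f \<beta> < f s" using monotone_onD[OF dec, of s \<beta>] s \<beta> by simp
  moreover have "\<beta> < s \<Longrightarrow> f \<beta> < f s" using monotone_onD[OF inc, of \<beta> s] s \<beta> by simp
  ultimately show ?thesis using nn[of \<beta>] by (cases s \<beta> rule: linorder_cases) auto
qed

context unimodal_forcing
begin

lemma sol_max_solution:
  assumes "0 \<le> q" "q \<le> \<beta>"
  shows "max_solution a b h T \<beta> f q (sol a b h f q)"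
proof unfold_locales
  obtain B where "\<And>t. \<bar>f t\<bar> \<le> B" using f_bounded by blast
  then show "is_solution a b h f q (f q / c) (sol a b h f q)"
    using sol_is_solution[OF less_imp_le[OF h] fc, of B a b q] by (simp only: ftilde_eq)
qed (use assms in auto)

lemma sol_shaped:
  assumes stab: "a * h \<le> 1 \<or> b * h < - exp (a * h - 1)"
    and q: "0 \<le> q" "q \<le> \<beta>" and U: "U_shaped a b h \<beta> f q"
  shows "\<exists>m \<mu>. shaped_solution a b h T \<beta> f q (sol a b h f q) m \<mu> (nu_star a b h f q)"
proof -
  interpret S: max_solution a b h T \<beta> f q "sol a b h f q" by (rule sol_max_solution[OF q])
  have ns: "nu_star a b h f q = (LEAST \<nu>. S.admissible \<nu>)"
    unfolding nu_star_def S.admissible_def ..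
  have least: "S.admissible (nu_star a b h f q)" "\<And>x. S.admissible x \<Longrightarrow> nu_star a b h f q \<le> x"
    unfolding ns by (rule S.least_admissible[OF S.admissible_exists[OF stab]])+
  show ?thesis
  proof (cases "q < \<beta>")
    case True
    then obtain m \<delta> where "{t \<in> {q<..<nu_star a b h f q}. turning_point (sol a b h f q) t} = {m}"
      "\<forall>t\<in>{q<..<nu_star a b h f q}. sol a b h f q m \<le> sol a b h f q t" "\<delta> > 0"
      "\<forall>t\<in>{nu_star a b h f q - \<delta><..<nu_star a b h f q}.
         (sol a b h f q has_real_derivative (a + b) * sol a b h f q t + f t) (at t)"
      using U unfolding U_shaped_def Let_def by blast
    then show ?thesis using S.shaped_if_single_turning_point[OF least(1), of m \<delta>] True by blast
  next
    case False
    then have "q = \<beta>" using q by simp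
    then show ?thesis using S.shaped_from_minimum[OF _ least] by blast
  qed
qed

end

section \<open>The piecewise structure of the return map\<close>

theorem theorem25:
  fixes a b h T \<beta> \<beta>\<^sub>1 \<tau> \<alpha> :: real and f :: "real \<Rightarrow> real"
  assumes "0 < h" and "h < T"
    and "(a + b < 0 \<and> a * h \<le> 1) \<or> (b * h < - exp (a * h - 1) \<and> a * h \<ge> 1)"
    and "continuous_on UNIV f"
    and "\<forall>t. f (t + T) = f t"
    and "0 < \<beta>" and "\<beta> < T"
    and "strict_antimono_on {0..\<beta>} f" and "strict_mono_on {\<beta>..T} f"
    and "\<forall>t. 0 \<le> f t" and "\<exists>t. f t = 0"
    and "f C1_differentiable_on UNIV"
    and "\<forall>x. card {t \<in> {x..<x + T}. deriv f t = 0} = 2"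
    and "a > 0" and "b < 0" and "\<beta> < h"
    and "\<beta>\<^sub>1 < \<beta>"
    (* The set is an interval with endpoints \<beta>\<^sub>1 and \<beta>; the left endpoint is not excluded. *)
    and "{\<beta>\<^sub>1<..<\<beta>} \<subseteq>
           {q \<in> {0..<\<beta>}. integral {0..h} (\<lambda>s. exp (a * s) * (f (q + h - s) - f q)) \<ge> 0}"
    and "{q \<in> {0..<\<beta>}. integral {0..h} (\<lambda>s. exp (a * s) * (f (q + h - s) - f q)) \<ge> 0}
           \<subseteq> {\<beta>\<^sub>1..<\<beta>}"
    and "\<tau> \<in> {\<beta>\<^sub>1<..<\<beta>}"
    and "\<forall>x\<in>{\<beta>\<^sub>1<..<\<beta>}.
           f x + b * integral {0..1 / a * ln (b / (a + b))} (\<lambda>u. exp (- a * u) * f (u + x)) = 0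
             \<longleftrightarrow> x = \<tau>"
    and "0 < \<alpha>" and "\<alpha> < \<beta>\<^sub>1"
    and "\<forall>q\<in>{\<alpha><..\<beta>}. U_shaped a b h \<beta> f q"
    and "\<forall>q\<in>{\<alpha><..\<beta>\<^sub>1}. Delta a b h f q < 0"
  (* p 1, p 2, ... is the sequence and N its length.  The convention p 0 = 0 and, for a finite
     sequence, p (N + 1) = ftilde \<alpha> makes {p j..<p (Suc j)} the (j+1)-st interval for all j \<le> N. *)
  shows "\<exists>(N :: enat) (p :: nat \<Rightarrow> real) (R' :: real \<Rightarrow> real).
    (let R = return_map a b h \<beta> f; D = (\<lambda>j. {p j..<p (Suc j)}) in
      p 0 = 0 \<and> (\<forall>n. N = enat n \<longrightarrow> p (Suc n) = ftilde a b f \<alpha>) \<and>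
      0 < ftilde a b f \<tau> \<and> ftilde a b f \<tau> < p 1 \<and>
      (\<forall>j. enat j \<le> N \<longrightarrow> p j < p (Suc j)) \<and>
      (\<forall>j\<ge>1. enat j \<le> N \<longrightarrow> p j < ftilde a b f \<alpha>) \<and>
      (\<forall>j. enat j \<le> N \<longrightarrow>
         (\<forall>x\<in>D j. (R has_real_derivative R' x) (at x within D j) \<and>
                   R' x = Delta a b h f (q_of a b \<beta> f x)) \<and>
         continuous_on (D j) R') \<and>
      strict_mono_on {0<..<ftilde a b f \<tau>} R \<and>
      strict_antimono_on {ftilde a b f \<tau><..<p 1} R \<and>
      (\<forall>j\<ge>1. enat j \<le> N \<longrightarrow> strict_antimono_on (D j) R) \<and>
      (\<forall>j\<ge>1. enat j \<le> N \<longrightarrow>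
         continuous (at_right (p j)) R \<and>
         (R \<longlongrightarrow> 0) (at_left (p j)) \<and>
         R 0 = R (p j) \<and>
         (\<exists>l r. (R' \<longlongrightarrow> l) (at_left (p j)) \<and> (R' \<longlongrightarrow> r) (at_right (p j)) \<and> l < r)))"
proof -
  obtain t0 where "f t0 = 0" using assms(11) by blast
  then have f\<beta>: "f \<beta> = 0"
    by (rule periodic_zero_unimodal[OF assms(5)[rule_format] assms(6-9) assms(10)[rule_format]])
  have \<alpha>\<beta>: "\<alpha> < \<beta>" using assms(17,23) by simp
  interpret unimodal_forcing a b h T \<beta> f
  proof unfold_locales
    show "a + b < 0"
    proof (cases "a * h \<le> 1 \<and> a + b < 0")
      case False
      then have bh: "b * h < - exp (a * h - 1)" using assms(3) by argo
      have "a * h \<le> exp (a * h - 1)" using exp_ge_add_one_self[of "a * h - 1"] by simp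
      then have "(a + b) * h < 0" using bh by (simp add: distrib_right)
      then show ?thesis using assms(1) by (simp add: mult_less_0_iff)
    qed simp
  qed (use assms(1,2,4-10,14-16) f\<beta> in \<open>simp_all only: simp_thms\<close>)
  have stab: "a * h \<le> 1 \<or> b * h < - exp (a * h - 1)" using assms(3) by blast
  have "\<forall>q\<in>{\<alpha><..\<beta>}. \<exists>s. shaped_solution a b h T \<beta> f q (sol a b h f q) (fst s) (snd s) (nu_star a b h f q)"
  proof
    fix q assume q: "q \<in> {\<alpha><..\<beta>}"
    then have "0 \<le> q" "q \<le> \<beta>" using assms(22) by simp_all
    then obtain m \<mu> where "shaped_solution a b h T \<beta> f q (sol a b h f q) m \<mu> (nu_star a b h f q)"
      using sol_shaped[OF stab] assms(24) q by blast
    then show "\<exists>s. shaped_solution a b h T \<beta> f q (sol a b h f q) (fst s) (snd s) (nu_star a b h f q)"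
      by (intro exI[of _ "(m, \<mu>)"]) simp
  qed
  then obtain s where s: "\<And>q. q \<in> {\<alpha><..\<beta>} \<Longrightarrow>
      shaped_solution a b h T \<beta> f q (sol a b h f q) (fst (s q)) (snd (s q)) (nu_star a b h f q)"
    unfolding bchoice_iff by blast
  obtain Y :: "real \<Rightarrow> real" where Y: "continuous_on UNIV Y" "\<forall>s\<le>0. Y s = 1"
    "\<forall>s\<ge>0. (Y has_real_derivative a * Y s + b * Y (s - h)) (at s within {0..})"
    using linear_delay_equation_exists[of h a b] assms(1) by (metis less_imp_le)
  define \<mu> where "\<mu> = (\<lambda>q. snd (s q))"
  interpret shaped_family a b h T \<beta> f \<alpha> "sol a b h f" "\<lambda>q. fst (s q)" \<mu> "nu_star a b h f" Y
  proof (rule shaped_family.intro[OF unimodal_forcing_axioms], rule shaped_family_axioms.intro)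
    show "shaped_solution a b h T \<beta> f q (sol a b h f q) (fst (s q)) (\<mu> q) (nu_star a b h f q)"
      if "\<alpha> < q" "q \<le> \<beta>" for q using s[of q] that by (simp add: \<mu>_def)
    show "(Y has_real_derivative a * Y r + b * Y (r - h)) (at r)" if "0 < r" for r
      using Y(3) that by (intro has_derivative_interior[of _ _ _ 0]) auto
  qed (use Y(1,2) assms(22) \<alpha>\<beta> in simp_all)
  have mu: "mu a b h f q = \<mu> q" if "\<alpha> < q" "q \<le> \<beta>" for q
    by (rule shaped_solution.switching_unique[OF shaped[OF that]]) simp_all
  have Delta: "Delta a b h f q = Y (\<mu> q - q) * exp (- c * (nu_star a b h f q - \<mu> q))"
    if q: "\<alpha> < q" "q \<le> \<beta>" for q
  proof -
    have "fundamental_solution a b h (\<mu> q - q)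
        + b * integral {\<mu> q - q - h..\<mu> q - q} (fundamental_solution a b h) = Y (\<mu> q - q)"
      using \<mu>_ge[OF q] q ab by (intro fundamental_solution_integral[OF assms(1) _ Y]) auto
    then show ?thesis by (simp add: Delta_def Let_def mu[OF q] c_def)
  qed
  interpret peaked_family a b h T \<beta> f \<alpha> "sol a b h f" "\<lambda>q. fst (s q)" \<mu> "nu_star a b h f" Y \<tau>
  proof (rule peaked_if_unique_root[of \<beta>\<^sub>1])
    show "Y (\<mu> q - q) < 0" if "\<alpha> < q" "q \<le> \<beta>\<^sub>1" for q
    proof -
      have "Y (\<mu> q - q) * exp (- c * (nu_star a b h f q - \<mu> q)) < 0"
        using Delta[of q] assms(17) assms(25)[rule_format, of q] that by simp
      then show ?thesis by (simp add: mult_less_0_iff)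
    qed
    show "0 \<le> integral {0..h} (\<lambda>s. exp (a * s) * (f (q + h - s) - f q))" if "\<beta>\<^sub>1 < q" "q < \<beta>" for q
      using assms(18) that by auto
    show "q = \<tau>" if "\<beta>\<^sub>1 < q" "q < \<beta>"
      "f q + b * integral {0..1 / a * ln (b / (a + b))} (\<lambda>s. exp (- a * s) * f (s + q)) = 0" for q
      using assms(21) that by auto
  qed (use assms(20,23) in simp_all)
  let ?R = "return_map a b h \<beta> f"
  have R: "?R x = return_value x" if "x \<in> Dom" for x
    using shaped_solution.u\<nu>[OF shaped_p[OF that]] by (simp add: return_map_def Let_def return_value_def N_def)
  have R': "return_slope x = Delta a b h f (qp x)" if x: "x \<in> Dom" for x
  proof -
    have "Delta a b h f (qp x) = Y (M x - qp x) * exp (- c * (N x - M x))"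
      using Delta[OF qp_mem(1)[OF x] qp_mem(2)[OF x]] by (simp add: M_def N_def)
    also have "- c * (N x - M x) = c * M x + - c * N x" by (simp add: algebra_simps)
    finally show ?thesis unfolding return_slope_def C'_def exp_add by (simp add: M_def)
  qed
  have deriv: "(?R has_real_derivative return_slope x) (at x within piece j)"
    if "enat j \<le> jump_count" "x \<in> piece j" for j x
    by (rule has_field_derivative_transform_within[OF return_value_deriv[OF that], of 1])
      (use that R piece_subset in \<open>auto simp: subset_iff\<close>)
  have mono: "?R x < ?R y" if "enat j \<le> jump_count" "x \<in> piece j" "y \<in> piece j" "C x < C y" for j x y
    using return_value_compare[OF that] R[of x] R[of y] piece_subset[of j] that by auto
  have zero_le: "enat 0 \<le> jump_count" by (simp add: zero_enat_def[symmetric])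
  have top_sub: "x \<in> piece 0" if "0 < x" "x < jump 1" for x using that by (simp add: jump_0)
  show ?thesis
    unfolding Let_def ftilde_eq ptop_def[symmetric]
  proof (intro exI[of _ jump_count] exI[of _ jump] exI[of _ return_slope] conjI allI impI ballI)
    show "jump 0 = 0" by (rule jump_0)
    show "0 < ptop" "ptop < jump 1" using ptop ptop_less_jump[of 0] by auto
    show "jump (Suc n) = pmax" if "jump_count = enat n" for n
      using not_reached_count[OF that] by (simp add: jump_def)
    show "strict_mono_on {0<..<ptop} ?R"
    proof (rule monotone_onI)
      fix x y assume "x \<in> {0<..<ptop}" "y \<in> {0<..<ptop}" "x < y"
      then show "?R x < ?R y"
        using C_inc[of x y] ptop_less_jump[of 0] by (intro mono[OF zero_le] top_sub) auto
    qed
    show "strict_antimono_on {ptop<..<jump 1} ?R"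
    proof (rule monotone_onI)
      fix x y assume "x \<in> {ptop<..<jump 1}" "y \<in> {ptop<..<jump 1}" "x < y"
      then show "?R y < ?R x"
        using C_dec[of x y] ptop jump_le_pmax[of 1] by (intro mono[OF zero_le] top_sub) auto
    qed
    fix j assume j: "enat j \<le> jump_count"
    show "jump j < jump (Suc j)" by (rule jump_less[OF j])
    show "continuous_on (piece j) return_slope" by (rule return_slope_cont[OF j])
    show "(?R has_real_derivative return_slope x) (at x within piece j)" if "x \<in> piece j" for x
      by (rule deriv[OF j that])
    show "return_slope x = Delta a b h f (qp x)" if "x \<in> piece j" for x
      using R' piece_subset that by blast
  next
    fix j :: nat assume j1: "1 \<le> j" and j: "enat j \<le> jump_count"
    note J = jump_reached[OF j1 reached_if_le_count[OF j j1]]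
    have jp: "jump j \<in> piece j" using jump_less[OF j] by simp
    have j0: "0 < jump j" using ptop(1) J(1) by (rule less_trans)
    show "jump j < pmax" by (rule J(2))
    show "strict_antimono_on (piece j) ?R"
    proof (rule monotone_onI)
      fix x y assume xy: "x \<in> piece j" "y \<in> piece j" "x < y"
      have "C y < C x" using C_dec[of x y] xy J jump_le_pmax[of "Suc j"] by simp
      then show "?R y < ?R x" using xy by (intro mono[OF j])
    qed
    have within: "at (jump j) within piece j = at_right (jump j)"
      by (rule at_within_nhd[of _ "{..<jump (Suc j)}"]) (use jump_less[OF j] in auto)
    show "continuous (at_right (jump j)) ?R"
      using DERIV_continuous[OF deriv[OF j jp]] unfolding within .
    show "(?R \<longlongrightarrow> 0) (at_left (jump j))"
    proof (rule Lim_transform_eventually[OF return_value_left_limit[OF j j1]])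
      show "\<forall>\<^sub>F x in at_left (jump j). return_value x = ?R x"
        using eventually_at_left_real[OF j0] by eventually_elim (use R J in auto)
    qed
    show "?R 0 = ?R (jump j)"
      using R[of 0] R[of "jump j"] return_value_jump[OF j j1] pmax_pos J(2) j0 by simp
    show "\<exists>l r. (return_slope \<longlongrightarrow> l) (at_left (jump j)) \<and> (return_slope \<longlongrightarrow> r) (at_right (jump j)) \<and> l < r"
      by (rule return_slope_limits[OF j j1])
  qed
qed

end
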